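(* Let $k$ be a finite field and let $R=k[[x,y]]\big/\bigl(y\prod_{\alpha\in k}(x+\alpha y)\bigr)$. Then $$\mathrm{g}\ell\ell(R)=\mathrm{index}(R)+1=|k|+2.$$
   Context: Let $\mathfrak{m}$ be the maximal ideal of the Cohen-Macaulay local ring $R$. The generalized Loewy length $\mathrm{g}\ell\ell(R)$ is the smallest positive integer $n$ for which $\mathfrak{m}^n$ is contained in the ideal generated by some system of parameters of $R$. For a finitely generated $R$-module $M$, Auslander's $\delta$-invariant $\delta_R(M)$ is the smallest non-negative integer $n$ such that there is a surjective $R$-linear map $X\oplus R^n\to M$, where $X$ is a maximal Cohen-Macaulay $R$-module with no free direct summand ($X=0$ is allowed). The index of $R$ is $\mathrm{index}(R)=\inf\{n\ge 1 : \delta_R(R/\mathfrak{m}^n)=1\}$. (Known result of Ding: for a hypersurface ring $R=k[[x_1,\dots,x_n]]/(f)$ with $f\in(x_1,\dots,x_n)^r\setminus(x_1,\dots,x_n)^{r+1}$, the index equals the Hilbert-Samuel multiplicity, $\mathrm{index}(R)=e(R)=r$.) *)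

theory Defs
  imports
    "HOL-Algebra.Algebraic_Closure_Type"
    "HOL-Algebra.Ideal_Product"
    "HOL-Library.Extended_Nat"
begin

section \<open>Modules\<close>

text \<open>A record of type \<open>('a, 'b) module\<close> inherits the fields \<open>mult\<close> and \<open>one\<close> from the record of
  rings. They are not part of the module structure (the locale \<open>module\<close> does not constrain them),
  so they are left \<open>undefined\<close> below, and no definition in this theory looks at them.\<close>

definition mod_hom :: "('r, 'c) ring_scheme \<Rightarrow> ('r, 'a, 'd) module_scheme \<Rightarrow>
    ('r, 'b, 'e) module_scheme \<Rightarrow> ('a \<Rightarrow> 'b) set"
  where "mod_hom R M N = {h \<in> carrier M \<rightarrow> carrier N.
    (\<forall>u\<in>carrier M. \<forall>v\<in>carrier M. h (u \<oplus>\<^bsub>M\<^esub> v) = h u \<oplus>\<^bsub>N\<^esub> h v) \<and>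
    (\<forall>a\<in>carrier R. \<forall>u\<in>carrier M. h (a \<odot>\<^bsub>M\<^esub> u) = a \<odot>\<^bsub>N\<^esub> h u)}"

definition mod_isomorphic :: "('r, 'c) ring_scheme \<Rightarrow> ('r, 'a, 'd) module_scheme \<Rightarrow>
    ('r, 'b, 'e) module_scheme \<Rightarrow> bool"
  where "mod_isomorphic R M N \<longleftrightarrow> (\<exists>h \<in> mod_hom R M N. bij_betw h (carrier M) (carrier N))"

definition submodule_gen :: "('r, 'c) ring_scheme \<Rightarrow> ('r, 'a, 'd) module_scheme \<Rightarrow> 'a set \<Rightarrow> 'a set"
  where "submodule_gen R M S = \<Inter>{N. submodule N R M \<and> S \<subseteq> N}"

definition fin_gen_module :: "('r, 'c) ring_scheme \<Rightarrow> ('r, 'a, 'd) module_scheme \<Rightarrow> bool"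
  where "fin_gen_module R M \<longleftrightarrow> Module.module R M \<and>
    (\<exists>S. finite S \<and> S \<subseteq> carrier M \<and> submodule_gen R M S = carrier M)"

definition ideal_smult :: "('r, 'c) ring_scheme \<Rightarrow> 'r set \<Rightarrow> ('r, 'a, 'd) module_scheme \<Rightarrow> 'a set"
  where "ideal_smult R I M = submodule_gen R M {a \<odot>\<^bsub>M\<^esub> u | a u. a \<in> I \<and> u \<in> carrier M}"

text \<open>The ring \<open>R\<close> as a module over itself, the free module \<open>R\<^sup>n\<close>, the external direct sum,
  and the quotient \<open>M / N\<close> by a submodule.\<close>

definition regular_module :: "('r, 'c) ring_scheme \<Rightarrow> ('r, 'r) module"
  where "regular_module R = \<lparr>carrier = carrier R, monoid.mult = undefined, one = undefined,
    ring.zero = \<zero>\<^bsub>R\<^esub>, add = (\<oplus>\<^bsub>R\<^esub>), module.smult = (\<otimes>\<^bsub>R\<^esub>)\<rparr>"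

definition free_module :: "('r, 'c) ring_scheme \<Rightarrow> nat \<Rightarrow> ('r, nat \<Rightarrow> 'r) module"
  where "free_module R n = \<lparr>carrier = {..<n} \<rightarrow>\<^sub>E carrier R, monoid.mult = undefined, one = undefined,
    ring.zero = (\<lambda>i\<in>{..<n}. \<zero>\<^bsub>R\<^esub>), add = (\<lambda>u v. \<lambda>i\<in>{..<n}. u i \<oplus>\<^bsub>R\<^esub> v i),
    module.smult = (\<lambda>a u. \<lambda>i\<in>{..<n}. a \<otimes>\<^bsub>R\<^esub> u i)\<rparr>"

definition direct_sum_module :: "('r, 'a, 'd) module_scheme \<Rightarrow> ('r, 'b, 'e) module_scheme \<Rightarrow>
    ('r, 'a \<times> 'b) module"
  where "direct_sum_module M N = \<lparr>carrier = carrier M \<times> carrier N, monoid.mult = undefined,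
    one = undefined, ring.zero = (\<zero>\<^bsub>M\<^esub>, \<zero>\<^bsub>N\<^esub>),
    add = (\<lambda>(u, v) (u', v'). (u \<oplus>\<^bsub>M\<^esub> u', v \<oplus>\<^bsub>N\<^esub> v')),
    module.smult = (\<lambda>a (u, v). (a \<odot>\<^bsub>M\<^esub> u, a \<odot>\<^bsub>N\<^esub> v))\<rparr>"

definition quot_module :: "('r, 'a, 'd) module_scheme \<Rightarrow> 'a set \<Rightarrow> ('r, 'a set) module"
  where "quot_module M N = \<lparr>carrier = a_rcosets\<^bsub>M\<^esub> N, monoid.mult = undefined, one = undefined,
    ring.zero = N, add = set_add M, module.smult = (\<lambda>a C. \<Union>c\<in>C. N +>\<^bsub>M\<^esub> (a \<odot>\<^bsub>M\<^esub> c))\<rparr>"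


section \<open>Local rings, dimension, systems of parameters\<close>

text \<open>Only meaningful for a ring with exactly one maximal ideal, i.e. a local ring.\<close>

definition max_ideal :: "('r, 'c) ring_scheme \<Rightarrow> 'r set"
  where "max_ideal R = (THE m. maximalideal m R)"

abbreviation ideal_power :: "('r, 'c) ring_scheme \<Rightarrow> 'r set \<Rightarrow> nat \<Rightarrow> 'r set"
  where "ideal_power R I n \<equiv> I [^]\<^bsub>ideals_set R\<^esub> n"

definition krull_dim :: "('r, 'c) ring_scheme \<Rightarrow> enat"
  where "krull_dim R = Sup {enat n | n. \<exists>P :: nat \<Rightarrow> 'r set.
    (\<forall>i\<le>n. primeideal (P i) R) \<and> (\<forall>i<n. P i \<subset> P (Suc i))}"

definition ideal_radical :: "('r, 'c) ring_scheme \<Rightarrow> 'r set \<Rightarrow> 'r set"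
  where "ideal_radical R I = {a \<in> carrier R. \<exists>n::nat. a [^]\<^bsub>R\<^esub> n \<in> I}"

definition primary_ideal :: "'r set \<Rightarrow> ('r, 'c) ring_scheme \<Rightarrow> bool"
  where "primary_ideal Q R \<longleftrightarrow> ideal Q R \<and> Q \<noteq> carrier R \<and>
    (\<forall>a\<in>carrier R. \<forall>b\<in>carrier R. a \<otimes>\<^bsub>R\<^esub> b \<in> Q \<longrightarrow> a \<in> Q \<or> b \<in> ideal_radical R Q)"

text \<open>A system of parameters: \<open>dim R\<close> elements of the maximal ideal \<open>m\<close> that generate an
  \<open>m\<close>-primary ideal.\<close>

definition system_of_parameters :: "('r, 'c) ring_scheme \<Rightarrow> 'r list \<Rightarrow> bool"
  where "system_of_parameters R xs \<longleftrightarrow>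
    set xs \<subseteq> max_ideal R \<and> enat (length xs) = krull_dim R \<and>
    primary_ideal (Idl\<^bsub>R\<^esub> (set xs)) R \<and> ideal_radical R (Idl\<^bsub>R\<^esub> (set xs)) = max_ideal R"

text \<open>The infimum of a set of positive integers is taken in \<^typ>\<open>enat\<close>; it is the least element
  if the set is non-empty, and \<open>\<infinity>\<close> otherwise. The same applies to the two invariants below.\<close>

definition gen_loewy_length :: "('r, 'c) ring_scheme \<Rightarrow> enat"
  where "gen_loewy_length R = Inf {enat n | n. n \<ge> 1 \<and>
    (\<exists>xs. system_of_parameters R xs \<and> ideal_power R (max_ideal R) n \<subseteq> Idl\<^bsub>R\<^esub> (set xs))}"


section \<open>Maximal Cohen-Macaulay modules\<close>

definition regular_sequence :: "('r, 'c) ring_scheme \<Rightarrow> ('r, 'a, 'd) module_scheme \<Rightarrow> 'r list \<Rightarrow> bool"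
  where "regular_sequence R M xs \<longleftrightarrow> set xs \<subseteq> carrier R \<and>
    (\<forall>i<length xs. let Q = quot_module M (ideal_smult R (Idl\<^bsub>R\<^esub> (set (take i xs))) M) in
       \<forall>u\<in>carrier Q. (xs ! i) \<odot>\<^bsub>Q\<^esub> u = \<zero>\<^bsub>Q\<^esub> \<longrightarrow> u = \<zero>\<^bsub>Q\<^esub>) \<and>
    ideal_smult R (Idl\<^bsub>R\<^esub> (set xs)) M \<noteq> carrier M"

text \<open>The depth of a nonzero finitely generated module over a Noetherian local ring.\<close>

definition module_depth :: "('r, 'c) ring_scheme \<Rightarrow> ('r, 'a, 'd) module_scheme \<Rightarrow> enat"
  where "module_depth R M =
    Sup {enat (length xs) | xs. set xs \<subseteq> max_ideal R \<and> regular_sequence R M xs}"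

text \<open>As usual, the zero module counts as maximal Cohen-Macaulay.\<close>

definition max_cohen_macaulay :: "('r, 'c) ring_scheme \<Rightarrow> ('r, 'a, 'd) module_scheme \<Rightarrow> bool"
  where "max_cohen_macaulay R M \<longleftrightarrow> fin_gen_module R M \<and>
    (carrier M = {\<zero>\<^bsub>M\<^esub>} \<or> module_depth R M = krull_dim R)"

definition no_free_summand :: "('r, 'c) ring_scheme \<Rightarrow> ('r, 'a, 'd) module_scheme \<Rightarrow> bool"
  where "no_free_summand R M \<longleftrightarrow>
    \<not> (\<exists>F N n. submodule F R M \<and> submodule N R M \<and>
        F \<inter> N = {\<zero>\<^bsub>M\<^esub>} \<and> F <+>\<^bsub>M\<^esub> N = carrier M \<and>
        n \<ge> 1 \<and> mod_isomorphic R (M\<lparr>carrier := F\<rparr>) (free_module R n))"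


section \<open>The delta invariant and the index\<close>

text \<open>The module \<open>W\<close> ranges over the modules whose elements are sets of functions from
  \<^typ>\<open>nat\<close> to \<open>R\<close>. This is no restriction: every finitely generated module is isomorphic to a
  quotient of some \<open>R\<^sup>n\<close>, whose elements are cosets in \<open>R\<^sup>n\<close>; see
  \<open>fin_gen_module_representable\<close> below.\<close>

definition delta_invariant :: "('r, 'c) ring_scheme \<Rightarrow> ('r, 'a, 'd) module_scheme \<Rightarrow> enat"
  where "delta_invariant R M = Inf {enat n | n. \<exists>(W :: ('r, (nat \<Rightarrow> 'r) set) module) h.
    max_cohen_macaulay R W \<and> no_free_summand R W \<and>
    h \<in> mod_hom R (direct_sum_module W (free_module R n)) M \<and>
    h ` carrier (direct_sum_module W (free_module R n)) = carrier M}"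

definition ring_index :: "('r, 'c) ring_scheme \<Rightarrow> enat"
  where "ring_index R = Inf {enat n | n. n \<ge> 1 \<and>
    delta_invariant R (quot_module (regular_module R) (ideal_power R (max_ideal R) n)) = 1}"


section \<open>Every finitely generated module occurs in the universe used for the delta invariant\<close>

lemma module_transport:
  fixes R (structure) and M :: "('r, 'a, 'd) module_scheme" and g :: "'a \<Rightarrow> 'b"
  assumes M: "Module.module R M" and g: "inj_on g (carrier M)"
  shows "\<exists>W :: ('r, 'b) module. Module.module R W \<and> mod_isomorphic R W M"
proof -
  interpret M: Module.module R M by (rule M)
  define i where "i = the_inv_into (carrier M) g"
  define W :: "('r, 'b) module" where "W = \<lparr>carrier = g ` carrier M, monoid.mult = undefined,
    one = undefined, ring.zero = g \<zero>\<^bsub>M\<^esub>, add = (\<lambda>u v. g (i u \<oplus>\<^bsub>M\<^esub> i v)),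
    module.smult = (\<lambda>a u. g (a \<odot>\<^bsub>M\<^esub> i u))\<rparr>"
  have i: "i (g u) = u" if "u \<in> carrier M" for u
    using that g by (simp add: i_def the_inv_into_f_f)
  have "abelian_group W"
  proof (rule abelian_groupI)
    fix x assume "x \<in> carrier W"
    then obtain u where u: "u \<in> carrier M" "x = g u" by (auto simp: W_def)
    have "g (\<ominus>\<^bsub>M\<^esub> u) \<in> carrier W \<and> g (\<ominus>\<^bsub>M\<^esub> u) \<oplus>\<^bsub>W\<^esub> x = \<zero>\<^bsub>W\<^esub>"
      using u by (simp add: W_def i M.M.l_neg)
    then show "\<exists>y\<in>carrier W. y \<oplus>\<^bsub>W\<^esub> x = \<zero>\<^bsub>W\<^esub>" by blast
  qed (auto simp: W_def i M.M.a_ac)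
  then have "Module.module R W"
    by (rule moduleI[OF M.is_cring])
       (auto simp: W_def i M.smult_l_distr M.smult_r_distr M.smult_assoc1)
  moreover have "i \<in> mod_hom R W M"
    by (auto simp: mod_hom_def W_def i)
  moreover have "bij_betw i (carrier W) (carrier M)"
    by (rule bij_betw_byWitness[where f' = g]) (auto simp: W_def i)
  ultimately show ?thesis
    unfolding mod_isomorphic_def by blast
qed

lemma fin_gen_module_representable:
  fixes R (structure) and M :: "('r, 'a, 'd) module_scheme"
  assumes "fin_gen_module R M"
  shows "\<exists>W :: ('r, (nat \<Rightarrow> 'r) set) module. Module.module R W \<and> mod_isomorphic R W M"
proof -
  from assms obtain S where M: "Module.module R M" and S: "finite S" "S \<subseteq> carrier M"
    and gen: "submodule_gen R M S = carrier M"
    by (auto simp: fin_gen_module_def)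
  interpret M: Module.module R M by (rule M)
  obtain s :: "nat \<Rightarrow> 'a" and n where s: "S = s ` {..<n}"
    using finite_imp_nat_seg_image_inj_on[OF S(1)] by (auto simp: lessThan_def)
  define L where "L f = (\<Oplus>\<^bsub>M\<^esub>j\<in>{..<n}. f j \<odot>\<^bsub>M\<^esub> s j)" for f :: "nat \<Rightarrow> 'r"
  have sc: "s j \<in> carrier M" if "j < n" for j
    using that S(2) s by auto
  define N where "N = L ` (UNIV \<rightarrow> carrier R)"
  have L_closed: "L f \<in> carrier M" if "f \<in> UNIV \<rightarrow> carrier R" for f
    unfolding L_def using that sc by (intro M.M.finsum_closed) auto
  have "submodule N R M"
  proof (rule M.submoduleI)
    show "N \<subseteq> carrier M" using L_closed by (auto simp: N_def)
    have "L (\<lambda>_. \<zero>) = (\<Oplus>\<^bsub>M\<^esub>j\<in>{..<n}. \<zero>\<^bsub>M\<^esub>)"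
      unfolding L_def using sc by (intro M.M.finsum_cong') auto
    then have "\<zero>\<^bsub>M\<^esub> = L (\<lambda>_. \<zero>)" by simp
    then show "\<zero>\<^bsub>M\<^esub> \<in> N" by (auto simp: N_def)
    have sm: "a \<odot>\<^bsub>M\<^esub> u \<in> N" if a: "a \<in> carrier R" and "u \<in> N" for a u
    proof -
      from \<open>u \<in> N\<close> obtain f where f: "f \<in> UNIV \<rightarrow> carrier R" and u: "u = L f" by (auto simp: N_def)
      have "a \<odot>\<^bsub>M\<^esub> L f = (\<Oplus>\<^bsub>M\<^esub>j\<in>{..<n}. a \<odot>\<^bsub>M\<^esub> (f j \<odot>\<^bsub>M\<^esub> s j))"
        unfolding L_def using a f sc by (intro M.finsum_smult_ldistr) auto
      also have "\<dots> = L (\<lambda>j. a \<otimes> f j)"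
        unfolding L_def using a f sc by (intro M.M.finsum_cong') (auto simp: M.smult_assoc1 Pi_iff)
      finally show ?thesis using a f u by (auto simp: N_def)
    qed
    show "a \<odot>\<^bsub>M\<^esub> u \<in> N" if "a \<in> carrier R" "u \<in> N" for a u
      using that by (rule sm)
    show "\<ominus>\<^bsub>M\<^esub> u \<in> N" if "u \<in> N" for u
      using sm[of "\<ominus> \<one>" u] that \<open>N \<subseteq> carrier M\<close> by (auto simp: M.smult_l_minus subset_iff)
    show "u \<oplus>\<^bsub>M\<^esub> v \<in> N" if "u \<in> N" "v \<in> N" for u v
    proof -
      from that obtain f h where f: "f \<in> UNIV \<rightarrow> carrier R" "u = L f"
        and h: "h \<in> UNIV \<rightarrow> carrier R" "v = L h" by (auto simp: N_def)
      have "L (\<lambda>j. f j \<oplus> h j) = (\<Oplus>\<^bsub>M\<^esub>j\<in>{..<n}. f j \<odot>\<^bsub>M\<^esub> s j \<oplus>\<^bsub>M\<^esub> h j \<odot>\<^bsub>M\<^esub> s j)"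
        unfolding L_def using f h sc by (intro M.M.finsum_cong') (auto simp: M.smult_l_distr Pi_iff)
      also have "\<dots> = L f \<oplus>\<^bsub>M\<^esub> L h"
        unfolding L_def using f h sc by (intro M.M.finsum_addf) auto
      finally show ?thesis using f h by (auto simp: N_def intro!: rev_image_eqI[of "\<lambda>j. f j \<oplus> h j"])
    qed
  qed
  moreover have "S \<subseteq> N"
  proof
    fix u assume "u \<in> S"
    then obtain j where j: "j < n" "u = s j" using s by auto
    have "L (\<lambda>l. if j = l then \<one> else \<zero>) = (\<Oplus>\<^bsub>M\<^esub>l\<in>{..<n}. if j = l then s l else \<zero>\<^bsub>M\<^esub>)"
      unfolding L_def using sc by (intro M.M.finsum_cong') auto
    also have "\<dots> = u"
      using j sc by (subst M.M.finsum_singleton) auto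
    finally show "u \<in> N"
      by (auto simp: N_def intro!: rev_image_eqI[of "\<lambda>l. if j = l then \<one> else \<zero>"])
  qed
  ultimately have "carrier M \<subseteq> N"
    using gen by (auto simp: submodule_gen_def)
  then have "inj_on (\<lambda>u. {f \<in> UNIV \<rightarrow> carrier R. L f = u}) (carrier M)"
  proof (intro inj_onI)
    fix u v assume uv: "u \<in> carrier M" "v \<in> carrier M"
      "{f \<in> UNIV \<rightarrow> carrier R. L f = u} = {f \<in> UNIV \<rightarrow> carrier R. L f = v}"
    with \<open>carrier M \<subseteq> N\<close> obtain f where "f \<in> UNIV \<rightarrow> carrier R" "L f = u"
      unfolding N_def by blast
    with uv(3) show "u = v" by blast
  qed
  then show ?thesis
    by (rule module_transport[OF M])
qed

end

theory Submission
  imports Defs "HOL-Library.Cardinality"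
begin

text \<open>
  Let \<open>q\<close> be the number of elements of \<open>k\<close>, let \<open>S = k[[x, y]]\<close> with maximal ideal \<open>n = (x, y)\<close>, and
  let \<open>f\<close> be the product of all \<open>q + 1\<close> lines through the origin that are defined over \<open>k\<close>. Then
  \<open>R = S/(f)\<close>, the order of \<open>f\<close> is \<open>q + 1\<close>, and \<open>R\<close> has dimension one, because a prime of \<open>R\<close>
  contains one of the lines \<open>l\<close> and \<open>S/(l)\<close> is the discrete valuation ring \<open>k[[t]]\<close>.

  The generalized Loewy length is \<open>q + 2\<close>. The parabola \<open>z = x - y\<^sup>2\<close> is tangent to the line \<open>x = 0\<close>
  and transversal to the \<open>q\<close> other lines, so it meets \<open>f\<close> with multiplicity \<open>q + 2\<close>; hence
  \<open>n\<^bsup>q+2\<^esup>\<close> lies in \<open>(z, f)\<close> (\<open>mpow_parabola_arrangement\<close>). No parameter \<open>h\<close> does better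
  (\<open>mpow_not_in_principal\<close>): if \<open>n\<^bsup>q+1\<^esup>\<close> were contained in \<open>(h, f)\<close>, then every form of degree \<open>q + 1\<close>
  would be a combination of \<open>f\<close> and multiples of the initial form of \<open>h\<close>. These forms have dimension
  \<open>q + 2\<close>, whereas the multiples of a form of degree \<open>d\<close> have dimension \<open>q + 2 - d\<close>. This excludes
  \<open>d \<ge> 2\<close>. If \<open>d = 1\<close>, the initial form of \<open>h\<close> is a line over \<open>k\<close>, so it divides \<open>f\<close>, and \<open>f\<close> adds
  nothing. Since \<open>k\<close> is finite, the dimensions can be read off from cardinalities.

  The index is \<open>q + 1\<close>. The free module of rank one shows that the \<open>\<delta>\<close>-invariant of \<open>R/n\<^sup>j\<close> is at most
  one, so the question is for which \<open>j\<close> it vanishes. For \<open>j \<le> q\<close> it does: if \<open>g\<close> is the product of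
  the \<open>q\<close> lines other than \<open>y = 0\<close>, then \<open>S/(g)\<close> is maximal Cohen-Macaulay, it has no free summand
  because \<open>g\<close> kills it, and it maps onto \<open>R/n\<^sup>j\<close> because \<open>g\<close> has order \<open>q\<close>.

  For \<open>j = q + 1\<close> it does not (\<open>no_mcm_cover\<close>). Let \<open>W\<close> be maximal Cohen-Macaulay without free summand
  and let \<open>\<phi>\<close> map \<open>W\<close> to \<open>S/n\<^bsup>q+1\<^esup>\<close> with \<open>\<phi> w\<^sub>0 = 1\<close>. In the coordinates \<open>z, y\<close> write
  \<open>f = z\<rho> + y\<sigma>\<close>, where \<open>z\<rho>\<close> is the part of \<open>f\<close> free of \<open>y\<close>. The element \<open>z\<close> acts injectively on \<open>W\<close>.
  If \<open>\<sigma>w\<^sub>0\<close> were not in \<open>zW\<close>, a \<open>k\<close>-linear functional on \<open>W/zW\<close> that is nonzero at \<open>\<sigma>w\<^sub>0\<close> would lift to an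
  \<open>R\<close>-linear map \<open>W \<rightarrow> R\<close> whose value at \<open>w\<^sub>0\<close> is a unit (\<open>linear_map_to_hypersurface\<close>), and \<open>R\<close> would be
  a summand of \<open>W\<close>. So \<open>\<sigma>w\<^sub>0 = zw\<^sub>1\<close> for some \<open>w\<^sub>1\<close>, and \<open>fw\<^sub>0 = 0\<close> gives \<open>\<rho>w\<^sub>0 = -yw\<^sub>1\<close>. Applying \<open>\<phi>\<close>, with
  \<open>r = \<phi> w\<^sub>1\<close>, yields \<open>\<sigma> = zr\<close> and \<open>\<rho> = -yr\<close> modulo \<open>n\<^bsup>q+1\<^esup>\<close>. Therefore \<open>f = z\<rho> + y\<sigma>\<close> vanishes modulo
  \<open>n\<^bsup>q+2\<^esup>\<close>, which contradicts that its order is \<open>q + 1\<close>.\<close>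

section \<open>Power series in two variables\<close>

text \<open>The ring \<open>k[[x, y]]\<close> is \<open>k[[x]][[y]]\<close>: the inner variable is \<open>x\<close>, the outer one is \<open>y\<close>, and the
  coefficient of \<open>x\<^sup>iy\<^sup>j\<close> in \<open>s\<close> is \<open>s $ j $ i\<close>.\<close>

abbreviation px :: "'k::comm_ring_1 fps fps" where "px \<equiv> fps_const fps_X"
abbreviation py :: "'k::comm_ring_1 fps fps" where "py \<equiv> fps_X"
abbreviation kc :: "'k::comm_ring_1 \<Rightarrow> 'k fps fps" where "kc c \<equiv> fps_const (fps_const c)"

text \<open>The power \<open>(x, y)\<^sup>n\<close> of the maximal ideal, described by coefficients; \<open>mpow_SucE\<close> below is the
  link with products of ideals.\<close>

definition mpow :: "nat \<Rightarrow> 'k::comm_ring_1 fps fps set"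
  where "mpow n = {s. \<forall>i j. i + j < n \<longrightarrow> s $ j $ i = 0}"

lemma mpow_0 [simp]: "mpow 0 = UNIV" by (simp add: mpow_def)

lemma mpow_mono: "n \<le> m \<Longrightarrow> s \<in> mpow m \<Longrightarrow> s \<in> mpow n"
  by (auto simp: mpow_def)

lemma mpow_zero [simp]: "0 \<in> mpow n" by (simp add: mpow_def)
lemma mpow_add: "s \<in> mpow n \<Longrightarrow> t \<in> mpow n \<Longrightarrow> s + t \<in> mpow n" by (simp add: mpow_def)
lemma mpow_diff: "s \<in> mpow n \<Longrightarrow> t \<in> mpow n \<Longrightarrow> s - t \<in> mpow n" by (simp add: mpow_def)
lemma mpow_uminus: "s \<in> mpow n \<Longrightarrow> - s \<in> mpow n" by (simp add: mpow_def)

lemma fps2_mult_nth: "(s * t) $ j $ i = (\<Sum>b=0..j. \<Sum>a=0..i. s $ b $ a * t $ (j - b) $ (i - a))"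
  for s t :: "'k::comm_ring_1 fps fps"
  by (simp add: fps_mult_nth fps_sum_nth)

lemma mpow_mult:
  fixes s t :: "'k::comm_ring_1 fps fps"
  assumes "s \<in> mpow m" "t \<in> mpow n" shows "s * t \<in> mpow (m + n)"
  unfolding mpow_def
proof (intro CollectI allI impI)
  fix i j :: nat assume ij: "i + j < m + n"
  have "s $ b $ a * t $ (j - b) $ (i - a) = 0" if "b \<le> j" "a \<le> i" for a b
  proof -
    have "a + b < m \<or> (i - a) + (j - b) < n" using that ij by linarith
    then show ?thesis using assms by (auto simp: mpow_def)
  qed
  then show "(s * t) $ j $ i = 0" by (simp add: fps2_mult_nth)
qed

lemma mpow_mult_left: "t \<in> mpow n \<Longrightarrow> s * t \<in> mpow n"
  and mpow_mult_right: "t \<in> mpow n \<Longrightarrow> t * s \<in> mpow n"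
  using mpow_mult[of s 0 t n] mpow_mult[of t n s 0] by simp_all

lemma px_mpow: "px \<in> mpow 1" and py_mpow: "py \<in> mpow 1"
  by (auto simp: mpow_def fps_X_def)

lemma mpow_eq_0: "(\<And>n. s \<in> mpow n) \<Longrightarrow> s = 0"
proof (intro fps_ext)
  fix i j assume "\<And>n. s \<in> mpow n"
  from this[of "Suc (i + j)"] show "s $ j $ i = 0 $ j $ i" by (simp add: mpow_def)
qed

lemma mpow_eqI: "(\<And>n. s - t \<in> mpow n) \<Longrightarrow> s = t"
  using mpow_eq_0[of "s - t"] by simp

abbreviation shx :: "'k::comm_ring_1 fps fps \<Rightarrow> 'k fps fps" where
  "shx s \<equiv> fps_const (fps_shift 1 (s $ 0))"

text \<open>Every series is a constant plus a multiple of \<open>x\<close> plus a multiple of \<open>y\<close>. With \<open>mpow_eqI\<close> this gives a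
  proof principle for identities between additive operators: if the difference of the two sides at \<open>s\<close>
  is expressed through the differences at the two quotients, multiplied by elements of the maximal
  ideal, then it lies in every power of that ideal.\<close>

lemma ps_decomp: "s = kc (s $ 0 $ 0) + px * shx s + py * fps_shift 1 s"
  for s :: "'k::comm_ring_1 fps fps"
proof -
  have "s $ 0 = fps_const (s $ 0 $ 0) + fps_X * fps_shift 1 (s $ 0)"
    by (rule fps_ext) (simp add: fps_X_mult_nth)
  moreover have "s = fps_const (s $ 0) + py * fps_shift 1 s"
    by (rule fps_ext) (simp add: fps_X_mult_nth)
  ultimately have "s = fps_const (fps_const (s $ 0 $ 0) + fps_X * fps_shift 1 (s $ 0)) + py * fps_shift 1 s"
    by (simp only: )
  then show ?thesis by (simp only: fps_const_add [symmetric] fps_const_mult [symmetric])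
qed

lemma mpow_shift: "s \<in> mpow (Suc n) \<Longrightarrow> shx s \<in> mpow n"
   "s \<in> mpow (Suc n) \<Longrightarrow> fps_shift 1 s \<in> mpow n"
  by (auto simp: mpow_def)

lemma mpow_SucE:
  assumes "s \<in> mpow (Suc n)"
  obtains a b where "a \<in> mpow n" "b \<in> mpow n" "s = px * a + py * b"
proof -
  have "s $ 0 $ 0 = 0" using assms by (auto simp: mpow_def)
  then show ?thesis using ps_decomp[of s] mpow_shift[OF assms] that by auto
qed

lemma mpow_1_iff: "s \<in> mpow 1 \<longleftrightarrow> s $ 0 $ 0 = 0"
  by (auto simp: mpow_def)

section \<open>Substitution homomorphisms\<close>

text \<open>Changes of coordinates on \<open>k[[x, y]]\<close> are needed, for instance \<open>x \<mapsto> x + y\<^sup>2\<close>, where the image of the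
  inner variable involves the outer one. The substitution \<open>x \<mapsto> u\<close>, \<open>y \<mapsto> v\<close> is the limit of the
  approximations that unfold the decomposition of a series \<open>n\<close> times; it converges as
  soon as \<open>u\<close> and \<open>v\<close> lie in the maximal ideal.\<close>

primrec psubst_approx :: "'k::comm_ring_1 fps fps \<Rightarrow> 'k fps fps \<Rightarrow> nat \<Rightarrow> 'k fps fps \<Rightarrow> 'k fps fps" where
  "psubst_approx u v 0 s = 0"
| "psubst_approx u v (Suc n) s =
     kc (s $ 0 $ 0) + u * psubst_approx u v n (shx s) + v * psubst_approx u v n (fps_shift 1 s)"

definition psubst :: "'k::comm_ring_1 fps fps \<Rightarrow> 'k fps fps \<Rightarrow> 'k fps fps \<Rightarrow> 'k fps fps" where
  "psubst u v s = Abs_fps (\<lambda>j. Abs_fps (\<lambda>i. psubst_approx u v (Suc (i + j)) s $ j $ i))"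

locale ps_substitution =
  fixes u v :: "'k::comm_ring_1 fps fps"
  assumes u: "u \<in> mpow 1" and v: "v \<in> mpow 1"
begin

lemma uv_mult: "s \<in> mpow n \<Longrightarrow> u * s \<in> mpow (Suc n)" "s \<in> mpow n \<Longrightarrow> v * s \<in> mpow (Suc n)"
  using mpow_mult[OF u] mpow_mult[OF v] by simp_all

lemma approx_step: "psubst_approx u v (Suc n) s - psubst_approx u v n s \<in> mpow n"
proof (induction n arbitrary: s)
  case (Suc n)
  let ?d = "\<lambda>t. psubst_approx u v (Suc n) t - psubst_approx u v n t"
  have "psubst_approx u v (Suc (Suc n)) s - psubst_approx u v (Suc n) s
      = u * ?d (shx s) + v * ?d (fps_shift 1 s)"
    unfolding psubst_approx.simps(2)[of u v "Suc n" s] psubst_approx.simps(2)[of u v n s]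
    by (simp only: algebra_simps)
  then show ?case using Suc.IH by (simp only: mpow_add uv_mult)
qed simp

lemma approx_mono: "n \<le> m \<Longrightarrow> psubst_approx u v m s - psubst_approx u v n s \<in> mpow n"
proof (induction rule: dec_induct)
  case (step m)
  have "psubst_approx u v (Suc m) s - psubst_approx u v m s \<in> mpow n"
    using approx_step step.hyps(1) mpow_mono by blast
  from mpow_add[OF this step.IH] show ?case by (simp del: psubst_approx.simps)
qed simp

lemma psubst_approx: "psubst u v s - psubst_approx u v n s \<in> mpow n"
  unfolding mpow_def
proof (intro CollectI allI impI)
  fix i j :: nat assume "i + j < n"
  then have "psubst_approx u v n s - psubst_approx u v (Suc (i + j)) s \<in> mpow (Suc (i + j))"
    by (intro approx_mono) simp
  then show "(psubst u v s - psubst_approx u v n s) $ j $ i = 0"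
    by (simp add: mpow_def psubst_def del: psubst_approx.simps)
qed

lemma psubst_rec: "psubst u v s = kc (s $ 0 $ 0) + u * psubst u v (shx s) + v * psubst u v (fps_shift 1 s)"
proof (rule mpow_eqI)
  fix n
  let ?d = "\<lambda>t. psubst u v t - psubst_approx u v n t"
  have "psubst u v s - psubst_approx u v (Suc n) s \<in> mpow n"
    using psubst_approx[of s "Suc n"] mpow_mono[of n "Suc n"] by simp
  moreover have "u * ?d (shx s) + v * ?d (fps_shift 1 s) \<in> mpow n"
    by (intro mpow_add mpow_mult_left psubst_approx)
  ultimately have "(psubst u v s - psubst_approx u v (Suc n) s)
      - (u * ?d (shx s) + v * ?d (fps_shift 1 s)) \<in> mpow n" by (rule mpow_diff)
  then show "psubst u v s - (kc (s $ 0 $ 0) + u * psubst u v (shx s) + v * psubst u v (fps_shift 1 s)) \<in> mpow n"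
    by (simp add: algebra_simps)
qed

lemma approx_add: "psubst_approx u v n (s + t) = psubst_approx u v n s + psubst_approx u v n t"
proof (induction n arbitrary: s t)
  case (Suc n)
  have "shx (s + t) = shx s + shx t" "fps_shift 1 (s + t) = fps_shift 1 s + fps_shift 1 t"
    by (simp_all add: fps_shift_add)
  with Suc show ?case
    by (simp only: psubst_approx.simps) (simp add: algebra_simps flip: fps_const_add)
qed simp

lemma psubst_add: "psubst u v (s + t) = psubst u v s + psubst u v t"
  by (intro fps_ext) (simp add: psubst_def approx_add del: psubst_approx.simps)

lemma psubst_0: "psubst u v 0 = 0"
  using psubst_add[of 0 0] by simp

lemma psubst_uminus: "psubst u v (- s) = - psubst u v s"
  using psubst_add[of s "- s"] psubst_0 by (simp add: eq_neg_iff_add_eq_0 add.commute)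

lemma psubst_diff: "psubst u v (s - t) = psubst u v s - psubst u v t"
  using psubst_add[of s "- t"] psubst_uminus by simp

lemma psubst_kc: "psubst u v (kc c) = kc c"
  by (subst psubst_rec) (simp add: psubst_0 fps_shift_fps_const)

lemma psubst_1: "psubst u v 1 = 1"
  using psubst_kc[of 1] by simp

lemma psubst_py_mult: "psubst u v (py * s) = v * psubst u v s"
proof -
  have "fps_shift 1 (py * s) = s" by (simp add: fps_eq_iff)
  then show ?thesis by (subst psubst_rec) (simp add: psubst_0)
qed

lemma psubst_px_mult: "psubst u v (px * s) = u * psubst u v s"
proof (rule mpow_eqI)
  show "psubst u v (px * s) - u * psubst u v s \<in> mpow n" for n
  proof (induction n arbitrary: s)
    case (Suc n)
    have sh: "fps_shift 1 (px * s) = px * fps_shift 1 s" "shx (px * s) = fps_const (s $ 0)"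
      by (simp_all add: fps_eq_iff fps_X_mult_nth)
    have 1: "psubst u v (px * s) = u * psubst u v (fps_const (s $ 0)) + v * psubst u v (px * fps_shift 1 s)"
      by (subst psubst_rec) (simp only: sh, simp)
    have "s = fps_const (s $ 0) + py * fps_shift 1 s"
      by (rule fps_ext) (simp add: fps_X_mult_nth)
    then have 2: "psubst u v s = psubst u v (fps_const (s $ 0)) + v * psubst u v (fps_shift 1 s)"
      by (metis psubst_add psubst_py_mult)
    (* Both sides agree on the part of s that is free of y, so only the quotient by y remains. *)
    have "psubst u v (px * s) - u * psubst u v s
        = v * (psubst u v (px * fps_shift 1 s) - u * psubst u v (fps_shift 1 s))"
      unfolding 1 2 by (simp add: algebra_simps)
    then show ?case using Suc by (simp only: uv_mult)
  qed simp
qed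

lemma psubst_px: "psubst u v px = u" and psubst_py: "psubst u v py = v"
  using psubst_px_mult[of 1] psubst_py_mult[of 1] by (simp_all add: psubst_1)

lemma psubst_kc_mult: "psubst u v (kc c * s) = kc c * psubst u v s"
proof (rule mpow_eqI)
  show "psubst u v (kc c * s) - kc c * psubst u v s \<in> mpow n" for n
  proof (induction n arbitrary: s)
    case (Suc n)
    have sh: "fps_shift 1 (kc c * s) = kc c * fps_shift 1 s" "shx (kc c * s) = kc c * shx s"
      by (simp_all add: fps_eq_iff)
    have "psubst u v (kc c * s) - kc c * psubst u v s
        = u * (psubst u v (kc c * shx s) - kc c * psubst u v (shx s))
        + v * (psubst u v (kc c * fps_shift 1 s) - kc c * psubst u v (fps_shift 1 s))"
      by (subst (1 2) psubst_rec) (simp only: sh, simp add: algebra_simps)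
    then show ?case using Suc by (simp only: uv_mult mpow_add)
  qed simp
qed

lemma psubst_mult: "psubst u v (s * t) = psubst u v s * psubst u v t"
proof (rule mpow_eqI)
  show "psubst u v (s * t) - psubst u v s * psubst u v t \<in> mpow n" for n
  proof (induction n arbitrary: s)
    case (Suc n)
    define a b where "a = shx s" and "b = fps_shift 1 s"
    have s: "s = kc (s $ 0 $ 0) + px * a + py * b" unfolding a_def b_def by (rule ps_decomp)
    have "s * t = kc (s $ 0 $ 0) * t + px * (a * t) + py * (b * t)"
      by (subst s) (simp add: algebra_simps)
    then have "psubst u v (s * t) = kc (s $ 0 $ 0) * psubst u v t + u * psubst u v (a * t) + v * psubst u v (b * t)"
      by (simp only: psubst_add psubst_kc_mult psubst_px_mult psubst_py_mult)
    moreover have "psubst u v s = kc (s $ 0 $ 0) + u * psubst u v a + v * psubst u v b"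
      unfolding a_def b_def by (rule psubst_rec)
    ultimately have "psubst u v (s * t) - psubst u v s * psubst u v t
       = u * (psubst u v (a * t) - psubst u v a * psubst u v t) + v * (psubst u v (b * t) - psubst u v b * psubst u v t)"
      by (simp add: algebra_simps)
    then show ?case using Suc by (simp only: uv_mult mpow_add)
  qed simp
qed

lemma psubst_power: "psubst u v (s ^ n) = psubst u v s ^ n"
  by (induction n) (simp_all add: psubst_1 psubst_mult)

lemma psubst_mpow: "s \<in> mpow n \<Longrightarrow> psubst u v s \<in> mpow n"
proof (induction n arbitrary: s)
  case (Suc n)
  have "s $ 0 $ 0 = 0" using Suc.prems by (auto simp: mpow_def)
  moreover have "u * psubst u v (shx s) + v * psubst u v (fps_shift 1 s) \<in> mpow (Suc n)"
    by (intro mpow_add uv_mult Suc.IH mpow_shift Suc.prems)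
  ultimately show ?case by (subst psubst_rec) simp
qed simp

lemma psubst_const_coeff: "psubst u v s $ 0 $ 0 = s $ 0 $ 0"
proof -
  have "s - kc (s $ 0 $ 0) \<in> mpow 1" by (simp add: mpow_1_iff del: One_nat_def)
  from psubst_mpow[OF this] show ?thesis by (simp add: psubst_diff psubst_kc mpow_1_iff del: One_nat_def)
qed

end

text \<open>A composition of substitutions is the identity once it fixes both variables, since the difference
  with the identity is pushed into every power of the maximal ideal.\<close>

lemma psubst_inverse:
  assumes "ps_substitution u v" "ps_substitution u' v'"
    and xy: "psubst u v u' = px" "psubst u v v' = py"
  shows "psubst u v (psubst u' v' s) = s"
proof -
  interpret p: ps_substitution u v by fact
  interpret p': ps_substitution u' v' by fact
  show ?thesis
  proof (rule mpow_eqI)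
    show "psubst u v (psubst u' v' s) - s \<in> mpow n" for n
    proof (induction n arbitrary: s)
      case (Suc n)
      define a b where "a = shx s" and "b = fps_shift 1 s"
      have s: "s = kc (s $ 0 $ 0) + px * a + py * b" unfolding a_def b_def by (rule ps_decomp)
      have "psubst u v (psubst u' v' s) = kc (s $ 0 $ 0) + px * psubst u v (psubst u' v' a)
          + py * psubst u v (psubst u' v' b)"
        by (subst p'.psubst_rec)
           (simp only: p.psubst_add p.psubst_mult xy p.psubst_kc a_def b_def)
      then have "psubst u v (psubst u' v' s) - s = px * (psubst u v (psubst u' v' a) - a)
          + py * (psubst u v (psubst u' v' b) - b)"
        by (subst (2) s) (simp add: algebra_simps)
      then show ?case
        using mpow_mult[OF px_mpow Suc] mpow_mult[OF py_mpow Suc] by (simp add: mpow_add)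
    qed simp
  qed
qed

section \<open>Orders of products\<close>

text \<open>The order is additive, because the initial forms multiply without cancellation: among the
  monomials of the initial form of each factor take the one with the smallest exponent of \<open>x\<close>; the
  product of these two monomials arises in no other way.\<close>

lemma mpow_order_mult:
  fixes a h :: "'k::idom fps fps"
  assumes a: "a \<in> mpow c" "a \<notin> mpow (Suc c)" and h: "h \<in> mpow d" "h \<notin> mpow (Suc d)"
  shows "a * h \<notin> mpow (Suc (c + d))"
proof -
  have ex: "\<exists>i\<le>n. s $ (n - i) $ i \<noteq> 0" if "s \<in> mpow n" "s \<notin> mpow (Suc n)" for s :: "'k fps fps" and n
  proof -
    from that obtain i j where "i + j = n" "s $ j $ i \<noteq> 0"
      unfolding mpow_def by (auto simp: less_Suc_eq)
    then show ?thesis by (intro exI[of _ i]) auto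
  qed
  define i0 where "i0 = (LEAST i. i \<le> c \<and> a $ (c - i) $ i \<noteq> 0)"
  define i1 where "i1 = (LEAST i. i \<le> d \<and> h $ (d - i) $ i \<noteq> 0)"
  have i0: "i0 \<le> c \<and> a $ (c - i0) $ i0 \<noteq> 0"
    unfolding i0_def using ex[OF a] by (rule LeastI_ex)
  have i1: "i1 \<le> d \<and> h $ (d - i1) $ i1 \<noteq> 0"
    unfolding i1_def using ex[OF h] by (rule LeastI_ex)
  define I J where "I = i0 + i1" and "J = (c - i0) + (d - i1)"
  have IJ: "I + J = c + d" using i0 i1 by (simp add: I_def J_def)
  have z: "a $ q $ p * h $ (J - q) $ (I - p) = 0"
    if "p \<le> I" "q \<le> J" "(q, p) \<noteq> (c - i0, i0)" for p q
  proof (rule ccontr)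
    assume "\<not> ?thesis"
    then have ne: "a $ q $ p \<noteq> 0" "h $ (J - q) $ (I - p) \<noteq> 0" by auto
    then have "\<not> p + q < c" "\<not> (I - p) + (J - q) < d" using a(1) h(1) by (auto simp: mpow_def)
    with that IJ have pq: "p + q = c" "(I - p) + (J - q) = d" by linarith+
    then have q: "q = c - p" "J - q = d - (I - p)" by auto
    have "\<not> p < i0" using ne(1) pq(1) not_less_Least[of p "\<lambda>i. i \<le> c \<and> a $ (c - i) $ i \<noteq> 0"]
      unfolding i0_def[symmetric] q(1) by auto
    moreover have "\<not> I - p < i1" using ne(2) pq(2) not_less_Least[of "I - p" "\<lambda>i. i \<le> d \<and> h $ (d - i) $ i \<noteq> 0"]
      unfolding i1_def[symmetric] q(2) by auto
    ultimately have "p = i0" using that(1) by (simp add: I_def)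
    with that(3) pq(1) show False by auto
  qed
  have "(a * h) $ J $ I = (\<Sum>b=0..J. if b = c - i0 then a $ (c - i0) $ i0 * h $ (d - i1) $ i1 else 0)"
    unfolding fps2_mult_nth
  proof (rule sum.cong[OF refl])
    fix b assume b: "b \<in> {0..J}"
    have "(\<Sum>p=0..I. a $ b $ p * h $ (J - b) $ (I - p))
      = (\<Sum>p=0..I. if p = i0 then (if b = c - i0 then a $ (c - i0) $ i0 * h $ (d - i1) $ i1 else 0) else 0)"
    proof (rule sum.cong[OF refl])
      fix p assume p: "p \<in> {0..I}"
      show "a $ b $ p * h $ (J - b) $ (I - p)
        = (if p = i0 then (if b = c - i0 then a $ (c - i0) $ i0 * h $ (d - i1) $ i1 else 0) else 0)"
      proof (cases "(b, p) = (c - i0, i0)")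
        case True then show ?thesis by (simp add: I_def J_def)
      next
        case False then show ?thesis using z[of p b] p b by auto
      qed
    qed
    then show "(\<Sum>p=0..I. a $ b $ p * h $ (J - b) $ (I - p))
      = (if b = c - i0 then a $ (c - i0) $ i0 * h $ (d - i1) $ i1 else 0)"
      by (simp add: I_def)
  qed
  also have "\<dots> = a $ (c - i0) $ i0 * h $ (d - i1) $ i1" by (simp add: J_def)
  also have "\<dots> \<noteq> 0" using i0 i1 by simp
  finally have "(a * h) $ J $ I \<noteq> 0" .
  moreover have "I + J < Suc (c + d)" using IJ by simp
  ultimately show ?thesis unfolding mpow_def by blast
qed

lemma mpow_cancel:
  fixes a h :: "'k::idom fps fps"
  assumes h: "h \<in> mpow d" "h \<notin> mpow (Suc d)" and ah: "a * h \<in> mpow (c + d)"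
  shows "a \<in> mpow c"
proof (rule ccontr)
  assume "a \<notin> mpow c"
  then obtain m where m: "m < c" "a \<in> mpow m" "a \<notin> mpow (Suc m)"
    using ex_least_nat_less[of "\<lambda>n. a \<notin> mpow n" c] by auto
  then have "a * h \<notin> mpow (Suc (m + d))" using h by (intro mpow_order_mult)
  then show False using ah mpow_mono[of "Suc (m + d)" "c + d"] m(1) by auto
qed

section \<open>Hypersurface rings\<close>

lemma ps_unit:
  fixes s :: "'k::field fps fps"
  assumes "s $ 0 $ 0 \<noteq> 0" shows "\<exists>t. s * t = 1"
proof -
  have "s $ 0 * inverse (s $ 0) = 1" using assms by (rule inverse_mult_eq_1')
  then show ?thesis using fps_right_inverse by blast
qed

text \<open>The quotient of \<open>k[[x, y]]\<close> by a nonunit \<open>f\<close>. All computations in the quotient are carried out on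
  representatives: a class is \<open>proj s\<close>, and two classes agree iff \<open>f\<close> divides the difference.\<close>

locale hypersurface =
  fixes f :: "'k::field fps fps"
  assumes f_mpow: "f \<in> mpow 1"
begin

definition R :: "'k fps fps set ring" where
  "R = ring_of_type_algebra Quot (PIdl\<^bsub>ring_of_type_algebra\<^esub> f)"

definition proj :: "'k fps fps \<Rightarrow> 'k fps fps set" where
  "proj s = PIdl\<^bsub>ring_of_type_algebra\<^esub> f +>\<^bsub>ring_of_type_algebra\<^esub> s"

lemma type_ring [simp]: "carrier ring_of_type_algebra = (UNIV :: 'k fps fps set)"
  "(a :: 'k fps fps) \<oplus>\<^bsub>ring_of_type_algebra\<^esub> b = a + b" "a \<otimes>\<^bsub>ring_of_type_algebra\<^esub> b = a * b"
  "\<one>\<^bsub>ring_of_type_algebra\<^esub> = (1 :: 'k fps fps)" "\<zero>\<^bsub>ring_of_type_algebra\<^esub> = (0 :: 'k fps fps)"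
  by (simp_all add: ring_of_type_algebra_def)

lemma type_cring: "cring (ring_of_type_algebra :: 'k fps fps ring)"
  by (rule cring_from_type_algebra)

lemma ideal_f: "ideal (PIdl\<^bsub>ring_of_type_algebra\<^esub> f) ring_of_type_algebra"
  by (intro cring.cgenideal_ideal type_cring) simp

lemma cring_R: "cring R"
  unfolding R_def by (intro ideal.quotient_is_cring ideal_f type_cring)

sublocale R: cring R by (rule cring_R)

lemma proj_hom: "proj \<in> ring_hom ring_of_type_algebra R"
  using ideal.rcos_ring_hom[OF ideal_f] by (simp add: R_def proj_def[abs_def])

lemma carrier_R: "carrier R = range proj"
  by (auto simp: R_def proj_def[abs_def] FactRing_def A_RCOSETS_def RCOSETS_def a_r_coset_def)

lemma proj_closed [simp, intro]: "proj s \<in> carrier R" by (simp add: carrier_R)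
lemma proj_add: "proj (s + t) = proj s \<oplus>\<^bsub>R\<^esub> proj t" using ring_hom_add[OF proj_hom] by simp
lemma proj_mult: "proj (s * t) = proj s \<otimes>\<^bsub>R\<^esub> proj t" using ring_hom_mult[OF proj_hom] by simp
lemma proj_1: "proj 1 = \<one>\<^bsub>R\<^esub>" using ring_hom_one[OF proj_hom] by simp

lemma proj_0: "proj 0 = \<zero>\<^bsub>R\<^esub>"
  using proj_add[of 0 0] R.add.l_cancel_one'[of "proj 0" "proj 0"] by simp

lemma proj_uminus: "proj (- s) = \<ominus>\<^bsub>R\<^esub> proj s"
  by (rule R.minus_equality[symmetric]) (simp_all flip: proj_add add: proj_0)

lemma proj_power: "proj (s ^ n) = proj s [^]\<^bsub>R\<^esub> (n::nat)"
  by (induction n) (simp_all add: proj_1 proj_mult R.m_comm)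

lemma proj_eq_iff: "proj s = proj t \<longleftrightarrow> f dvd s - t"
proof -
  have "proj s = \<zero>\<^bsub>R\<^esub> \<longleftrightarrow> f dvd s" for s
  proof -
    have "proj s = \<zero>\<^bsub>R\<^esub> \<longleftrightarrow> proj s = PIdl\<^bsub>ring_of_type_algebra\<^esub> f"
      by (simp add: R_def FactRing_def)
    also have "\<dots> \<longleftrightarrow> s \<in> PIdl\<^bsub>ring_of_type_algebra\<^esub> f"
      unfolding proj_def
      using ideal.rcos_const_imp_mem[OF ideal_f, of s] ring.a_rcos_zero[OF cring.axioms(1)[OF type_cring] ideal_f, of s]
      by auto
    also have "\<dots> \<longleftrightarrow> f dvd s" by (auto simp: cgenideal_def dvd_def mult.commute)
    finally show ?thesis .
  qed
  moreover have "proj s = proj t \<longleftrightarrow> proj (s - t) = \<zero>\<^bsub>R\<^esub>"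
    using proj_add[of s "- t"] by (simp add: proj_uminus R.r_right_minus_eq[unfolded a_minus_def])
  ultimately show ?thesis by simp
qed

lemma proj_eq_0_iff: "proj s = \<zero>\<^bsub>R\<^esub> \<longleftrightarrow> f dvd s"
  using proj_eq_iff[of s 0] by (simp add: proj_0)

lemma ideal_projI:
  assumes "0 \<in> A" "\<And>s t. s \<in> A \<Longrightarrow> t \<in> A \<Longrightarrow> s + t \<in> A" "\<And>s t. t \<in> A \<Longrightarrow> s * t \<in> A"
  shows "ideal (proj ` A) R"
proof (rule idealI)
  show "subgroup (proj ` A) (add_monoid R)"
  proof (rule R.add.subgroupI)
    fix a assume "a \<in> proj ` A"
    then obtain s where "s \<in> A" "a = proj s" by auto
    then show "\<ominus>\<^bsub>R\<^esub> a \<in> proj ` A" using assms(3)[of s "- 1"] by (auto simp flip: proj_uminus)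
  qed (use assms in \<open>auto simp flip: proj_add\<close>)
  show "x \<otimes>\<^bsub>R\<^esub> a \<in> proj ` A" "a \<otimes>\<^bsub>R\<^esub> x \<in> proj ` A" if "a \<in> proj ` A" "x \<in> carrier R" for a x
    proof -
    from that obtain s t where "t \<in> A" "a = proj t" "x = proj s" by (auto simp: carrier_R)
    moreover from this have "s * t \<in> A" "t * s \<in> A" using assms(3)[of t s] by (simp_all add: mult.commute)
    ultimately show "x \<otimes>\<^bsub>R\<^esub> a \<in> proj ` A" "a \<otimes>\<^bsub>R\<^esub> x \<in> proj ` A" by (simp_all flip: proj_mult)
  qed
qed (rule R.ring_axioms)

lemma ideal_proj_mpow: "ideal (proj ` mpow n) R"
  by (intro ideal_projI mpow_add mpow_mult_left) simp_all

text \<open>For exponents up to the order of \<open>f\<close>, the powers of the maximal ideal can be compared upstairs.\<close>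

lemma proj_mem_mpow:
  assumes "f \<in> mpow n" shows "proj s \<in> proj ` mpow n \<longleftrightarrow> s \<in> mpow n"
proof
  assume "proj s \<in> proj ` mpow n"
  then obtain t r where "t \<in> mpow n" "s - t = f * r"
    unfolding proj_eq_iff dvd_def image_iff by blast
  then show "s \<in> mpow n" using mpow_add[of t n "f * r"] mpow_mult_right[OF assms] by (metis add_diff_cancel_left' diff_add_cancel add.commute)
qed auto

lemma ideal_eq_carrier:
  assumes "ideal I R" "proj s \<in> I" "s \<notin> mpow 1" shows "I = carrier R"
proof -
  from assms(3) obtain t where "s * t = 1" using ps_unit unfolding mpow_1_iff by blast
  then have "\<one>\<^bsub>R\<^esub> = proj s \<otimes>\<^bsub>R\<^esub> proj t" by (simp flip: proj_mult proj_1)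
  then have "\<one>\<^bsub>R\<^esub> \<in> I" using ideal.I_r_closed[OF assms(1,2)] by simp
  then show ?thesis using ideal.one_imp_carrier[OF assms(1)] by blast
qed

lemma proper_ideal_subset:
  assumes "ideal I R" "I \<noteq> carrier R" shows "I \<subseteq> proj ` mpow 1"
proof
  fix a assume a: "a \<in> I"
  then obtain s where s: "a = proj s" using ideal.Icarr[OF assms(1)] by (auto simp: carrier_R)
  then have "s \<in> mpow 1" using ideal_eq_carrier[OF assms(1)] a assms(2) by blast
  then show "a \<in> proj ` mpow 1" using s by blast
qed

lemma proj_mpow1_proper: "proj ` mpow 1 \<noteq> carrier R"
proof
  assume "proj ` mpow 1 = carrier R"
  then have "proj 1 \<in> proj ` mpow 1" by simp
  then show False using proj_mem_mpow[OF f_mpow] by (simp add: mpow_1_iff del: One_nat_def)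
qed

text \<open>A series outside \<open>(x, y)\<close> is a unit, so every proper ideal lies in the image of \<open>(x, y)\<close>.\<close>

lemma maximalideal_iff: "maximalideal I R \<longleftrightarrow> I = proj ` mpow 1"
proof
  assume I: "maximalideal I R"
  interpret maximalideal I R by fact
  have "I \<subseteq> proj ` mpow 1" using proper_ideal_subset[OF is_ideal] I_notcarr by auto
  moreover have "proj ` mpow 1 \<subseteq> carrier R" by auto
  ultimately show "I = proj ` mpow 1"
    using I_maximal[OF ideal_proj_mpow[of 1]] proj_mpow1_proper by blast
next
  have "maximalideal (proj ` mpow 1) R"
  proof (rule maximalidealI[OF ideal_proj_mpow])
    show "carrier R \<noteq> proj ` mpow 1" using proj_mpow1_proper by blast
    fix J assume "ideal J R" "proj ` mpow 1 \<subseteq> J" "J \<subseteq> carrier R"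
    then show "J = proj ` mpow 1 \<or> J = carrier R" using proper_ideal_subset[of J] by blast
  qed
  then show "I = proj ` mpow 1 \<Longrightarrow> maximalideal I R" by simp
qed

lemma max_ideal_R: "max_ideal R = proj ` mpow 1"
  unfolding max_ideal_def maximalideal_iff by simp

lemma ideal_power_R: "ideal_power R (max_ideal R) n = proj ` mpow n"
proof (induction n)
  case 0
  show ?case by (simp add: nat_pow_def ideals_set_def carrier_R)
next
  case (Suc n)
  have "ideal_power R (max_ideal R) (Suc n) = ideal_power R (max_ideal R) n \<cdot>\<^bsub>R\<^esub> max_ideal R"
    by (simp add: nat_pow_def ideals_set_def)
  also have "\<dots> = proj ` mpow n \<cdot>\<^bsub>R\<^esub> proj ` mpow 1"
    using Suc by (simp only: max_ideal_R)
  also have "\<dots> = proj ` mpow (Suc n)"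
  proof
    show "proj ` mpow n \<cdot>\<^bsub>R\<^esub> proj ` mpow 1 \<subseteq> proj ` mpow (Suc n)"
    proof
      fix a assume "a \<in> proj ` mpow n \<cdot>\<^bsub>R\<^esub> proj ` mpow 1"
      then show "a \<in> proj ` mpow (Suc n)"
      proof induction
        case (prod i j)
        then obtain s t where "s \<in> mpow n" "t \<in> mpow 1" "i = proj s" "j = proj t" by blast
        then show ?case using mpow_mult[of s n t 1] by (simp flip: proj_mult)
      next
        case (sum s1 s2)
        then obtain s t where "s \<in> mpow (Suc n)" "t \<in> mpow (Suc n)" "s1 = proj s" "s2 = proj t" by blast
        then show ?case using mpow_add[of s "Suc n" t] by (simp flip: proj_add)
      qed
    qed
    show "proj ` mpow (Suc n) \<subseteq> proj ` mpow n \<cdot>\<^bsub>R\<^esub> proj ` mpow 1"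
    proof
      fix a assume "a \<in> proj ` mpow (Suc n)"
      then obtain s where "s \<in> mpow (Suc n)" and a: "a = proj s" by auto
      then obtain b c where bc: "b \<in> mpow n" "c \<in> mpow n" "s = px * b + py * c" by (elim mpow_SucE)
      have "a = proj b \<otimes>\<^bsub>R\<^esub> proj px \<oplus>\<^bsub>R\<^esub> proj c \<otimes>\<^bsub>R\<^esub> proj py"
        unfolding a bc(3) by (simp add: proj_add proj_mult R.m_comm)
      then show "a \<in> proj ` mpow n \<cdot>\<^bsub>R\<^esub> proj ` mpow 1"
        using bc px_mpow py_mpow by (auto intro!: ideal_prod.intros)
    qed
  qed
  finally show ?case .
qed

lemma Idl_proj: "Idl\<^bsub>R\<^esub> {proj h} = range (\<lambda>a. proj (a * h))"
  using R.cgenideal_eq_genideal[of "proj h"] by (auto simp: cgenideal_def carrier_R proj_mult)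

lemma Idl_empty: "Idl\<^bsub>R\<^esub> {} = {\<zero>\<^bsub>R\<^esub>}"
  using R.genideal_minimal[OF R.zeroideal, of "{}"] R.genideal_ideal[of "{}"]
  by (auto simp: additive_subgroup.zero_closed ideal.axioms(1))

end

section \<open>The arrangement of all lines through the origin\<close>

lemma mpow_prod:
  assumes "finite A" "\<And>a. a \<in> A \<Longrightarrow> t a \<in> mpow 1" shows "prod t A \<in> mpow (card A)"
  using assms
proof (induction A rule: finite_induct)
  case (insert a A)
  then show ?case using mpow_mult[of "t a" 1 "prod t A" "card A"] by simp
qed simp

lemma not_mpow_prod:
  fixes t :: "'b \<Rightarrow> 'k::idom fps fps"
  assumes "finite A" "\<And>a. a \<in> A \<Longrightarrow> t a \<in> mpow 1" "\<And>a. a \<in> A \<Longrightarrow> t a \<notin> mpow 2"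
  shows "prod t A \<notin> mpow (Suc (card A))"
  using assms
proof (induction A rule: finite_induct)
  case empty
  then show ?case by (auto simp: mpow_def)
next
  case (insert a A)
  have "t a * prod t A \<notin> mpow (Suc (1 + card A))"
    using insert by (intro mpow_order_mult mpow_prod) (auto simp: numeral_2_eq_2)
  then show ?case using insert.hyps by simp
qed

text \<open>The lines \<open>x + \<alpha>y = 0\<close> and \<open>y = 0\<close> are all lines through the origin that are defined over the field;
  \<open>line_prod\<close> leaves out \<open>y = 0\<close>.\<close>

definition line_prod :: "'k::{field,finite} fps fps" where
  "line_prod = (\<Prod>\<alpha>\<in>UNIV. px + kc \<alpha> * py)"

definition arrangement :: "'k::{field,finite} fps fps" where
  "arrangement = py * line_prod"

definition is_line :: "'k::{field,finite} fps fps \<Rightarrow> bool" where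
  "is_line l \<longleftrightarrow> l = py \<or> (\<exists>\<alpha>. l = px + kc \<alpha> * py)"

lemma mpow_2_iff: "s \<in> mpow 2 \<longleftrightarrow> s $ 0 $ 0 = 0 \<and> s $ 0 $ 1 = 0 \<and> s $ 1 $ 0 = 0"
proof -
  have "i + j < 2 \<longleftrightarrow> (i, j) = (0, 0) \<or> (i, j) = (1, 0) \<or> (i, j) = (0, 1)" for i j :: nat by auto
  then show ?thesis unfolding mpow_def by auto
qed

lemma line_mpow: "is_line l \<Longrightarrow> l \<in> mpow 1"
  unfolding is_line_def using px_mpow py_mpow by (auto intro: mpow_add mpow_mult_left)

lemma line_not_mpow: "is_line l \<Longrightarrow> l \<notin> mpow 2"
proof -
  assume "is_line l"
  then consider "l = py" | \<alpha> where "l = px + kc \<alpha> * py" unfolding is_line_def by blast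
  then show ?thesis by cases (simp_all add: mpow_2_iff)
qed

lemma line_dvd_arrangement: "is_line l \<Longrightarrow> l dvd arrangement"
  unfolding is_line_def arrangement_def line_prod_def
  by (elim disjE exE) (simp, auto intro!: dvd_mult dvd_prodI)

lemma is_line_px [simp]: "is_line (px + kc \<alpha> * py)" and is_line_py [simp]: "is_line py"
  by (auto simp: is_line_def)

lemma line_prod_mpow: "(line_prod :: 'k::{field,finite} fps fps) \<in> mpow CARD('k)"
  unfolding line_prod_def by (intro mpow_prod line_mpow) auto

lemma arrangement_mpow: "(arrangement :: 'k::{field,finite} fps fps) \<in> mpow (CARD('k) + 1)"
  unfolding arrangement_def using mpow_mult[OF py_mpow line_prod_mpow] by (simp add: add.commute)

lemma arrangement_not_mpow: "(arrangement :: 'k::{field,finite} fps fps) \<notin> mpow (CARD('k) + 2)"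
proof -
  have "(line_prod :: 'k fps fps) \<notin> mpow (Suc CARD('k))"
    unfolding line_prod_def by (intro not_mpow_prod line_mpow line_not_mpow) auto
  then have "py * (line_prod :: 'k fps fps) \<notin> mpow (Suc (1 + CARD('k)))"
    using line_not_mpow[OF is_line_py]
    by (intro mpow_order_mult py_mpow line_prod_mpow) (simp_all add: numeral_2_eq_2)
  then show ?thesis by (simp add: arrangement_def)
qed

interpretation H: hypersurface "arrangement :: 'k::{field,finite} fps fps"
  by unfold_locales (rule mpow_mono[OF _ arrangement_mpow], simp)

section \<open>Residue rings along the lines\<close>

lemma residue_py:
  shows "(py :: 'k::comm_ring_1 fps fps) dvd s \<longleftrightarrow> s $ 0 = 0"
proof
  assume "s $ 0 = 0"
  then have "s = py * fps_shift 1 s" by (intro fps_ext) (simp add: fps_X_mult_nth)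
  then show "py dvd s" by (metis dvd_triv_left)
qed auto

text \<open>The restriction of a series to the line \<open>x = 0\<close>, as a series in \<open>y\<close>.\<close>

definition coeff_x0 :: "'k::comm_ring_1 fps fps \<Rightarrow> 'k fps" where
  "coeff_x0 s = Abs_fps (\<lambda>j. s $ j $ 0)"

lemma coeff_x0_hom: "coeff_x0 (s + t) = coeff_x0 s + coeff_x0 t" "coeff_x0 (s * t) = coeff_x0 s * coeff_x0 t"
  by (simp_all add: coeff_x0_def fps_eq_iff fps_mult_nth fps_sum_nth)

lemma px_dvd_iff: "(px :: 'k::comm_ring_1 fps fps) dvd s \<longleftrightarrow> coeff_x0 s = 0"
proof
  assume "coeff_x0 s = 0"
  then have "s $ j $ 0 = 0" for j by (simp add: coeff_x0_def fps_eq_iff)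
  then have "s = px * Abs_fps (\<lambda>j. fps_shift 1 (s $ j))"
    by (intro fps_ext) (simp add: fps_X_mult_nth)
  then show "px dvd s" by (metis dvd_triv_left)
next
  assume "px dvd s"
  then show "coeff_x0 s = 0" by (auto simp: coeff_x0_def fps_eq_iff)
qed

lemma translation_subst: "ps_substitution (px + kc \<alpha> * py) (py :: 'k::comm_ring_1 fps fps)"
  by unfold_locales (auto intro: mpow_add mpow_mult_left px_mpow py_mpow simp del: One_nat_def)

lemma translation_inverse:
  "psubst (px - kc \<alpha> * py) py (psubst (px + kc \<alpha> * py) py s) = (s :: 'k::comm_ring_1 fps fps)"
  "psubst (px + kc \<alpha> * py) py (psubst (px - kc \<alpha> * py) py s) = s"
proof -
  have m: "px - kc \<alpha> * py = px + kc (- \<alpha>) * py" for \<alpha> :: 'k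
    by (simp flip: fps_const_neg)
  have *: "psubst (px + kc (- \<alpha>) * py) py (psubst (px + kc \<alpha> * py) py s) = s" for \<alpha> :: 'k
  proof -
    interpret ps_substitution "px + kc (- \<alpha>) * py" py by (rule translation_subst)
    have "psubst (px + kc (- \<alpha>) * py) py (px + kc \<alpha> * py) = px + kc (- \<alpha>) * py + kc \<alpha> * py"
      by (simp only: psubst_add psubst_kc_mult psubst_px psubst_py)
    then show ?thesis
      by (intro psubst_inverse[OF translation_subst translation_subst] psubst_py)
         (simp flip: fps_const_neg)
  qed
  show "psubst (px - kc \<alpha> * py) py (psubst (px + kc \<alpha> * py) py s) = s"
    using *[of \<alpha>] by (simp only: m)
  show "psubst (px + kc \<alpha> * py) py (psubst (px - kc \<alpha> * py) py s) = s"
    using *[of "- \<alpha>"] by (simp only: m minus_minus)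
qed

text \<open>A line is a smooth curve, so its coordinate ring is a power series ring in one variable. For
  \<open>y = 0\<close> the residue map is the constant coefficient in \<open>y\<close>; any other line is first moved to
  \<open>x = 0\<close> by a linear change of coordinates.\<close>

lemma line_residue_map:
  fixes l :: "'k::{field,finite} fps fps"
  assumes "is_line l"
  obtains e :: "'k fps fps \<Rightarrow> 'k fps" where
    "\<And>s t. e (s + t) = e s + e t" "\<And>s t. e (s * t) = e s * e t"
    "\<And>s. e s = 0 \<longleftrightarrow> l dvd s" "surj e" "\<And>s. e s $ 0 = s $ 0 $ 0"
proof (cases "l = py")
  case True
  have "surj (\<lambda>s :: 'k fps fps. s $ 0)" by (rule surjI[of _ fps_const]) simp
  then show ?thesis using that[of "\<lambda>s. s $ 0"] True by (simp add: residue_py)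
next
  case False
  then obtain \<alpha> where l: "l = px + kc \<alpha> * py" using assms by (auto simp: is_line_def)
  interpret P: ps_substitution "px + kc \<alpha> * py" py by (rule translation_subst)
  interpret N: ps_substitution "px - kc \<alpha> * py" py
    using translation_subst[of "- \<alpha>"] by (simp flip: fps_const_neg)
  define T where "T = psubst (px - kc \<alpha> * py) py"
  define T' where "T' = psubst (px + kc \<alpha> * py) py"
  have inv: "T (T' s) = s" "T' (T s) = s" for s by (simp_all add: T_def T'_def translation_inverse)
  have Tl: "T l = px" "T' px = l"
    by (simp_all add: T_def T'_def l N.psubst_add N.psubst_kc_mult N.psubst_px N.psubst_py P.psubst_px)
  show ?thesis
  proof (rule that[of "\<lambda>s. coeff_x0 (T s)"])
    show "coeff_x0 (T s) = 0 \<longleftrightarrow> l dvd s" for s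
    proof -
      have "l dvd s \<longleftrightarrow> px dvd T s"
        using Tl inv N.psubst_mult P.psubst_mult unfolding T_def T'_def dvd_def by metis
      then show ?thesis by (simp add: px_dvd_iff)
    qed
    show "surj (\<lambda>s. coeff_x0 (T s))"
    proof (rule surjI[of _ "\<lambda>c. T' (Abs_fps (\<lambda>j. fps_const (c $ j)))"])
      show "coeff_x0 (T (T' (Abs_fps (\<lambda>j. fps_const (c $ j))))) = c" for c
        by (simp add: inv coeff_x0_def fps_eq_iff)
    qed
    show "coeff_x0 (T s) $ 0 = s $ 0 $ 0" for s
      by (simp add: coeff_x0_def T_def N.psubst_const_coeff)
  qed (simp_all add: T_def N.psubst_add N.psubst_mult coeff_x0_hom)
qed

lemma line_prime:
  assumes "is_line l" "l dvd s * t" shows "l dvd s \<or> l dvd t"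
  using line_residue_map[OF assms(1)] assms(2) by (metis mult_eq_0_iff)

lemma fps_dvd_power:
  fixes a b :: "'k::field fps"
  assumes "a \<noteq> 0" "b $ 0 = 0" shows "a dvd b ^ subdegree a"
proof (cases "b = 0")
  case True
  show ?thesis
  proof (cases "subdegree a")
    case 0
    then have "a $ 0 \<noteq> 0" using nth_subdegree_nonzero[OF assms(1)] by simp
    then show ?thesis by (simp add: unit_imp_dvd)
  qed (simp add: True)
next
  case False
  then have "subdegree b \<ge> 1" using assms(2) nth_subdegree_nonzero[of b] by (cases "subdegree b") auto
  then show ?thesis using assms(1) False by (simp add: fps_dvd_iff)
qed

text \<open>In the discrete valuation ring \<open>S/(l)\<close> a nonzero \<open>h\<close> divides a power of every nonunit.\<close>

lemma line_coprime_power: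
  fixes l :: "'k::{field,finite} fps fps"
  assumes "is_line l" "\<not> l dvd h" "t \<in> mpow 1"
  obtains n :: nat and a b where "t ^ n = a * l + b * h"
proof -
  obtain e :: "'k fps fps \<Rightarrow> 'k fps" where e: "\<And>s t. e (s + t) = e s + e t" "\<And>s t. e (s * t) = e s * e t"
    "\<And>s. e s = 0 \<longleftrightarrow> l dvd s" "surj e" "\<And>s. e s $ 0 = s $ 0 $ 0"
    using line_residue_map[OF assms(1)] by blast
  have em: "e (s - t) = e s - e t" for s t using e(1)[of "s - t" t] by simp
  have e1: "e 1 = 1"
  proof -
    have "e 1 * e 1 = e 1" using e(2)[of 1 1] by simp
    moreover have "e 1 \<noteq> 0" using e(5)[of 1] by auto
    ultimately show ?thesis by simp
  qed
  have ep: "e (s ^ n) = e s ^ n" for s n by (induction n) (simp_all add: e1 e(2))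
  have "e h \<noteq> 0" "e t $ 0 = 0" using assms e(3,5) by (auto simp: mpow_1_iff simp del: One_nat_def)
  from fps_dvd_power[OF this] obtain c where "e t ^ subdegree (e h) = e h * c" by (auto simp: dvd_def)
  moreover obtain b where "c = e b" using e(4) by (metis surjD)
  ultimately have "e (t ^ subdegree (e h) - b * h) = 0" by (simp add: em e(2) ep mult.commute)
  then obtain a where "t ^ subdegree (e h) - b * h = l * a" using e(3) by (auto simp: dvd_def)
  then have "t ^ subdegree (e h) = a * l + b * h" by (simp add: algebra_simps)
  then show ?thesis by (rule that)
qed

section \<open>Krull dimension\<close>

lemma prime_contains_line:
  fixes P :: "'k::{field,finite} fps fps set set"
  assumes "primeideal P H.R"
  obtains l where "is_line l" "H.proj l \<in> P"
proof -
  interpret P: primeideal P H.R by fact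
  have pr: "\<exists>a\<in>A. H.proj (t a) \<in> P" if "finite A" "H.proj (prod t A) \<in> P" for A and t :: "'k \<Rightarrow> 'k fps fps"
    using that
  proof (induction A rule: finite_induct)
    case empty
    then have "P = carrier H.R" using P.one_imp_carrier by (simp add: H.proj_1)
    then show ?case using P.I_notcarr by simp
  next
    case (insert a A)
    then show ?case using P.I_prime[of "H.proj (t a)" "H.proj (prod t A)"] by (auto simp flip: H.proj_mult)
  qed
  have "H.proj arrangement \<in> P" using H.proj_eq_0_iff[of "arrangement :: 'k fps fps"] P.zero_closed by simp
  then have "H.proj py \<in> P \<or> H.proj line_prod \<in> P"
    using P.I_prime[of "H.proj py" "H.proj line_prod"] by (simp flip: arrangement_def H.proj_mult)
  then show ?thesis
  proof
    assume "H.proj py \<in> P"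
    with that[OF is_line_py] show ?thesis .
  next
    assume "H.proj line_prod \<in> P"
    then obtain \<alpha> where "H.proj (px + kc \<alpha> * py) \<in> P"
      using pr[of UNIV "\<lambda>\<alpha>. px + kc \<alpha> * py"] by (auto simp: line_prod_def)
    with that[OF is_line_px] show ?thesis .
  qed
qed

lemma prime_power_mem:
  assumes "primeideal P H.R" "H.proj (s ^ n) \<in> P" shows "H.proj s \<in> P"
proof -
  interpret P: primeideal P H.R by fact
  show ?thesis using assms(2)
  proof (induction n)
    case 0
    then have "P = carrier H.R" using P.one_imp_carrier by (simp add: H.proj_1)
    then show ?case using P.I_notcarr by simp
  next
    case (Suc n)
    then show ?case using P.I_prime[of "H.proj s" "H.proj (s ^ n)"] by (auto simp flip: H.proj_mult)
  qed
qed

text \<open>The smaller prime contains a line \<open>l\<close>, and the larger one contains an \<open>h\<close> that is not divisible by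
  \<open>l\<close>. Modulo \<open>(l, h)\<close> every element of the maximal ideal is nilpotent.\<close>

lemma prime_chain:
  fixes P0 P1 :: "'k::{field,finite} fps fps set set"
  assumes P0: "primeideal P0 H.R" and P1: "primeideal P1 H.R" and sub: "P0 \<subset> P1"
  shows "P1 = H.proj ` mpow 1"
proof -
  interpret P1: primeideal P1 H.R by fact
  interpret P0: primeideal P0 H.R by fact
  obtain l where l: "is_line l" "H.proj l \<in> P0" using prime_contains_line[OF P0] .
  obtain a where a: "a \<in> P1" "a \<notin> P0" using sub by blast
  then obtain h where h: "a = H.proj h" using P1.Icarr by (auto simp: H.carrier_R)
  have "\<not> l dvd h"
  proof
    assume "l dvd h"
    then obtain b where "h = l * b" by (auto simp: dvd_def)
    then have "a \<in> P0" using P0.I_r_closed[OF l(2)] by (simp add: h H.proj_mult)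
    with a show False by simp
  qed
  have "H.proj t \<in> P1" if t: "t \<in> mpow 1" for t
  proof -
    obtain n b c where n: "t ^ n = b * l + c * h" using line_coprime_power[OF l(1) \<open>\<not> l dvd h\<close> t] .
    have "H.proj (t ^ n) \<in> P1"
      unfolding n H.proj_add H.proj_mult using l(2) sub a(1) h
      by (intro P1.a_closed P1.I_l_closed) auto
    then show ?thesis by (rule prime_power_mem[OF P1])
  qed
  moreover have "P1 \<subseteq> H.proj ` mpow 1"
    using H.proper_ideal_subset[OF P1.is_ideal] P1.I_notcarr by auto
  ultimately show ?thesis by auto
qed

lemma krull_dim_arrangement: "krull_dim (H.R :: 'k::{field,finite} fps fps set ring) = 1"
proof -
  let ?M = "H.proj ` mpow 1 :: 'k fps fps set set"
  have pM: "primeideal ?M H.R"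
    using H.R.maximalideal_prime H.maximalideal_iff by blast
  let ?P = "H.proj ` {s. py dvd s} :: 'k fps fps set set"
  have memP: "H.proj s \<in> ?P \<longleftrightarrow> py dvd s" for s :: "'k fps fps"
  proof
    assume "H.proj s \<in> ?P"
    then obtain t where "py dvd t" "arrangement dvd s - t" by (auto simp: H.proj_eq_iff)
    then have "py dvd (s - t) + t" using line_dvd_arrangement[OF is_line_py] by (intro dvd_add) (auto intro: dvd_trans)
    then show "py dvd s" by simp
  qed auto
  have pP: "primeideal ?P H.R"
  proof (rule primeidealI)
    show "ideal ?P H.R" by (rule H.ideal_projI) auto
    show "carrier H.R \<noteq> ?P"
    proof
      assume "carrier H.R = ?P"
      then have "py dvd (1 :: 'k fps fps)" using memP[of 1] by auto
      then show False by (simp add: residue_py)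
    qed
    fix a b :: "'k fps fps set" assume ab: "a \<in> carrier H.R" "b \<in> carrier H.R" "a \<otimes>\<^bsub>H.R\<^esub> b \<in> ?P"
    then obtain s t where st: "a = H.proj s" "b = H.proj t" by (auto simp: H.carrier_R)
    have "py dvd s * t" using ab(3) unfolding st H.proj_mult[symmetric] memP .
    then show "a \<in> ?P \<or> b \<in> ?P" using line_prime[OF is_line_py] unfolding st memP by blast
  qed (rule H.cring_R)
  have PM: "?P \<subset> ?M"
  proof
    show "?P \<subseteq> ?M" using mpow_mult_right[OF py_mpow] by (auto simp: dvd_def)
    have "\<not> py dvd (px :: 'k fps fps)" by (simp add: residue_py)
    then have "H.proj px \<notin> ?P" unfolding memP .
    then show "?P \<noteq> ?M" using px_mpow by blast
  qed
  show ?thesis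
    unfolding krull_dim_def
  proof (rule antisym)
    show "Sup {enat n | n. \<exists>P :: nat \<Rightarrow> 'k fps fps set set. (\<forall>i\<le>n. primeideal (P i) H.R) \<and> (\<forall>i<n. P i \<subset> P (Suc i))} \<le> 1"
    proof (rule Sup_least, clarify)
      fix n and P :: "nat \<Rightarrow> 'k fps fps set set"
      assume P: "\<forall>i\<le>n. primeideal (P i) H.R" "\<forall>i<n. P i \<subset> P (Suc i)"
      have "n \<le> 1"
      proof (rule ccontr)
        assume n: "\<not> n \<le> 1"
        then have "P (Suc 0) = ?M" using P by (intro prime_chain[of "P 0"]) auto
        moreover have "P (Suc (Suc 0)) = ?M" using n P by (intro prime_chain[of "P (Suc 0)"]) auto
        moreover have "P (Suc 0) \<subset> P (Suc (Suc 0))" using n P(2) by simp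
        ultimately show False by simp
      qed
      then show "enat n \<le> 1" by (simp add: one_enat_def)
    qed
    show "1 \<le> Sup {enat n | n. \<exists>P :: nat \<Rightarrow> 'k fps fps set set. (\<forall>i\<le>n. primeideal (P i) H.R) \<and> (\<forall>i<n. P i \<subset> P (Suc i))}"
      unfolding one_enat_def
      by (intro Sup_upper CollectI exI[of _ 1] exI[of _ "\<lambda>i. if i = 0 then ?P else ?M"] conjI refl)
        (use pP pM PM in simp_all)
  qed
qed

section \<open>A parabola as parameter\<close>

text \<open>A linear form over the field is a factor of the arrangement and therefore no parameter, so the
  best candidates are curved. A smooth curve through the origin meets each line that is not its tangent
  with multiplicity one, and this parabola meets its tangent \<open>x = 0\<close> with multiplicity two.\<close>

definition parabola :: "'k::comm_ring_1 fps fps" where "parabola = px - py ^ 2"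

lemma parabola_mpow: "parabola \<in> mpow 1"
  unfolding parabola_def power2_eq_square by (intro mpow_diff px_mpow mpow_mult_left py_mpow)

text \<open>On the parabola \<open>x\<close> equals \<open>y\<^sup>2\<close>, so a monomial of degree \<open>n\<close> becomes divisible by \<open>y\<^sup>n\<close>.\<close>

lemma mpow_mod_parabola:
  fixes s :: "'k::comm_ring_1 fps fps"
  assumes "s \<in> mpow n" shows "\<exists>a b. s = a * parabola + b * py ^ n"
  using assms
proof (induction n arbitrary: s)
  case 0
  then show ?case by (intro exI[of _ 0] exI[of _ s]) simp
next
  case (Suc n)
  then obtain t u where tu: "t \<in> mpow n" "u \<in> mpow n" "s = px * t + py * u" by (elim mpow_SucE)
  then obtain a b c d where ab: "t = a * parabola + b * py ^ n" "u = c * parabola + d * py ^ n"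
    using Suc.IH by meson
  then have "s = (px * a + b * py ^ n + py * c) * parabola + (py * b + d) * py ^ Suc n"
    unfolding tu(3) ab
    by (simp add: parabola_def algebra_simps power2_eq_square del: fps_const_mult)
  then show ?case by blast
qed

lemma dvd_prod_diff:
  fixes z :: "'b::comm_ring_1"
  assumes "finite A" "\<And>a. a \<in> A \<Longrightarrow> z dvd t a - w a"
  shows "z dvd prod t A - prod w A"
  using assms
proof (induction A rule: finite_induct)
  case (insert a A)
  have "prod t (insert a A) - prod w (insert a A) = (t a - w a) * prod t A + w a * (prod t A - prod w A)"
    using insert by (simp add: algebra_simps)
  then show ?case using insert by simp
qed simp

text \<open>On the parabola the line \<open>x + \<alpha>y\<close> becomes \<open>y(y + \<alpha>)\<close>, which is \<open>y\<close> times a unit for \<open>\<alpha> \<noteq> 0\<close> and \<open>y\<^sup>2\<close>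
  for \<open>\<alpha> = 0\<close>. With the factor for \<open>y = 0\<close> the whole arrangement restricts to \<open>y\<^bsup>q+2\<^esup>\<close> times a unit.\<close>

lemma py_power_mod_parabola: "\<exists>a b. (py :: 'k::{field,finite} fps fps) ^ (CARD('k) + 2) = a * parabola + b * arrangement"
proof -
  define V where "V = (\<Prod>\<alpha>\<in>UNIV - {0}. py + kc (\<alpha>::'k))"
  have "V $ 0 $ 0 = (\<Prod>\<alpha>\<in>UNIV - {0}. \<alpha>)"
  proof -
    have "finite A \<Longrightarrow> (\<Prod>\<alpha>\<in>A. py + kc (\<alpha>::'k)) $ 0 $ 0 = (\<Prod>\<alpha>\<in>A. \<alpha>)" for A
      by (induction A rule: finite_induct) simp_all
    then show ?thesis by (simp add: V_def)
  qed
  then have "V $ 0 $ 0 \<noteq> 0" by simp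
  then obtain V' where V': "V * V' = 1" using ps_unit by blast
  have "parabola dvd line_prod - (\<Prod>\<alpha>\<in>UNIV. py * (py + kc (\<alpha>::'k)))"
    unfolding line_prod_def
    by (rule dvd_prod_diff) (auto simp: parabola_def algebra_simps power2_eq_square)
  moreover have "(\<Prod>\<alpha>\<in>UNIV. py * (py + kc (\<alpha>::'k))) = py ^ CARD('k) * (py * V)"
    unfolding V_def by (simp add: prod.distrib prod.remove[of UNIV 0])
  ultimately obtain c where "line_prod - py ^ CARD('k) * (py * V) = parabola * c" by (auto simp: dvd_def)
  then have lp: "line_prod = parabola * c + py ^ CARD('k) * (py * V)" by (simp add: algebra_simps)
  have "arrangement * V' = py * c * V' * parabola + py ^ (CARD('k) + 2) * (V * V')"
    unfolding arrangement_def lp by (simp add: algebra_simps power2_eq_square)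
  then have "py ^ (CARD('k) + 2) = (- py * c * V') * parabola + V' * arrangement"
    unfolding V' by (simp add: algebra_simps)
  then show ?thesis by blast
qed

lemma mpow_parabola_arrangement:
  fixes s :: "'k::{field,finite} fps fps"
  assumes "s \<in> mpow (CARD('k) + 2)" shows "\<exists>a b. s = a * parabola + b * arrangement"
proof -
  obtain a b where s: "s = a * parabola + b * py ^ (CARD('k) + 2)" using mpow_mod_parabola[OF assms] by blast
  obtain c d where py: "(py :: 'k fps fps) ^ (CARD('k) + 2) = c * parabola + d * arrangement" using py_power_mod_parabola by blast
  have "s = (a + b * c) * parabola + (b * d) * arrangement" unfolding s py by (simp add: algebra_simps)
  then show ?thesis by blast
qed

lemma mpow_power: "t \<in> mpow 1 \<Longrightarrow> t ^ n \<in> mpow n"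
proof (induction n)
  case (Suc n)
  then show ?case using mpow_mult[of t 1 "t ^ n" n] by simp
qed simp

lemma mpow_subset_Idl_parabola:
  "H.proj ` mpow (CARD('k) + 2) \<subseteq> Idl\<^bsub>H.R\<^esub> {H.proj (parabola :: 'k::{field,finite} fps fps)}"
proof
  fix r :: "'k fps fps set" assume "r \<in> H.proj ` mpow (CARD('k) + 2)"
  then obtain s where s: "s \<in> mpow (CARD('k) + 2)" "r = H.proj s" by blast
  obtain a b where "s = a * parabola + b * arrangement" using mpow_parabola_arrangement[OF s(1)] by blast
  then have "r = H.proj (a * parabola)" unfolding s(2) H.proj_eq_iff by simp
  then show "r \<in> Idl\<^bsub>H.R\<^esub> {H.proj parabola}" unfolding H.Idl_proj by blast
qed

lemma sop_parabola: "system_of_parameters H.R [H.proj (parabola :: 'k::{field,finite} fps fps)]"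
proof -
  let ?Q = "Idl\<^bsub>H.R\<^esub> {H.proj (parabola :: 'k fps fps)}"
  have idQ: "ideal ?Q H.R" by (rule H.R.genideal_ideal) simp
  have QM: "?Q \<subseteq> H.proj ` mpow 1"
    unfolding H.Idl_proj using mpow_mult_left[OF parabola_mpow] by blast
  then have Qp: "?Q \<noteq> carrier H.R" using H.proj_mpow1_proper by auto
  have rad: "ideal_radical H.R ?Q = H.proj ` mpow 1"
  proof
    show "H.proj ` mpow 1 \<subseteq> ideal_radical H.R ?Q"
    proof
      fix r :: "'k fps fps set" assume "r \<in> H.proj ` mpow 1"
      then obtain t where t: "t \<in> mpow 1" "r = H.proj t" by blast
      have "r [^]\<^bsub>H.R\<^esub> (CARD('k) + 2) \<in> ?Q"
        using mpow_subset_Idl_parabola mpow_power[OF t(1), of "CARD('k) + 2"]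
        unfolding t(2) H.proj_power[symmetric] by blast
      then show "r \<in> ideal_radical H.R ?Q" unfolding ideal_radical_def using t by blast
    qed
    show "ideal_radical H.R ?Q \<subseteq> H.proj ` mpow 1"
    proof
      fix r assume "r \<in> ideal_radical H.R ?Q"
      then obtain n :: nat where r: "r \<in> carrier H.R" "r [^]\<^bsub>H.R\<^esub> n \<in> ?Q" by (auto simp: ideal_radical_def)
      then obtain s where s: "r = H.proj s" by (auto simp: H.carrier_R)
      have "primeideal (H.proj ` mpow 1 :: 'k fps fps set set) H.R"
        using H.R.maximalideal_prime H.maximalideal_iff by blast
      moreover have "H.proj (s ^ n) \<in> H.proj ` mpow 1" using r(2) QM unfolding s H.proj_power by blast
      ultimately show "r \<in> H.proj ` mpow 1" unfolding s by (rule prime_power_mem)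
    qed
  qed
  have "primary_ideal ?Q H.R"
    unfolding primary_ideal_def rad
  proof (intro conjI ballI impI idQ Qp)
    fix a b assume ab: "a \<in> carrier H.R" "b \<in> carrier H.R" "a \<otimes>\<^bsub>H.R\<^esub> b \<in> ?Q"
    show "a \<in> ?Q \<or> b \<in> H.proj ` mpow 1"
    proof (rule disjCI)
      assume b: "b \<notin> H.proj ` mpow 1"
      obtain s where s: "b = H.proj s" using ab(2) by (auto simp: H.carrier_R)
      with b have "s \<notin> mpow 1" by blast
      then obtain t where "s * t = 1" using ps_unit unfolding mpow_1_iff by blast
      then have "b \<otimes>\<^bsub>H.R\<^esub> H.proj t = \<one>\<^bsub>H.R\<^esub>" unfolding s by (simp flip: H.proj_mult H.proj_1)
      then have "a = (a \<otimes>\<^bsub>H.R\<^esub> b) \<otimes>\<^bsub>H.R\<^esub> H.proj t" using ab by (simp add: H.R.m_assoc)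
      then show "a \<in> ?Q" using ideal.I_r_closed[OF idQ ab(3), of "H.proj t"] by simp
    qed
  qed
  then show ?thesis
    unfolding system_of_parameters_def H.max_ideal_R
    using rad imageI[OF parabola_mpow, of "H.proj :: 'k fps fps \<Rightarrow> _"] by (simp add: krull_dim_arrangement one_enat_def del: One_nat_def)
qed

section \<open>Counting forms modulo a parameter\<close>

text \<open>The coefficients of the homogeneous part of degree \<open>n\<close>, indexed by the exponent of \<open>x\<close>.\<close>

definition hom_part :: "nat \<Rightarrow> 'k::comm_ring_1 fps fps \<Rightarrow> nat \<Rightarrow> 'k" where
  "hom_part n s = restrict (\<lambda>i. s $ (n - i) $ i) {..n}"

abbreviation forms :: "nat \<Rightarrow> (nat \<Rightarrow> 'k) set" where "forms n \<equiv> {..n} \<rightarrow>\<^sub>E UNIV"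

lemma card_forms: "card (forms n :: (nat \<Rightarrow> 'k::finite) set) = CARD('k) ^ (n + 1)"
  by (simp add: card_PiE)

lemma finite_forms: "finite (forms n :: (nat \<Rightarrow> 'k::finite) set)"
  by (simp add: finite_PiE)

lemma hom_part_mem: "hom_part n s \<in> forms n"
  by (simp add: hom_part_def)

lemma hom_part_eq_iff:
  assumes "s \<in> mpow n" "t \<in> mpow n"
  shows "hom_part n s = hom_part n t \<longleftrightarrow> s - t \<in> mpow (Suc n)"
proof -
  have "hom_part n s = hom_part n t \<longleftrightarrow> (\<forall>i\<le>n. s $ (n - i) $ i = t $ (n - i) $ i)"
    by (auto simp: hom_part_def restrict_def fun_eq_iff)
  also have "\<dots> \<longleftrightarrow> (\<forall>i j. i + j = n \<longrightarrow> s $ j $ i = t $ j $ i)"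
    by (metis add_diff_cancel_left' le_add1 le_add_diff_inverse)
  also have "\<dots> \<longleftrightarrow> s - t \<in> mpow (Suc n)"
    using mpow_diff[OF assms] by (auto simp: mpow_def less_Suc_eq)
  finally show ?thesis .
qed

lemma hom_part_surj:
  assumes "v \<in> forms n" obtains s where "s \<in> mpow n" "hom_part n s = v"
proof
  let ?s = "Abs_fps (\<lambda>j. Abs_fps (\<lambda>i. if i + j = n then v i else 0))"
  show "?s \<in> mpow n" by (auto simp: mpow_def)
  show "hom_part n ?s = v" using assms
    by (auto simp: hom_part_def restrict_def fun_eq_iff PiE_def extensional_def)
qed

text \<open>If \<open>h\<close> has order \<open>m \<ge> d\<close>, then \<open>a h\<close> has order at least \<open>n\<close> only if \<open>a\<close> has order at least \<open>n - m\<close>, and the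
  part of degree \<open>n\<close> of \<open>a h\<close> depends only on the part of degree \<open>n - m\<close> of \<open>a\<close>. A field with \<open>q\<close>
  elements has \<open>q\<^bsup>n-m+1\<^esup>\<close> forms of that degree.\<close>

lemma card_hom_part_multiples:
  fixes h :: "'k::{field,finite} fps fps"
  assumes "h \<in> mpow d" "d \<le> n + 1"
  shows "card (hom_part n ` {a * h | a. a * h \<in> mpow n}) \<le> CARD('k) ^ (n + 1 - d)"
proof (cases "h \<in> mpow (Suc n)")
  case True
  have "hom_part n (a * h) = hom_part n 0" for a
    using mpow_mult_left[OF True, of a] mpow_mono[of n "Suc n" "a * h"] hom_part_eq_iff[of "a * h" n 0] by simp
  then have "hom_part n ` {a * h | a. a * h \<in> mpow n} \<subseteq> {hom_part n 0}" by auto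
  then have "card (hom_part n ` {a * h | a. a * h \<in> mpow n}) \<le> 1"
    using card_mono[of "{hom_part n (0 :: 'k fps fps)}"] by simp
  also have "\<dots> \<le> CARD('k) ^ (n + 1 - d)" by (simp add: Suc_le_eq)
  finally show ?thesis .
next
  case False
  then obtain m where m: "m < Suc n" "h \<in> mpow m" "h \<notin> mpow (Suc m)"
    using ex_least_nat_less[of "\<lambda>i. h \<notin> mpow i" "Suc n"] by auto
  have "d \<le> m" using m(3) assms(1) mpow_mono[of "Suc m" d h] by (metis not_less_eq_eq)
  define rep where "rep v = (SOME a. a \<in> mpow (n - m) \<and> hom_part (n - m) a = v)" for v :: "nat \<Rightarrow> 'k"
  have rep: "rep v \<in> mpow (n - m) \<and> hom_part (n - m) (rep v) = v" if v: "v \<in> forms (n - m)" for v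
  proof -
    obtain s where "s \<in> mpow (n - m) \<and> hom_part (n - m) s = v"
      using hom_part_surj[OF v] by metis
    then show ?thesis unfolding rep_def by (rule someI)
  qed
  have "hom_part n ` {a * h | a. a * h \<in> mpow n} \<subseteq> (\<lambda>v. hom_part n (rep v * h)) ` forms (n - m)"
  proof clarify
    fix a assume ah: "a * h \<in> mpow n"
    then have a: "a \<in> mpow (n - m)" using mpow_cancel[OF m(2,3), of a "n - m"] m(1) by simp
    let ?v = "hom_part (n - m) a"
    have r: "rep ?v \<in> mpow (n - m)" "hom_part (n - m) (rep ?v) = ?v" using rep[OF hom_part_mem] by simp_all
    then have "a - rep ?v \<in> mpow (Suc (n - m))" using hom_part_eq_iff[OF a r(1)] by simp
    from mpow_mult[OF this m(2)] have "a * h - rep ?v * h \<in> mpow (Suc n)"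
      using m(1) by (simp add: algebra_simps)
    moreover have "rep ?v * h \<in> mpow n" using mpow_mult[OF r(1) m(2)] m(1) by simp
    ultimately have "hom_part n (a * h) = hom_part n (rep ?v * h)" using hom_part_eq_iff[OF ah] by blast
    then show "hom_part n (a * h) \<in> (\<lambda>v. hom_part n (rep v * h)) ` forms (n - m)"
      using hom_part_mem by blast
  qed
  then have "card (hom_part n ` {a * h | a. a * h \<in> mpow n}) \<le> card (forms (n - m) :: (nat \<Rightarrow> 'k) set)"
    by (rule order_trans[OF card_mono[OF finite_imageI[OF finite_forms]] card_image_le[OF finite_forms]])
  also have "\<dots> = CARD('k) ^ (n + 1 - m)" using m(1) by (simp only: card_forms) (simp add: Suc_diff_le)
  also have "\<dots> \<le> CARD('k) ^ (n + 1 - d)" using \<open>d \<le> m\<close> by (intro power_increasing) (auto simp: Suc_le_eq)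
  finally show ?thesis .
qed

lemma card_field_ge_2: "CARD('k::{field,finite}) \<ge> 2"
  using card_mono[of UNIV "{0, 1::'k}"] by simp

text \<open>This is where all lines over the field must occur in the arrangement: the initial form of a series
  of order one is a scalar multiple of one of them.\<close>

lemma order_1_line:
  fixes h :: "'k::{field,finite} fps fps"
  assumes "h \<in> mpow 1" "h \<notin> mpow 2"
  obtains l c where "is_line l" "c \<noteq> 0" "h - kc c * l \<in> mpow 2"
proof -
  have h0: "h $ 0 $ 0 = 0" using assms(1) unfolding mpow_1_iff .
  show ?thesis
  proof (cases "h $ 0 $ 1 = 0")
    case True
    then have "h $ 1 $ 0 \<noteq> 0" using assms(2) h0 unfolding mpow_2_iff by simp
    then show ?thesis using True h0 by (intro that[of py "h $ 1 $ 0"]) (simp_all add: mpow_2_iff)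
  next
    case False
    then show ?thesis using h0
      by (intro that[of "px + kc (h $ 1 $ 0 / h $ 0 $ 1) * py" "h $ 0 $ 1"]) (simp_all add: mpow_2_iff)
  qed
qed

text \<open>The key to the lower bound for the generalized Loewy length. If the conclusion failed, the forms of degree
  \<open>n = q + 1\<close> would be spanned by \<open>f\<close> and the multiples of the initial form of \<open>h\<close>. Counting shows that
  there are too few of these: for order at least two there are at most \<open>q \<cdot> q\<^bsup>n-1\<^esup>\<close>, and for order one
  the summand \<open>f\<close> is itself such a multiple, which leaves at most \<open>q\<^sup>n\<close>.\<close>

lemma mpow_not_in_principal:
  fixes h :: "'k::{field,finite} fps fps"
  assumes h: "h \<in> mpow 1"
  shows "\<exists>s \<in> mpow (CARD('k) + 1). \<nexists>a b. s = a * h + b * arrangement"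
proof (rule ccontr)
  define n where "n = CARD('k) + 1"
  let ?q = "CARD('k)"
  assume "\<not> ?thesis"
  then have all: "\<exists>a b. s = a * h + b * arrangement" if "s \<in> mpow n" for s using that unfolding n_def by blast
  have arrangement: "(arrangement :: 'k fps fps) \<in> mpow n" unfolding n_def by (rule arrangement_mpow)
  define mult_parts where "mult_parts = hom_part n ` {a * h | a. a * h \<in> mpow n}"
  have "mult_parts \<subseteq> forms n" unfolding mult_parts_def using hom_part_mem by blast
  then have finX: "finite mult_parts" using finite_forms by (rule finite_subset)
  show False
  proof (cases "h \<in> mpow 2")
    case True
    have "forms n \<subseteq> (\<lambda>(c, v). restrict (\<lambda>i. v i + c * arrangement $ (n - i) $ i) {..n}) ` (UNIV \<times> mult_parts)"
    proof
      fix v :: "nat \<Rightarrow> 'k" assume "v \<in> forms n"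
      then obtain s where s: "s \<in> mpow n" "hom_part n s = v" by (rule hom_part_surj)
      then obtain a b where ab: "s = a * h + b * arrangement" using all by blast
      have ah: "a * h \<in> mpow n"
        using mpow_diff[OF s(1) mpow_mult_left[OF arrangement, of b]] ab by simp
      have t: "a * h + kc (b $ 0 $ 0) * arrangement \<in> mpow n" by (intro mpow_add ah mpow_mult_left arrangement)
      have "b - kc (b $ 0 $ 0) \<in> mpow 1" by (simp add: mpow_1_iff del: One_nat_def)
      from mpow_mult[OF this arrangement] have "s - (a * h + kc (b $ 0 $ 0) * arrangement) \<in> mpow (Suc n)"
        unfolding ab by (simp add: algebra_simps)
      then have "v = hom_part n (a * h + kc (b $ 0 $ 0) * arrangement)"
        using hom_part_eq_iff[OF s(1) t] s(2) by simp
      also have "\<dots> = (\<lambda>(c, v). restrict (\<lambda>i. v i + c * arrangement $ (n - i) $ i) {..n}) (b $ 0 $ 0, hom_part n (a * h))"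
        by (auto simp: hom_part_def)
      finally show "v \<in> (\<lambda>(c, v). restrict (\<lambda>i. v i + c * arrangement $ (n - i) $ i) {..n}) ` (UNIV \<times> mult_parts)"
        unfolding mult_parts_def using ah by blast
    qed
    then have "card (forms n :: (nat \<Rightarrow> 'k) set) \<le> card ((UNIV :: 'k set) \<times> mult_parts)"
      using finX by (intro order_trans[OF card_mono card_image_le]) auto
    also have "\<dots> = ?q * card mult_parts" by (simp add: card_cartesian_product)
    also have "\<dots> \<le> ?q * ?q ^ (n + 1 - 2)"
      unfolding mult_parts_def using card_hom_part_multiples[OF True, of n] by (intro mult_left_mono) (auto simp: n_def)
    also have "\<dots> = ?q ^ n" by (simp add: n_def)
    finally have "?q ^ (n + 1) \<le> ?q ^ n" unfolding card_forms .
    then show False using card_field_ge_2[where 'k = 'k] by (simp add: power_increasing_iff)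
  next
    case False
    obtain l c where l: "is_line l" "c \<noteq> 0" "h - kc c * l \<in> mpow 2" using order_1_line[OF h False] .
    obtain r where r: "arrangement = l * r" using line_dvd_arrangement[OF l(1)] by (auto simp: dvd_def)
    have "r * l \<in> mpow (?q + 1)" using arrangement unfolding r n_def by (simp add: mult.commute)
    moreover have "l \<notin> mpow (Suc 1)" using line_not_mpow[OF l(1)] by (simp add: numeral_2_eq_2)
    ultimately have rq: "r \<in> mpow ?q" using mpow_cancel[OF line_mpow[OF l(1)]] by blast
    have "forms n \<subseteq> mult_parts"
    proof
      fix v :: "nat \<Rightarrow> 'k" assume "v \<in> forms n"
      then obtain s where s: "s \<in> mpow n" "hom_part n s = v" by (rule hom_part_surj)
      then obtain a b where ab: "s = a * h + b * arrangement" using all by blast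
      (* As l agrees with h / c up to order two, f = l r agrees with (r / c) h up to order n + 1. *)
      let ?a = "a + b * (kc (1 / c) * r)"
      have "kc (1 / c) * kc c = 1" using l(2) by (simp flip: fps_const_1_eq_1)
      then have "s - ?a * h = - (b * (kc (1 / c) * (r * (h - kc c * l))))"
        unfolding ab r by (simp add: algebra_simps)
      moreover have "b * (kc (1 / c) * (r * (h - kc c * l))) \<in> mpow (Suc n)"
      proof -
        have "r * (h - kc c * l) \<in> mpow (Suc n)" using mpow_mult[OF rq l(3)] by (simp add: n_def)
        then show ?thesis by (rule mpow_mult_left[OF mpow_mult_left])
      qed
      ultimately have d: "s - ?a * h \<in> mpow (Suc n)" using mpow_uminus by metis
      then have "?a * h \<in> mpow n"
        using mpow_diff[OF s(1) mpow_mono[OF _ d, of n]] by simp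
      then show "v \<in> mult_parts" using hom_part_eq_iff[OF s(1)] d s(2) unfolding mult_parts_def by blast
    qed
    then have "card (forms n :: (nat \<Rightarrow> 'k) set) \<le> card mult_parts" using finX by (simp add: card_mono)
    also have "\<dots> \<le> ?q ^ (n + 1 - 1)" unfolding mult_parts_def by (intro card_hom_part_multiples h) simp
    finally have "?q ^ (n + 1) \<le> ?q ^ n" unfolding card_forms by simp
    then show False using card_field_ge_2[where 'k = 'k] by (simp add: power_increasing_iff)
  qed
qed

lemma Inf_enat_eq:
  assumes "P n" "\<And>m. P m \<Longrightarrow> n \<le> m" shows "Inf {enat m | m. P m} = enat n"
  by (rule Inf_eqI) (use assms in auto)

lemma gen_loewy_length_arrangement: "gen_loewy_length (H.R :: 'k::{field,finite} fps fps set ring) = enat (CARD('k) + 2)"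
  unfolding gen_loewy_length_def H.ideal_power_R
proof (rule Inf_enat_eq)
  show "CARD('k) + 2 \<ge> 1 \<and> (\<exists>xs. system_of_parameters H.R xs \<and>
      H.proj ` mpow (CARD('k) + 2) \<subseteq> Idl\<^bsub>(H.R :: 'k fps fps set ring)\<^esub> (set xs))"
    using mpow_subset_Idl_parabola[where 'k = 'k]
    by (intro conjI exI[of _ "[H.proj parabola]"] sop_parabola) simp_all
next
  fix m assume "m \<ge> 1 \<and> (\<exists>xs. system_of_parameters H.R xs \<and>
      H.proj ` mpow m \<subseteq> Idl\<^bsub>(H.R :: 'k fps fps set ring)\<^esub> (set xs))"
  then obtain xs :: "'k fps fps set list" where xs: "system_of_parameters H.R xs" "H.proj ` mpow m \<subseteq> Idl\<^bsub>H.R\<^esub> (set xs)" by blast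
  then have "length xs = 1" "set xs \<subseteq> H.proj ` mpow 1"
    by (simp_all add: system_of_parameters_def krull_dim_arrangement H.max_ideal_R one_enat_def del: One_nat_def)
  then obtain h where h: "h \<in> mpow 1" "xs = [H.proj h]" by (auto simp: length_Suc_conv)
  show "CARD('k) + 2 \<le> m"
  proof (rule ccontr)
    assume "\<not> ?thesis"
    then have m: "m \<le> CARD('k) + 1" by simp
    have "\<exists>a b. s = a * h + b * arrangement" if "s \<in> mpow (CARD('k) + 1)" for s
    proof -
      have "H.proj s \<in> Idl\<^bsub>H.R\<^esub> {H.proj h}" using xs(2) mpow_mono[OF m that] h(2) by auto
      then obtain a where "arrangement dvd s - a * h" unfolding H.Idl_proj by (auto simp: H.proj_eq_iff)
      then obtain b where "s - a * h = arrangement * b" by (auto simp: dvd_def)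
      then have "s = a * h + b * arrangement" by (simp add: algebra_simps)
      then show ?thesis by blast
    qed
    then show False using mpow_not_in_principal[OF h(1)] by blast
  qed
qed

section \<open>Linear maps from a module to a hypersurface ring\<close>

text \<open>A module over \<open>k[[x, y]]\<close>, with the action as a separate parameter: a module over a
  quotient of this ring can then be regarded as such a module in several coordinate systems.\<close>

locale ps_module = abelian_group W for W :: "('w, 'd) ring_scheme" (structure) +
  fixes act :: "'k::field fps fps \<Rightarrow> 'w \<Rightarrow> 'w"
  assumes act_closed [simp]: "w \<in> carrier W \<Longrightarrow> act s w \<in> carrier W"
    and act_add: "w \<in> carrier W \<Longrightarrow> act (s + t) w = act s w \<oplus> act t w"
    and act_distrib: "v \<in> carrier W \<Longrightarrow> w \<in> carrier W \<Longrightarrow> act s (v \<oplus> w) = act s v \<oplus> act s w"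
    and act_mult: "w \<in> carrier W \<Longrightarrow> act (s * t) w = act s (act t w)"
    and act_1: "w \<in> carrier W \<Longrightarrow> act 1 w = w"
begin

lemma act_0 [simp]: "w \<in> carrier W \<Longrightarrow> act 0 w = \<zero>"
  using act_add[of w 0 0] add.l_cancel_one'[of "act 0 w" "act 0 w"] by simp

lemma act_zero [simp]: "act s \<zero> = \<zero>"
  using act_distrib[of \<zero> \<zero> s] add.l_cancel_one'[of "act s \<zero>" "act s \<zero>"] by simp

lemma act_uminus: "w \<in> carrier W \<Longrightarrow> act (- s) w = \<ominus> act s w"
  by (rule minus_equality[symmetric]) (simp_all flip: act_add)

lemma act_minus: "w \<in> carrier W \<Longrightarrow> act s (\<ominus> w) = \<ominus> act s w"
  by (rule minus_equality[symmetric]) (simp_all flip: act_distrib add: l_neg)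

lemma act_diff: "v \<in> carrier W \<Longrightarrow> w \<in> carrier W \<Longrightarrow> act s (v \<ominus> w) = act s v \<ominus> act s w"
  by (simp add: a_minus_def act_distrib act_minus)

lemma act_comm: "w \<in> carrier W \<Longrightarrow> act s (act t w) = act t (act s w)"
  by (simp flip: act_mult add: mult.commute)

definition kspace :: "'w set \<Rightarrow> bool" where
  "kspace U \<longleftrightarrow> U \<subseteq> carrier W \<and> \<zero> \<in> U \<and> (\<forall>u\<in>U. \<forall>v\<in>U. u \<oplus> v \<in> U) \<and> (\<forall>c. \<forall>u\<in>U. act (kc c) u \<in> U)"

lemma kspaceD:
  assumes "kspace U"
  shows "u \<in> U \<Longrightarrow> u \<in> carrier W" "\<zero> \<in> U" "u \<in> U \<Longrightarrow> v \<in> U \<Longrightarrow> u \<oplus> v \<in> U" "u \<in> U \<Longrightarrow> act (kc c) u \<in> U"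
  using assms by (auto simp: kspace_def)

lemma kspace_minus: "kspace U \<Longrightarrow> u \<in> U \<Longrightarrow> v \<in> U \<Longrightarrow> u \<ominus> v \<in> U"
proof -
  assume U: "kspace U" "u \<in> U" "v \<in> U"
  then have "\<ominus> v = act (kc (- 1)) v"
    using act_uminus[of v 1] kspaceD(1)[OF U(1)] by (simp add: act_1 flip: fps_const_neg)
  then show ?thesis using U kspaceD(3,4)[OF U(1)] by (metis a_minus_def)
qed

lemma add_swap:
  assumes "a \<in> carrier W" "b \<in> carrier W" "c \<in> carrier W" "d \<in> carrier W"
  shows "(a \<oplus> b) \<oplus> (c \<oplus> d) = (a \<oplus> c) \<oplus> (b \<oplus> d)"
  using assms by (simp add: a_ac)

lemma add_diff_cancel_left:
  assumes "a \<in> carrier W" "b \<in> carrier W" shows "(a \<oplus> b) \<ominus> a = b"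
proof -
  have "(a \<oplus> b) \<ominus> a = (b \<oplus> a) \<oplus> \<ominus> a" using assms by (simp add: a_minus_def a_comm)
  then show ?thesis using assms by (simp only: a_assoc a_inv_closed r_neg r_zero)
qed

lemma kspace_sum:
  assumes B: "kspace B" and U: "kspace U"
  shows "kspace {b \<oplus> u | b u. b \<in> B \<and> u \<in> U}"
proof -
  let ?S = "{b \<oplus> u | b u. b \<in> B \<and> u \<in> U}"
  note bu = kspaceD(1)[OF B] kspaceD(1)[OF U]
  have "v \<oplus> w \<in> ?S" if "v \<in> ?S" "w \<in> ?S" for v w
  proof -
    from that obtain b u b' u' where "b \<in> B" "u \<in> U" "b' \<in> B" "u' \<in> U" "v = b \<oplus> u" "w = b' \<oplus> u'" by blast
    moreover from this have "v \<oplus> w = (b \<oplus> b') \<oplus> (u \<oplus> u')" using bu by (simp add: add_swap)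
    ultimately show ?thesis using kspaceD(3)[OF B] kspaceD(3)[OF U] by blast
  qed
  moreover have "act (kc c) v \<in> ?S" if "v \<in> ?S" for v c
  proof -
    from that obtain b u where "b \<in> B" "u \<in> U" "v = b \<oplus> u" by blast
    moreover from this have "act (kc c) v = act (kc c) b \<oplus> act (kc c) u" using bu by (simp add: act_distrib)
    ultimately show ?thesis using kspaceD(4)[OF B] kspaceD(4)[OF U] by blast
  qed
  moreover have "\<zero> \<in> ?S" using kspaceD(2)[OF B] kspaceD(2)[OF U] by force
  ultimately show ?thesis unfolding kspace_def using bu by blast
qed

lemma kspace_line: "w \<in> carrier W \<Longrightarrow> kspace (range (\<lambda>c. act (kc c) w))"
  unfolding kspace_def
proof (intro conjI ballI allI)
  assume w: "w \<in> carrier W"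
  show "range (\<lambda>c. act (kc c) w) \<subseteq> carrier W" using w by auto
  show "\<zero> \<in> range (\<lambda>c. act (kc c) w)" using w by (auto intro!: image_eqI[of _ _ 0])
  fix u v c assume u: "u \<in> range (\<lambda>c. act (kc c) w)"
  then show "act (kc c) u \<in> range (\<lambda>c. act (kc c) w)" using w by (auto simp flip: act_mult)
  assume "v \<in> range (\<lambda>c. act (kc c) w)"
  with u obtain c d where "u = act (kc c) w" "v = act (kc d) w" by auto
  then have "u \<oplus> v = act (kc (c + d)) w" using w by (simp flip: act_add fps_const_add)
  then show "u \<oplus> v \<in> range (\<lambda>c. act (kc c) w)" by blast
qed

text \<open>Zorn's lemma gives a maximal subspace \<open>B\<close> that contains \<open>A\<close> and meets \<open>U\<close> trivially. If a vector \<open>v\<close>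
  were outside \<open>B + U\<close>, adding \<open>v\<close> to \<open>B\<close> would create no new intersection with \<open>U\<close>.\<close>

lemma kspace_complement:
  assumes A: "kspace A" and U: "kspace U" and AU: "A \<inter> U \<subseteq> {\<zero>}"
  obtains B where "kspace B" "A \<subseteq> B" "B \<inter> U \<subseteq> {\<zero>}" "\<And>v. v \<in> carrier W \<Longrightarrow> \<exists>b\<in>B. \<exists>u\<in>U. v = b \<oplus> u"
proof -
  let ?F = "{B. kspace B \<and> A \<subseteq> B \<and> B \<inter> U \<subseteq> {\<zero>}}"
  have "\<exists>B\<in>?F. \<forall>Y\<in>?F. B \<subseteq> Y \<longrightarrow> Y = B"
  proof (rule subset_Zorn_nonempty)
    show "?F \<noteq> {}" using A AU by blast
    fix C assume C: "C \<noteq> {}" "subset.chain ?F C"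
    then have CF: "C \<subseteq> ?F" and ch: "\<And>P Q. P \<in> C \<Longrightarrow> Q \<in> C \<Longrightarrow> P \<subseteq> Q \<or> Q \<subseteq> P"
      by (auto simp: subset_chain_def)
    have "kspace (\<Union>C)"
      unfolding kspace_def
    proof (intro conjI ballI allI)
      show "\<Union>C \<subseteq> carrier W" using CF by (auto simp: kspace_def)
      show "\<zero> \<in> \<Union>C" using CF C(1) by (auto simp: kspace_def)
      fix u v c assume u: "u \<in> \<Union>C"
      then show "act (kc c) u \<in> \<Union>C" using CF unfolding kspace_def by blast
      assume "v \<in> \<Union>C"
      with u obtain P Q where "P \<in> C" "Q \<in> C" "u \<in> P" "v \<in> Q" by blast
      then obtain Z where "Z \<in> C" "u \<in> Z" "v \<in> Z" using ch[of P Q] by blast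
      then show "u \<oplus> v \<in> \<Union>C" using CF unfolding kspace_def by blast
    qed
    then show "\<Union>C \<in> ?F" using CF C(1) by blast
  qed
  then obtain B where BF: "B \<in> ?F" and mx: "\<forall>Y\<in>?F. B \<subseteq> Y \<longrightarrow> Y = B" by (elim bexE)
  from BF have B: "kspace B" "A \<subseteq> B" "B \<inter> U \<subseteq> {\<zero>}" by simp_all
  have max: "Y = B" if "kspace Y" "A \<subseteq> Y" "Y \<inter> U \<subseteq> {\<zero>}" "B \<subseteq> Y" for Y
    using mx that by simp
  have "\<exists>b\<in>B. \<exists>u\<in>U. v = b \<oplus> u" if v: "v \<in> carrier W" for v
  proof (cases "v \<in> B")
    case True
    then show ?thesis using kspaceD(2)[OF U] v by force
  next
    case False
    let ?X = "{b \<oplus> u | b u. b \<in> B \<and> u \<in> range (\<lambda>c. act (kc c) v)}"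
    have kX: "kspace ?X" by (intro kspace_sum B kspace_line v)
    have BX: "B \<subseteq> ?X"
    proof
      fix b assume b: "b \<in> B"
      then have "b = b \<oplus> act (kc 0) v" using v kspaceD(1)[OF B(1)] by simp
      then show "b \<in> ?X" using b by blast
    qed
    have "v = \<zero> \<oplus> act (kc 1) v" using v by (simp add: act_1)
    then have "v \<in> ?X" using kspaceD(2)[OF B(1)] by blast
    then have "?X \<noteq> B" using False by blast
    then have "\<not> ?X \<inter> U \<subseteq> {\<zero>}" using max[OF kX] BX B(2) by blast
    then obtain b c where b: "b \<in> B" and bc: "b \<oplus> act (kc c) v \<in> U" "b \<oplus> act (kc c) v \<noteq> \<zero>" by blast
    define u where "u = b \<oplus> act (kc c) v"
    have bW: "b \<in> carrier W" and uW: "u \<in> carrier W" using b kspaceD(1)[OF B(1)] v by (auto simp: u_def)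
    have "c \<noteq> 0"
    proof
      assume "c = 0"
      then show False using bc b B(3) v bW by auto
    qed
    then have c1: "kc (1 / c) * kc c = 1" by (simp flip: fps_const_1_eq_1)
    have "act (kc c) v = u \<ominus> b"
      unfolding u_def using add_diff_cancel_left[OF bW, of "act (kc c) v"] v by simp
    then have "v = act (kc (1 / c)) (u \<ominus> b)"
      using act_mult[OF v, of "kc (1 / c)" "kc c"] v by (simp only: c1 act_1)
    also have "u \<ominus> b = (\<zero> \<ominus> b) \<oplus> u" using bW uW by (simp add: a_minus_def a_comm)
    also have "act (kc (1 / c)) ((\<zero> \<ominus> b) \<oplus> u) = act (kc (1 / c)) (\<zero> \<ominus> b) \<oplus> act (kc (1 / c)) u"
      using bW uW by (intro act_distrib) auto
    finally show ?thesis
      using kspaceD(4)[OF B(1) kspace_minus[OF B(1) kspaceD(2)[OF B(1)] b]]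
        kspaceD(4)[OF U bc(1)[folded u_def]] by blast
  qed
  then show ?thesis using that B by blast
qed

lemma diff_swap:
  assumes "b \<oplus> u = b' \<oplus> u'" "b \<in> carrier W" "b' \<in> carrier W" "u \<in> carrier W" "u' \<in> carrier W"
  shows "b \<ominus> b' = u' \<ominus> u"
proof -
  have "b = (b \<oplus> u) \<ominus> u" using assms(2,4) by (simp add: a_minus_def a_assoc r_neg)
  also have "\<dots> = (b' \<oplus> u') \<ominus> u" by (simp only: assms(1))
  finally have "b \<ominus> b' = ((b' \<oplus> u') \<ominus> u) \<ominus> b'" by simp
  also have "\<dots> = ((u' \<ominus> u) \<oplus> b') \<ominus> b'" using assms(2-5) by (simp add: a_minus_def a_ac)
  also have "\<dots> = u' \<ominus> u" using assms(2-5) by (simp add: a_minus_def a_assoc r_neg)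
  finally show ?thesis .
qed

lemma eq_of_diff_0: "v \<ominus> w = \<zero> \<Longrightarrow> v \<in> carrier W \<Longrightarrow> w \<in> carrier W \<Longrightarrow> v = w"
  by (metis a_minus_def minus_equality minus_minus a_inv_closed add.inv_closed)

lemma complement_unique:
  assumes "kspace B" "kspace U" "B \<inter> U \<subseteq> {\<zero>}"
    and "b \<in> B" "b' \<in> B" "u \<in> U" "u' \<in> U" "b \<oplus> u = b' \<oplus> u'"
  shows "u = u'"
proof -
  have W: "b \<in> carrier W" "b' \<in> carrier W" "u \<in> carrier W" "u' \<in> carrier W"
    using assms kspaceD(1) by blast+
  have "b \<ominus> b' = u' \<ominus> u" by (rule diff_swap[OF assms(8) W])
  moreover have "b \<ominus> b' \<in> B" "u' \<ominus> u \<in> U" using assms kspace_minus by auto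
  ultimately have "u' \<ominus> u = \<zero>" using assms(3) by auto
  then show ?thesis using W eq_of_diff_0[of u' u] by simp
qed

lemma kspace_px: "kspace (act px ` carrier W)"
  unfolding kspace_def
proof (intro conjI ballI allI)
  show "\<zero> \<in> act px ` carrier W" by (rule image_eqI[of _ _ \<zero>]) simp_all
  fix u v c assume u: "u \<in> act px ` carrier W"
  then show "act (kc c) u \<in> act px ` carrier W" using act_comm[of _ "kc c" px] by auto
  assume "v \<in> act px ` carrier W"
  with u obtain u' v' where "u' \<in> carrier W" "v' \<in> carrier W" "u = act px u'" "v = act px v'" by auto
  then have "u \<oplus> v = act px (u' \<oplus> v')" "u' \<oplus> v' \<in> carrier W" by (simp_all add: act_distrib)
  then show "u \<oplus> v \<in> act px ` carrier W" by blast
qed auto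

text \<open>If \<open>x\<close> acts injectively, a functional \<open>\<mu>\<close> on \<open>W/xW\<close> lifts to a map \<open>\<nu> : W \<rightarrow> k[[x]]\<close> that is compatible
  with \<open>x\<close>. Choose a complement \<open>B\<close> of \<open>xW\<close>, and let \<open>D\<close> be division by \<open>x\<close> after
  discarding the \<open>B\<close>-component; then \<open>\<nu> w\<close> is the series \<open>\<mu> w + \<mu>(D w)x + \<mu>(D\<^sup>2w)x\<^sup>2 + \<dots>\<close>. The functional
  \<open>\<mu>\<close> itself is the coefficient of \<open>w0\<close> with respect to a hyperplane \<open>H\<close> that contains \<open>xW\<close>.\<close>

lemma px_linear_functional:
  assumes inj: "\<And>w. w \<in> carrier W \<Longrightarrow> act px w = \<zero> \<Longrightarrow> w = \<zero>"
    and w0: "w0 \<in> carrier W" "w0 \<notin> act px ` carrier W"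
  obtains \<nu> :: "'w \<Rightarrow> 'k fps" where
    "\<And>v w. v \<in> carrier W \<Longrightarrow> w \<in> carrier W \<Longrightarrow> \<nu> (v \<oplus> w) = \<nu> v + \<nu> w"
    "\<And>c w. w \<in> carrier W \<Longrightarrow> \<nu> (act (kc c) w) = fps_const c * \<nu> w"
    "\<And>w. w \<in> carrier W \<Longrightarrow> \<nu> (act px w) = fps_X * \<nu> w"
    "\<nu> w0 $ 0 = 1"
proof -
  let ?U = "act px ` carrier W"
  have k0: "kspace {\<zero>}" by (simp add: kspace_def)
  obtain B where B: "kspace B" "B \<inter> ?U \<subseteq> {\<zero>}" "\<And>v. v \<in> carrier W \<Longrightarrow> \<exists>b\<in>B. \<exists>u\<in>?U. v = b \<oplus> u"
    using kspace_complement[OF k0 kspace_px] by (metis Int_subset_iff inf_le1)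
  let ?L = "range (\<lambda>c. act (kc c) w0)"
  have "?U \<inter> ?L \<subseteq> {\<zero>}"
  proof
    fix v assume "v \<in> ?U \<inter> ?L"
    then obtain c where c: "v = act (kc c) w0" "v \<in> ?U" by blast
    show "v \<in> {\<zero>}"
    proof (cases "c = 0")
      case True
      then show ?thesis using c w0 by simp
    next
      case False
      then have c1: "kc (1 / c) * kc c = 1" by (simp flip: fps_const_1_eq_1)
      have "act (kc (1 / c)) v = w0" unfolding c(1) act_mult[OF w0(1), symmetric] c1 by (rule act_1[OF w0(1)])
      then show ?thesis using kspaceD(4)[OF kspace_px c(2), of "1 / c"] w0(2) by simp
    qed
  qed
  from kspace_complement[OF kspace_px kspace_line[OF w0(1)] this]
  obtain H where H: "kspace H" "?U \<subseteq> H" "H \<inter> ?L \<subseteq> {\<zero>}"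
    "\<And>v. v \<in> carrier W \<Longrightarrow> \<exists>b\<in>H. \<exists>u\<in>?L. v = b \<oplus> u" by blast
  have w0_nz: "w0 \<noteq> \<zero>" using w0(2) kspaceD(2)[OF kspace_px] by auto

  define D where "D v = (SOME w. w \<in> carrier W \<and> (\<exists>b\<in>B. v = b \<oplus> act px w))" for v
  have D: "D v \<in> carrier W \<and> (\<exists>b\<in>B. v = b \<oplus> act px (D v))" if "v \<in> carrier W" for v
    unfolding D_def by (rule someI_ex) (use B(3)[OF that] in blast)
  have D_eq: "D v = w" if "w \<in> carrier W" "b \<in> B" "v = b \<oplus> act px w" for v b w
  proof -
    have "v \<in> carrier W" using that kspaceD(1)[OF B(1)] by simp
    from D[OF this] obtain b' where b': "D v \<in> carrier W" "b' \<in> B" "v = b' \<oplus> act px (D v)" by blast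
    have "act px (D v) = act px w"
      by (rule complement_unique[OF B(1) kspace_px B(2) b'(2) that(2)]) (use b' that in auto)
    then have "act px (D v \<ominus> w) = \<zero>" using act_diff[OF b'(1) that(1), of px] that(1) by (simp add: a_minus_def r_neg)
    then have "D v \<ominus> w = \<zero>" using inj b'(1) that(1) by simp
    then show ?thesis by (rule eq_of_diff_0[OF _ b'(1) that(1)])
  qed
  have D_add: "D (v \<oplus> w) = D v \<oplus> D w" if vw: "v \<in> carrier W" "w \<in> carrier W" for v w
  proof -
    obtain b b' where b: "b \<in> B" "v = b \<oplus> act px (D v)" "b' \<in> B" "w = b' \<oplus> act px (D w)"
      using D vw by blast
    note bW = kspaceD(1)[OF B(1) b(1)] kspaceD(1)[OF B(1) b(3)] D[OF vw(1), THEN conjunct1] D[OF vw(2), THEN conjunct1]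
    have "v \<oplus> w = (b \<oplus> act px (D v)) \<oplus> (b' \<oplus> act px (D w))" using b by simp
    also have "\<dots> = (b \<oplus> b') \<oplus> act px (D v \<oplus> D w)" using bW by (simp add: add_swap act_distrib)
    finally show ?thesis using bW kspaceD(3)[OF B(1) b(1,3)] by (intro D_eq) auto
  qed
  have D_kc: "D (act (kc c) v) = act (kc c) (D v)" if v: "v \<in> carrier W" for v c
  proof -
    obtain b where b: "b \<in> B" "v = b \<oplus> act px (D v)" using D v by blast
    note bW = kspaceD(1)[OF B(1) b(1)] D[OF v, THEN conjunct1]
    have "act (kc c) v = act (kc c) (b \<oplus> act px (D v))" using b by simp
    also have "\<dots> = act (kc c) b \<oplus> act px (act (kc c) (D v))"
      using bW act_comm[of "D v" "kc c" px] by (simp add: act_distrib)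
    finally show ?thesis using bW kspaceD(4)[OF B(1) b(1)] by (intro D_eq) auto
  qed
  have D_px: "D (act px w) = w" if "w \<in> carrier W" for w
    by (rule D_eq[OF that kspaceD(2)[OF B(1)]]) (use that in simp)

  define \<mu> where "\<mu> v = (SOME c. \<exists>b\<in>H. v = b \<oplus> act (kc c) w0)" for v
  have \<mu>: "\<exists>b\<in>H. v = b \<oplus> act (kc (\<mu> v)) w0" if "v \<in> carrier W" for v
    unfolding \<mu>_def by (rule someI_ex) (use H(4)[OF that] in blast)
  have \<mu>_eq: "\<mu> v = c" if "b \<in> H" "v = b \<oplus> act (kc c) w0" for v b c
  proof (rule ccontr)
    assume "\<mu> v \<noteq> c"
    then have c1: "kc (1 / (\<mu> v - c)) * (kc (\<mu> v) - kc c) = 1" by (simp flip: fps_const_1_eq_1)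
    have "v \<in> carrier W" using that kspaceD(1)[OF H(1)] w0 by simp
    from \<mu>[OF this] obtain b' where b': "b' \<in> H" "v = b' \<oplus> act (kc (\<mu> v)) w0" by blast
    have "act (kc (\<mu> v)) w0 = act (kc c) w0"
      by (rule complement_unique[OF H(1) kspace_line[OF w0(1)] H(3) b'(1) that(1)]) (use b' that in auto)
    then have "act (kc (\<mu> v) - kc c) w0 = \<zero>"
      unfolding diff_conv_add_uminus act_add[OF w0(1)] act_uminus[OF w0(1)] using w0(1) by (simp add: r_neg)
    then have "w0 = \<zero>"
      using act_mult[OF w0(1), of "kc (1 / (\<mu> v - c))" "kc (\<mu> v) - kc c"] w0(1)
      by (simp only: c1 act_1 act_zero)
    with w0_nz show False by simp
  qed
  have \<mu>_add: "\<mu> (v \<oplus> w) = \<mu> v + \<mu> w" if vw: "v \<in> carrier W" "w \<in> carrier W" for v w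
  proof -
    obtain b b' where b: "b \<in> H" "v = b \<oplus> act (kc (\<mu> v)) w0" "b' \<in> H" "w = b' \<oplus> act (kc (\<mu> w)) w0"
      using \<mu> vw by blast
    note bW = kspaceD(1)[OF H(1) b(1)] kspaceD(1)[OF H(1) b(3)]
    have "v \<oplus> w = (b \<oplus> act (kc (\<mu> v)) w0) \<oplus> (b' \<oplus> act (kc (\<mu> w)) w0)" using b by simp
    also have "\<dots> = (b \<oplus> b') \<oplus> act (kc (\<mu> v + \<mu> w)) w0"
      using bW w0 by (simp add: add_swap act_add flip: fps_const_add)
    finally show ?thesis using kspaceD(3)[OF H(1) b(1,3)] by (intro \<mu>_eq)
  qed
  have \<mu>_kc: "\<mu> (act (kc c) v) = c * \<mu> v" if v: "v \<in> carrier W" for v c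
  proof -
    obtain b where b: "b \<in> H" "v = b \<oplus> act (kc (\<mu> v)) w0" using \<mu> v by blast
    note bW = kspaceD(1)[OF H(1) b(1)]
    have "act (kc c) v = act (kc c) (b \<oplus> act (kc (\<mu> v)) w0)" using b by simp
    also have "\<dots> = act (kc c) b \<oplus> act (kc (c * \<mu> v)) w0"
      using bW w0 by (simp add: act_distrib flip: act_mult)
    finally show ?thesis using kspaceD(4)[OF H(1) b(1)] by (intro \<mu>_eq)
  qed
  have \<mu>_px: "\<mu> (act px w) = 0" if "w \<in> carrier W" for w
    by (rule \<mu>_eq[of "act px w"]) (use that H(2) w0 in auto)
  have \<mu>_w0: "\<mu> w0 = 1"
    by (rule \<mu>_eq[OF kspaceD(2)[OF H(1)]]) (use w0 in \<open>simp add: act_1\<close>)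

  have Dn: "(D ^^ m) v \<in> carrier W" if "v \<in> carrier W" for m v
    by (induction m) (use that D in auto)
  have Dn_add: "(D ^^ m) (v \<oplus> w) = (D ^^ m) v \<oplus> (D ^^ m) w" if "v \<in> carrier W" "w \<in> carrier W" for m v w
    by (induction m) (use that in \<open>simp_all add: D_add Dn\<close>)
  have Dn_kc: "(D ^^ m) (act (kc c) v) = act (kc c) ((D ^^ m) v)" if "v \<in> carrier W" for m v c
    by (induction m) (use that in \<open>simp_all add: D_kc Dn\<close>)
  define \<nu> where "\<nu> v = Abs_fps (\<lambda>m. \<mu> ((D ^^ m) v))" for v
  show ?thesis
  proof (rule that[of \<nu>])
    show "\<nu> (v \<oplus> w) = \<nu> v + \<nu> w" if "v \<in> carrier W" "w \<in> carrier W" for v w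
      using that by (simp add: \<nu>_def fps_eq_iff Dn_add \<mu>_add Dn)
    show "\<nu> (act (kc c) w) = fps_const c * \<nu> w" if "w \<in> carrier W" for w c
      using that by (simp add: \<nu>_def fps_eq_iff Dn_kc \<mu>_kc Dn)
    show "\<nu> (act px w) = fps_X * \<nu> w" if "w \<in> carrier W" for w
    proof (rule fps_ext)
      fix m
      show "\<nu> (act px w) $ m = (fps_X * \<nu> w) $ m"
        by (cases m) (use that in \<open>simp_all add: \<nu>_def \<mu>_px funpow_Suc_right D_px del: funpow.simps(2)\<close>)
    qed
    show "\<nu> w0 $ 0 = 1" by (simp add: \<nu>_def \<mu>_w0)
  qed
qed

text \<open>With \<open>t\<^sub>m\<close> for the shift of \<open>t\<close> by \<open>m\<close>, the coefficients of index at least \<open>n\<close> of \<open>s t\<close> come from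
  \<open>s\<^sub>n t\<close> and from the terms of \<open>s\<close> of index \<open>j < n\<close>, which meet \<open>t\<^bsub>n-j\<^esub>\<close>. The roles of
  \<open>s\<close> and \<open>t\<close> are different on the right-hand side but not on the left, and comparing the two
  versions is what makes the map of the next lemma linear.\<close>

lemma fps_shift_mult_sum:
  fixes s t :: "'b::comm_ring_1 fps"
  shows "fps_shift n (s * t) = fps_shift n s * t + (\<Sum>j<n. fps_const (s $ j) * fps_shift (n - j) t)"
proof (induction n)
  case (Suc n)
  have 1: "fps_shift 1 (a * t) = fps_shift 1 a * t + fps_const (a $ 0) * fps_shift 1 t" for a :: "'b fps"
  proof -
    have "a * t = fps_X * (fps_shift 1 a * t) + fps_const (a $ 0) * t"
    proof -
      have "a = fps_X * fps_shift 1 a + fps_const (a $ 0)" by (rule fps_ext) (simp add: fps_X_mult_nth)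
      then have "a * t = (fps_X * fps_shift 1 a + fps_const (a $ 0)) * t" by simp
      then show ?thesis by (simp add: algebra_simps)
    qed
    then have "fps_shift 1 (a * t) = fps_shift 1 (fps_X * (fps_shift 1 a * t)) + fps_shift 1 (fps_const (a $ 0) * t)"
      by (simp only: fps_shift_add)
    moreover have "fps_shift 1 (fps_X * (fps_shift 1 a * t)) = fps_shift 1 a * t"
      "fps_shift 1 (fps_const (a $ 0) * t) = fps_const (a $ 0) * fps_shift 1 t"
      by (simp_all add: fps_eq_iff)
    ultimately show ?thesis by simp
  qed
  have s1: "fps_shift 1 (fps_shift m a) = fps_shift (Suc m) a" for a :: "'b fps" and m by (simp add: fps_eq_iff)
  have "fps_shift (Suc n) (s * t) = fps_shift 1 (fps_shift n (s * t))" by (simp only: s1)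
  also have "\<dots> = fps_shift 1 (fps_shift n s * t) + fps_shift 1 (\<Sum>j<n. fps_const (s $ j) * fps_shift (n - j) t)"
    by (simp only: Suc.IH fps_shift_add)
  also have "fps_shift 1 (fps_shift n s * t) = fps_shift (Suc n) s * t + fps_const (s $ n) * fps_shift 1 t"
    unfolding 1 s1 by simp
  also have "fps_shift 1 (\<Sum>j<n. fps_const (s $ j) * fps_shift (n - j) t) = (\<Sum>j<n. fps_const (s $ j) * fps_shift (Suc n - j) t)"
    by (simp add: fps_eq_iff fps_sum_nth Suc_diff_le cong: sum.cong_simp)
  finally show ?case by (simp add: algebra_simps)
qed simp

text \<open>The duality between \<open>k[[x]]\<close>-linear maps \<open>W \<rightarrow> k[[x]]\<close> and \<open>S/(f)\<close>-linear maps \<open>W \<rightarrow> S/(f)\<close>, made explicit.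
  From \<open>\<nu>\<close> one gets the series in \<open>y\<close> whose coefficient of index \<open>i\<close> is \<open>\<nu>(f\<^bsub>i+1\<^esub> w)\<close>, where \<open>f\<^sub>m\<close> is \<open>f\<close>
  shifted by \<open>m\<close>. This is \<open>\<nu>\<close> applied to the difference quotient \<open>(f(y) - f(Y))/(y - Y)\<close>, with \<open>Y\<close> acting on \<open>w\<close>.
  Its constant term at \<open>w0\<close> is \<open>\<nu>(f\<^sub>1 w0)\<close>, so \<open>\<nu>\<close> is chosen to be nonzero there.\<close>

lemma linear_map_to_hypersurface:
  assumes inj: "\<And>w. w \<in> carrier W \<Longrightarrow> act px w = \<zero> \<Longrightarrow> w = \<zero>"
    and f: "\<And>w. w \<in> carrier W \<Longrightarrow> act f w = \<zero>"
    and w0: "w0 \<in> carrier W" "act (fps_shift 1 f) w0 \<notin> act px ` carrier W"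
  obtains l :: "'w \<Rightarrow> 'k fps fps" where
    "\<And>v w. v \<in> carrier W \<Longrightarrow> w \<in> carrier W \<Longrightarrow> l (v \<oplus> w) = l v + l w"
    "\<And>s w. w \<in> carrier W \<Longrightarrow> f dvd l (act s w) - s * l w"
    "l w0 $ 0 $ 0 = 1"
proof -
  obtain \<nu> :: "'w \<Rightarrow> 'k fps" where
    \<nu>_add: "\<And>v w. v \<in> carrier W \<Longrightarrow> w \<in> carrier W \<Longrightarrow> \<nu> (v \<oplus> w) = \<nu> v + \<nu> w" and
    \<nu>_kc: "\<And>c w. w \<in> carrier W \<Longrightarrow> \<nu> (act (kc c) w) = fps_const c * \<nu> w" and
    \<nu>_px: "\<And>w. w \<in> carrier W \<Longrightarrow> \<nu> (act px w) = fps_X * \<nu> w" and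
    \<nu>_w0: "\<nu> (act (fps_shift 1 f) w0) $ 0 = 1"
    using px_linear_functional[OF inj act_closed[OF w0(1)] w0(2)] by blast
  have \<nu>_zero: "\<nu> \<zero> = 0" using \<nu>_px[of \<zero>] \<nu>_kc[of \<zero> 0] by simp
  have \<nu>_const: "\<nu> (act (fps_const a) w) = a * \<nu> w" if "w \<in> carrier W" for a w
  proof (rule fps_ext)
    show "\<nu> (act (fps_const a) w) $ m = (a * \<nu> w) $ m" for m
    proof (induction m arbitrary: a)
      case (0 a)
      have "fps_const a = kc (a $ 0) + px * fps_const (fps_shift 1 a)"
        using ps_decomp[of "fps_const a"] by (simp add: fps_shift_fps_const)
      then have "\<nu> (act (fps_const a) w) = fps_const (a $ 0) * \<nu> w + fps_X * \<nu> (act (fps_const (fps_shift 1 a)) w)"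
        using that by (simp only: act_add act_mult \<nu>_add \<nu>_kc \<nu>_px act_closed)
      then show ?case by simp
    next
      case (Suc m a)
      have "fps_const a = kc (a $ 0) + px * fps_const (fps_shift 1 a)"
        using ps_decomp[of "fps_const a"] by (simp add: fps_shift_fps_const)
      then have "\<nu> (act (fps_const a) w) = fps_const (a $ 0) * \<nu> w + fps_X * \<nu> (act (fps_const (fps_shift 1 a)) w)"
        using that by (simp only: act_add act_mult \<nu>_add \<nu>_kc \<nu>_px act_closed)
      moreover have "a * \<nu> w = fps_const (a $ 0) * \<nu> w + fps_X * (fps_shift 1 a * \<nu> w)"
      proof -
        have "a = fps_const (a $ 0) + fps_X * fps_shift 1 a" by (rule fps_ext) (simp add: fps_X_mult_nth)
        then have "a * \<nu> w = (fps_const (a $ 0) + fps_X * fps_shift 1 a) * \<nu> w" by simp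
        then show ?thesis by (simp add: algebra_simps)
      qed
      ultimately show ?case using Suc[of "fps_shift 1 a"] by simp
    qed
  qed
  have \<phi>_sum: "\<nu> (act (\<Sum>j<n. fps_const (a j) * g j) w) = (\<Sum>j<n. a j * \<nu> (act (g j) w))"
    if "w \<in> carrier W" for a g w and n :: nat
    by (induction n) (use that in \<open>simp_all add: \<nu>_zero act_add \<nu>_add act_mult \<nu>_const\<close>)
  define \<rho> where "\<rho> s w = Abs_fps (\<lambda>i. \<nu> (act (fps_shift (Suc i) s) w))" for s w
  have conv: "(\<Sum>j<Suc i. s $ j * \<nu> (act (fps_shift (Suc i - j) t) w)) = (s * \<rho> t w) $ i" for s t w i
    unfolding fps_mult_nth \<rho>_def
    by (simp add: lessThan_Suc_atMost atLeast0AtMost Suc_diff_le cong: sum.cong_simp)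
  (* Expand the shifts of s f and of f s; the term that contains f w vanishes. *)
  have key: "s * \<rho> f w = \<rho> f (act s w) + f * \<rho> s w" if w: "w \<in> carrier W" for s w
  proof (rule fps_ext)
    fix i
    have "\<nu> (act (fps_shift (Suc i) (s * f)) w) = (s * \<rho> f w) $ i"
      unfolding fps_shift_mult_sum
      using w by (simp only: act_add \<nu>_add act_closed \<phi>_sum conv act_mult f act_zero l_zero)
    moreover have "\<nu> (act (fps_shift (Suc i) (f * s)) w) = \<rho> f (act s w) $ i + (f * \<rho> s w) $ i"
      unfolding fps_shift_mult_sum
      using w by (simp only: act_add \<nu>_add act_closed \<phi>_sum conv act_mult) (simp add: \<rho>_def)
    ultimately show "(s * \<rho> f w) $ i = (\<rho> f (act s w) + f * \<rho> s w) $ i"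
      by (simp add: mult.commute[of s f])
  qed
  show ?thesis
  proof (rule that[of "\<rho> f"])
    show "\<rho> f (v \<oplus> w) = \<rho> f v + \<rho> f w" if "v \<in> carrier W" "w \<in> carrier W" for v w
      using that by (simp add: \<rho>_def fps_eq_iff act_distrib \<nu>_add)
    show "f dvd \<rho> f (act s w) - s * \<rho> f w" if "w \<in> carrier W" for s w
      unfolding key[OF that] by simp
    show "\<rho> f w0 $ 0 $ 0 = 1" using \<nu>_w0 by (simp add: \<rho>_def)
  qed
qed

end

section \<open>Quotient modules and free summands\<close>

context module
begin

lemma submodule_abelian_subgroup: "submodule N R M \<Longrightarrow> abelian_subgroup N M"
  by (intro abelian_subgroupI3 additive_subgroupI M.abelian_group_axioms submodule.axioms(1))

lemma coset_eq_iff: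
  assumes N: "submodule N R M" and uv: "u \<in> carrier M" "v \<in> carrier M"
  shows "N +>\<^bsub>M\<^esub> u = N +>\<^bsub>M\<^esub> v \<longleftrightarrow> u \<ominus>\<^bsub>M\<^esub> v \<in> N"
proof -
  interpret N: abelian_subgroup N M by (rule submodule_abelian_subgroup[OF N])
  have "u \<in> N +>\<^bsub>M\<^esub> v \<longleftrightarrow> u \<ominus>\<^bsub>M\<^esub> v \<in> N"
    using N.a_rcos_module[OF uv(2,1)] by (simp add: a_minus_def)
  moreover have "N +>\<^bsub>M\<^esub> u = N +>\<^bsub>M\<^esub> v \<longleftrightarrow> u \<in> N +>\<^bsub>M\<^esub> v"
    using N.a_rcos_self[OF uv(1)] N.a_repr_independence'[OF _ uv(2), of u] by metis
  ultimately show ?thesis by simp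
qed

lemma coset_eq_self_iff:
  assumes N: "submodule N R M" and u: "u \<in> carrier M"
  shows "N +>\<^bsub>M\<^esub> u = N \<longleftrightarrow> u \<in> N"
proof -
  interpret N: abelian_subgroup N M by (rule submodule_abelian_subgroup[OF N])
  have "N +>\<^bsub>M\<^esub> \<zero>\<^bsub>M\<^esub> = N" by (simp add: N.a_subset)
  moreover have "u \<ominus>\<^bsub>M\<^esub> \<zero>\<^bsub>M\<^esub> = u"
  proof -
    have m0: "\<ominus>\<^bsub>M\<^esub> \<zero>\<^bsub>M\<^esub> = \<zero>\<^bsub>M\<^esub>" by (rule M.minus_equality) auto
    show ?thesis unfolding a_minus_def m0 using u by simp
  qed
  ultimately show ?thesis using coset_eq_iff[OF N u, of "\<zero>\<^bsub>M\<^esub>"] by simp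
qed

lemma quot_carrier: "carrier (quot_module M N) = (\<lambda>u. N +>\<^bsub>M\<^esub> u) ` carrier M"
  by (auto simp: quot_module_def A_RCOSETS_def RCOSETS_def a_r_coset_def)

lemma quot_add:
  assumes N: "submodule N R M" and uv: "u \<in> carrier M" "v \<in> carrier M"
  shows "(N +>\<^bsub>M\<^esub> u) \<oplus>\<^bsub>quot_module M N\<^esub> (N +>\<^bsub>M\<^esub> v) = N +>\<^bsub>M\<^esub> (u \<oplus>\<^bsub>M\<^esub> v)"
  using abelian_subgroup.a_rcos_sum[OF submodule_abelian_subgroup[OF N] uv] by (simp add: quot_module_def)

lemma quot_zero: "\<zero>\<^bsub>quot_module M N\<^esub> = N"
  by (simp add: quot_module_def)

lemma quot_smult:
  assumes N: "submodule N R M" and a: "a \<in> carrier R" and u: "u \<in> carrier M"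
  shows "a \<odot>\<^bsub>quot_module M N\<^esub> (N +>\<^bsub>M\<^esub> u) = N +>\<^bsub>M\<^esub> (a \<odot>\<^bsub>M\<^esub> u)"
proof -
  interpret N: abelian_subgroup N M by (rule submodule_abelian_subgroup[OF N])
  have eq: "N +>\<^bsub>M\<^esub> (a \<odot>\<^bsub>M\<^esub> c) = N +>\<^bsub>M\<^esub> (a \<odot>\<^bsub>M\<^esub> u)" if c: "c \<in> N +>\<^bsub>M\<^esub> u" for c
  proof -
    have cM: "c \<in> carrier M" using c u N.a_elemrcos_carrier by blast
    then have "c \<ominus>\<^bsub>M\<^esub> u \<in> N" using N.a_rcos_module[OF u cM] c by (simp add: a_minus_def)
    then have "a \<odot>\<^bsub>M\<^esub> (c \<ominus>\<^bsub>M\<^esub> u) \<in> N" using submoduleE(4)[OF N] a by blast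
    then have "a \<odot>\<^bsub>M\<^esub> c \<ominus>\<^bsub>M\<^esub> a \<odot>\<^bsub>M\<^esub> u \<in> N"
      using a cM u by (simp add: a_minus_def smult_r_distr smult_r_minus)
    then show ?thesis using coset_eq_iff[OF N] a cM u by simp
  qed
  have "a \<odot>\<^bsub>quot_module M N\<^esub> (N +>\<^bsub>M\<^esub> u) = (\<Union>c\<in>N +>\<^bsub>M\<^esub> u. N +>\<^bsub>M\<^esub> (a \<odot>\<^bsub>M\<^esub> c))"
    by (simp add: quot_module_def)
  also have "\<dots> = (\<Union>c\<in>N +>\<^bsub>M\<^esub> u. N +>\<^bsub>M\<^esub> (a \<odot>\<^bsub>M\<^esub> u))"
    by (intro SUP_cong refl) (rule eq)
  finally show ?thesis using N.a_rcos_self[OF u] by (simp only: UN_constant) (auto split: if_splits)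
qed

lemma submodule_gen_subset: "submodule N R M \<Longrightarrow> S \<subseteq> N \<Longrightarrow> submodule_gen R M S \<subseteq> N"
  by (auto simp: submodule_gen_def)

lemma subset_submodule_gen: "S \<subseteq> submodule_gen R M S"
  by (auto simp: submodule_gen_def)

lemma submodule_gen_closed: "S \<subseteq> carrier M \<Longrightarrow> submodule_gen R M S \<subseteq> carrier M"
  by (intro submodule_gen_subset carrier_is_submodule)

lemma submodule_zero: "submodule {\<zero>\<^bsub>M\<^esub>} R M"
  by (rule submoduleI) auto

lemma submodule_smult_image: "a \<in> carrier R \<Longrightarrow> submodule ((\<lambda>w. a \<odot>\<^bsub>M\<^esub> w) ` carrier M) R M"
proof (rule submoduleI)
  assume a: "a \<in> carrier R"
  let ?N = "(\<lambda>w. a \<odot>\<^bsub>M\<^esub> w) ` carrier M"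
  show "?N \<subseteq> carrier M" using a by auto
  show "\<zero>\<^bsub>M\<^esub> \<in> ?N" using a by (intro image_eqI[of _ _ "\<zero>\<^bsub>M\<^esub>"]) auto
  show "\<ominus>\<^bsub>M\<^esub> u \<in> ?N" if "u \<in> ?N" for u
    using that a smult_r_minus[OF a] by (auto intro!: image_eqI[of _ _ "\<ominus>\<^bsub>M\<^esub> _"])
  show "u \<oplus>\<^bsub>M\<^esub> v \<in> ?N" if "u \<in> ?N" "v \<in> ?N" for u v
  proof -
    from that obtain u' v' where "u' \<in> carrier M" "v' \<in> carrier M" "u = a \<odot>\<^bsub>M\<^esub> u'" "v = a \<odot>\<^bsub>M\<^esub> v'" by auto
    then have "u \<oplus>\<^bsub>M\<^esub> v = a \<odot>\<^bsub>M\<^esub> (u' \<oplus>\<^bsub>M\<^esub> v')" "u' \<oplus>\<^bsub>M\<^esub> v' \<in> carrier M" using a by (simp_all add: smult_r_distr)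
    then show ?thesis by blast
  qed
  show "b \<odot>\<^bsub>M\<^esub> u \<in> ?N" if b: "b \<in> carrier R" and "u \<in> ?N" for b u
  proof -
    from that obtain u' where u': "u' \<in> carrier M" "u = a \<odot>\<^bsub>M\<^esub> u'" by auto
    then have "b \<odot>\<^bsub>M\<^esub> u = a \<odot>\<^bsub>M\<^esub> (b \<odot>\<^bsub>M\<^esub> u')"
      using a b R.m_comm[of a b] by (simp flip: smult_assoc1)
    then show ?thesis using u' b by blast
  qed
qed

lemma ideal_smult_empty: "ideal_smult R {\<zero>} M = {\<zero>\<^bsub>M\<^esub>}"
proof
  show "ideal_smult R {\<zero>} M \<subseteq> {\<zero>\<^bsub>M\<^esub>}"
    unfolding ideal_smult_def by (intro submodule_gen_subset submodule_zero) auto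
  have "\<zero>\<^bsub>M\<^esub> = \<zero> \<odot>\<^bsub>M\<^esub> \<zero>\<^bsub>M\<^esub>" by simp
  then have "\<zero>\<^bsub>M\<^esub> \<in> {a \<odot>\<^bsub>M\<^esub> u | a u. a \<in> {\<zero>} \<and> u \<in> carrier M}" using M.zero_closed by blast
  then show "{\<zero>\<^bsub>M\<^esub>} \<subseteq> ideal_smult R {\<zero>} M"
    unfolding ideal_smult_def using subsetD[OF subset_submodule_gen] by simp
qed

lemma ideal_smult_principal:
  assumes a: "a \<in> carrier R"
  shows "ideal_smult R (Idl {a}) M = (\<lambda>w. a \<odot>\<^bsub>M\<^esub> w) ` carrier M"
proof
  have Idl: "Idl {a} = {b \<otimes> a | b. b \<in> carrier R}"
    using R.cgenideal_eq_genideal[OF a] by (simp add: cgenideal_def)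
  show "ideal_smult R (Idl {a}) M \<subseteq> (\<lambda>w. a \<odot>\<^bsub>M\<^esub> w) ` carrier M"
    unfolding ideal_smult_def
  proof (rule submodule_gen_subset[OF submodule_smult_image[OF a]], clarify)
    fix i w assume "i \<in> Idl {a}" "w \<in> carrier M"
    then obtain b where b: "b \<in> carrier R" "i = b \<otimes> a" using Idl by blast
    then have "i \<odot>\<^bsub>M\<^esub> w = a \<odot>\<^bsub>M\<^esub> (b \<odot>\<^bsub>M\<^esub> w)"
      using a \<open>w \<in> carrier M\<close> R.m_comm[of b a] by (simp add: smult_assoc1)
    then show "i \<odot>\<^bsub>M\<^esub> w \<in> (\<lambda>w. a \<odot>\<^bsub>M\<^esub> w) ` carrier M" using b \<open>w \<in> carrier M\<close> by blast
  qed
  have "a \<in> Idl {a}" using R.genideal_self'[OF a] .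
  then have "(\<lambda>w. a \<odot>\<^bsub>M\<^esub> w) ` carrier M \<subseteq> {b \<odot>\<^bsub>M\<^esub> u | b u. b \<in> Idl {a} \<and> u \<in> carrier M}" by blast
  then show "(\<lambda>w. a \<odot>\<^bsub>M\<^esub> w) ` carrier M \<subseteq> ideal_smult R (Idl {a}) M"
    unfolding ideal_smult_def by (rule order_trans[OF _ subset_submodule_gen])
qed

text \<open>A linear map \<open>M \<rightarrow> R\<close> that takes the value one at \<open>w\<close> splits: \<open>M\<close> is the sum of \<open>R w\<close> and the kernel.\<close>

lemma free_summandI:
  assumes L: "\<And>v. v \<in> carrier M \<Longrightarrow> L v \<in> carrier R"
    "\<And>v w. v \<in> carrier M \<Longrightarrow> w \<in> carrier M \<Longrightarrow> L (v \<oplus>\<^bsub>M\<^esub> w) = L v \<oplus> L w"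
    "\<And>a w. a \<in> carrier R \<Longrightarrow> w \<in> carrier M \<Longrightarrow> L (a \<odot>\<^bsub>M\<^esub> w) = a \<otimes> L w"
    and w: "w \<in> carrier M" "L w = \<one>"
  shows "\<not> no_free_summand R M"
proof -
  define F where "F = (\<lambda>a. a \<odot>\<^bsub>M\<^esub> w) ` carrier R"
  define N where "N = {v \<in> carrier M. L v = \<zero>}"
  have L0: "L \<zero>\<^bsub>M\<^esub> = \<zero>" using L(3)[of \<zero> w] w by simp
  have Lm: "L (\<ominus>\<^bsub>M\<^esub> v) = \<ominus> L v" if "v \<in> carrier M" for v
  proof -
    have "\<ominus>\<^bsub>M\<^esub> v = (\<ominus> \<one>) \<odot>\<^bsub>M\<^esub> v" using that by (simp add: smult_l_minus)
    then show ?thesis using L(1,3) that by (simp add: R.l_minus)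
  qed
  have LF: "L (a \<odot>\<^bsub>M\<^esub> w) = a" if "a \<in> carrier R" for a using L(3) w that by simp
  have F: "submodule F R M"
  proof (rule submoduleI)
    show "F \<subseteq> carrier M" using w by (auto simp: F_def)
    show "\<zero>\<^bsub>M\<^esub> \<in> F" unfolding F_def using w by (intro image_eqI[of _ _ \<zero>]) auto
    show "\<ominus>\<^bsub>M\<^esub> u \<in> F" if u: "u \<in> F" for u
    proof -
      from u obtain a where "a \<in> carrier R" "u = a \<odot>\<^bsub>M\<^esub> w" by (auto simp: F_def)
      then have "\<ominus>\<^bsub>M\<^esub> u = (\<ominus> a) \<odot>\<^bsub>M\<^esub> w" "\<ominus> a \<in> carrier R" using w by (simp_all add: smult_l_minus)
      then show ?thesis unfolding F_def by blast
    qed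
    show "u \<oplus>\<^bsub>M\<^esub> v \<in> F" if uv: "u \<in> F" "v \<in> F" for u v
    proof -
      from uv obtain a b where "a \<in> carrier R" "u = a \<odot>\<^bsub>M\<^esub> w" "b \<in> carrier R" "v = b \<odot>\<^bsub>M\<^esub> w" by (auto simp: F_def)
      then have "u \<oplus>\<^bsub>M\<^esub> v = (a \<oplus> b) \<odot>\<^bsub>M\<^esub> w" "a \<oplus> b \<in> carrier R" using w by (simp_all add: smult_l_distr)
      then show ?thesis unfolding F_def by blast
    qed
    show "b \<odot>\<^bsub>M\<^esub> u \<in> F" if b: "b \<in> carrier R" and u: "u \<in> F" for b u
    proof -
      from u obtain a where "a \<in> carrier R" "u = a \<odot>\<^bsub>M\<^esub> w" by (auto simp: F_def)
      then have "b \<odot>\<^bsub>M\<^esub> u = (b \<otimes> a) \<odot>\<^bsub>M\<^esub> w" "b \<otimes> a \<in> carrier R" using w b by (simp_all add: smult_assoc1)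
      then show ?thesis unfolding F_def by blast
    qed
  qed
  have N: "submodule N R M"
    by (rule submoduleI) (auto simp: N_def L0 Lm L)
  have "F \<inter> N = {\<zero>\<^bsub>M\<^esub>}"
  proof
    show "F \<inter> N \<subseteq> {\<zero>\<^bsub>M\<^esub>}" using w by (auto simp: F_def N_def LF)
    show "{\<zero>\<^bsub>M\<^esub>} \<subseteq> F \<inter> N" using submodule.axioms(1)[OF F] submodule.axioms(1)[OF N]
      by (auto dest: subgroup.one_closed)
  qed
  moreover have "F <+>\<^bsub>M\<^esub> N = carrier M"
  proof
    show "F <+>\<^bsub>M\<^esub> N \<subseteq> carrier M"
      using submoduleE(1)[OF F] submoduleE(1)[OF N] by (auto simp: set_add_def' subset_iff)
    show "carrier M \<subseteq> F <+>\<^bsub>M\<^esub> N"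
    proof
      fix v assume v: "v \<in> carrier M"
      define u where "u = L v \<odot>\<^bsub>M\<^esub> w"
      have u: "u \<in> carrier M" "u \<in> F" using L(1) v w by (auto simp: u_def F_def)
      have "L (v \<ominus>\<^bsub>M\<^esub> u) = \<zero>"
        using v u(1) L(1) LF[OF L(1)[OF v]] by (simp add: a_minus_def L(2) Lm R.r_neg u_def)
      then have "v \<ominus>\<^bsub>M\<^esub> u \<in> N" using u v by (simp add: N_def)
      moreover have "v = u \<oplus>\<^bsub>M\<^esub> (v \<ominus>\<^bsub>M\<^esub> u)"
        using u v by (simp add: a_minus_def M.a_lcomm[of u] M.r_neg)
      ultimately show "v \<in> F <+>\<^bsub>M\<^esub> N" using u(2) unfolding set_add_def' by blast
    qed
  qed
  moreover have "mod_isomorphic R (M\<lparr>carrier := F\<rparr>) (free_module R 1)"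
    unfolding mod_isomorphic_def
  proof (intro bexI)
    let ?h = "\<lambda>v. \<lambda>i\<in>{..<1::nat}. L v"
    have FM: "F \<subseteq> carrier M" by (rule submoduleE(1)[OF F])
    show "?h \<in> mod_hom R (M\<lparr>carrier := F\<rparr>) (free_module R 1)"
      using FM L by (auto simp: mod_hom_def free_module_def fun_eq_iff subset_iff)
    show "bij_betw ?h (carrier (M\<lparr>carrier := F\<rparr>)) (carrier (free_module R 1))"
    proof (rule bij_betw_byWitness[where f' = "\<lambda>v. v 0 \<odot>\<^bsub>M\<^esub> w"])
      show "\<forall>a\<in>carrier (M\<lparr>carrier := F\<rparr>). ?h a 0 \<odot>\<^bsub>M\<^esub> w = a" by (auto simp: F_def LF)
      show "\<forall>a'\<in>carrier (free_module R 1). ?h (a' 0 \<odot>\<^bsub>M\<^esub> w) = a'"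
        by (auto simp: free_module_def fun_eq_iff restrict_def PiE_def Pi_iff extensional_def LF)
      show "?h ` carrier (M\<lparr>carrier := F\<rparr>) \<subseteq> carrier (free_module R 1)"
        using FM L(1) by (auto simp: free_module_def PiE_def extensional_def restrict_def split: if_splits)
      show "(\<lambda>v. v 0 \<odot>\<^bsub>M\<^esub> w) ` carrier (free_module R 1) \<subseteq> carrier (M\<lparr>carrier := F\<rparr>)"
        by (auto simp: free_module_def F_def)
    qed
  qed
  ultimately show ?thesis
    unfolding no_free_summand_def using F N by blast
qed

end

section \<open>Modules over a hypersurface ring\<close>

lemma regular_module_module: "cring R \<Longrightarrow> Module.module R (regular_module R)"
proof -
  assume "cring R"
  then interpret cring R .
  show ?thesis
  proof (rule moduleI)
    show "abelian_group (regular_module R)"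
    proof (rule abelian_groupI)
      fix a assume "a \<in> carrier (regular_module R)"
      then show "\<exists>y\<in>carrier (regular_module R). y \<oplus>\<^bsub>regular_module R\<^esub> a = \<zero>\<^bsub>regular_module R\<^esub>"
        by (auto simp: regular_module_def intro!: bexI[of _ "\<ominus>\<^bsub>R\<^esub> a"] l_neg)
    qed (auto simp: regular_module_def a_ac)
  qed (auto simp: regular_module_def l_distr r_distr m_assoc is_cring)
qed

lemma ideal_submodule: "cring R \<Longrightarrow> ideal I R \<Longrightarrow> submodule I R (regular_module R)"
proof -
  assume "cring R" and I: "ideal I R"
  interpret I: ideal I R by fact
  interpret M: Module.module R "regular_module R" by (rule regular_module_module) fact
  have inv: "\<ominus>\<^bsub>regular_module R\<^esub> a = \<ominus>\<^bsub>R\<^esub> a" if "a \<in> carrier R" for a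
    by (rule M.M.minus_equality) (use that in \<open>auto simp: regular_module_def I.l_neg\<close>)
  show ?thesis
    by (rule M.submoduleI) (auto simp: inv, auto simp: regular_module_def I.I_l_closed)
qed

context hypersurface
begin

text \<open>An element of the quotient of the ring by a power of its maximal ideal is a coset of cosets of series;
  \<open>res\<close> gives direct access to it from the series.\<close>

definition res :: "nat \<Rightarrow> 'k fps fps \<Rightarrow> 'k fps fps set set" where
  "res n s = proj ` mpow n +>\<^bsub>regular_module R\<^esub> proj s"

abbreviation res_module :: "nat \<Rightarrow> ('k fps fps set, 'k fps fps set set) module" where
  "res_module n \<equiv> quot_module (regular_module R) (proj ` mpow n)"

lemma submodule_mpow: "submodule (proj ` mpow n) R (regular_module R)"
  by (intro ideal_submodule cring_R ideal_proj_mpow)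

lemma regular_carrier: "carrier (regular_module R) = range proj"
  by (simp add: regular_module_def carrier_R)

sublocale reg: Module.module R "regular_module R"
  by (rule regular_module_module[OF cring_R])

lemma reg_ops: "proj s \<oplus>\<^bsub>regular_module R\<^esub> proj t = proj (s + t)"
  "proj s \<odot>\<^bsub>regular_module R\<^esub> proj t = proj (s * t)"
  "proj s \<ominus>\<^bsub>regular_module R\<^esub> proj t = proj (s - t)"
proof -
  show 1: "proj s \<oplus>\<^bsub>regular_module R\<^esub> proj t = proj (s + t)" for s t
    by (simp add: regular_module_def proj_add)
  show "proj s \<odot>\<^bsub>regular_module R\<^esub> proj t = proj (s * t)" by (simp add: regular_module_def proj_mult)
  have "\<ominus>\<^bsub>regular_module R\<^esub> proj t = proj (- t)"
  proof (rule reg.M.minus_equality)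
    show "proj (- t) \<oplus>\<^bsub>regular_module R\<^esub> proj t = \<zero>\<^bsub>regular_module R\<^esub>"
      unfolding 1 by (simp add: regular_module_def proj_0)
  qed (simp_all add: regular_carrier)
  then show "proj s \<ominus>\<^bsub>regular_module R\<^esub> proj t = proj (s - t)" by (simp add: a_minus_def 1)
qed

lemma res_carrier: "carrier (res_module n) = range (res n)"
  unfolding reg.quot_carrier regular_carrier res_def[abs_def] by auto

lemma res_eq_iff: "res n s = res n t \<longleftrightarrow> proj (s - t) \<in> proj ` mpow n"
  unfolding res_def by (subst reg.coset_eq_iff[OF submodule_mpow]) (auto simp: reg_ops regular_carrier)

lemma res_eqI: "s - t \<in> mpow n \<Longrightarrow> res n s = res n t"
  unfolding res_eq_iff by blast

lemma res_add: "res n s \<oplus>\<^bsub>res_module n\<^esub> res n t = res n (s + t)"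
  unfolding res_def by (subst reg.quot_add[OF submodule_mpow]) (auto simp: reg_ops regular_carrier)

lemma res_smult: "proj a \<odot>\<^bsub>res_module n\<^esub> res n s = res n (a * s)"
  unfolding res_def by (subst reg.quot_smult[OF submodule_mpow]) (auto simp: reg_ops regular_carrier)

text \<open>A module over the hypersurface ring becomes a module over \<open>k[[x, y]]\<close> along any ring endomorphism \<open>g\<close>
  followed by the projection.\<close>

lemma module_ps_module:
  assumes "Module.module R W"
    and "\<And>s t. g (s + t) = g s + g t" "\<And>s t. g (s * t) = g s * g t" "g 1 = 1"
  shows "ps_module W (\<lambda>s w. proj (g s) \<odot>\<^bsub>W\<^esub> w)"
proof -
  interpret W: Module.module R W by fact
  show ?thesis
    by (unfold_locales)
       (auto simp: assms proj_add proj_mult proj_1 W.smult_l_distr W.smult_r_distr W.smult_assoc1)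
qed

text \<open>Regular sequences are defined through quotients by submodules; for the first two members the condition
  is restated inside \<open>W\<close>.\<close>

lemma regular_sequence_first:
  assumes W: "Module.module R W" and reg: "regular_sequence R W xs" and xs: "0 < length xs"
    and w: "w \<in> carrier W" "(xs ! 0) \<odot>\<^bsub>W\<^esub> w = \<zero>\<^bsub>W\<^esub>"
  shows "w = \<zero>\<^bsub>W\<^esub>"
proof -
  interpret W: Module.module R W by fact
  let ?Z = "{\<zero>\<^bsub>W\<^esub>}"
  have "set xs \<subseteq> carrier R" using reg unfolding regular_sequence_def by blast
  then have x: "xs ! 0 \<in> carrier R" using nth_mem[OF xs] by blast
  have "\<forall>u\<in>carrier (quot_module W ?Z). (xs ! 0) \<odot>\<^bsub>quot_module W ?Z\<^esub> u = \<zero>\<^bsub>quot_module W ?Z\<^esub> \<longrightarrow> u = \<zero>\<^bsub>quot_module W ?Z\<^esub>"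
    using reg xs unfolding regular_sequence_def
    by (auto simp: Let_def Idl_empty W.ideal_smult_empty dest!: spec[of _ 0])
  moreover have "?Z +>\<^bsub>W\<^esub> w \<in> carrier (quot_module W ?Z)" using w by (auto simp: W.quot_carrier)
  moreover have "(xs ! 0) \<odot>\<^bsub>quot_module W ?Z\<^esub> (?Z +>\<^bsub>W\<^esub> w) = \<zero>\<^bsub>quot_module W ?Z\<^esub>"
    using x w W.coset_eq_self_iff[OF W.submodule_zero, of "\<zero>\<^bsub>W\<^esub>"]
    by (simp add: W.quot_smult[OF W.submodule_zero] W.quot_zero)
  ultimately have "?Z +>\<^bsub>W\<^esub> w = ?Z" by (auto simp: W.quot_zero)
  then show ?thesis using W.coset_eq_self_iff[OF W.submodule_zero w(1)] by simp
qed

lemma regular_sequence_second: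
  assumes W: "Module.module R W" and reg: "regular_sequence R W xs" and xs: "1 < length xs"
    and w: "w \<in> carrier W" "(xs ! 1) \<odot>\<^bsub>W\<^esub> w \<in> (\<lambda>v. (xs ! 0) \<odot>\<^bsub>W\<^esub> v) ` carrier W"
  shows "w \<in> (\<lambda>v. (xs ! 0) \<odot>\<^bsub>W\<^esub> v) ` carrier W"
proof -
  interpret W: Module.module R W by fact
  let ?Z = "(\<lambda>v. (xs ! 0) \<odot>\<^bsub>W\<^esub> v) ` carrier W"
  have "set xs \<subseteq> carrier R" using reg unfolding regular_sequence_def by blast
  moreover have "0 < length xs" using xs by linarith
  ultimately have x: "xs ! 0 \<in> carrier R" "xs ! 1 \<in> carrier R" using nth_mem[of 0 xs] nth_mem[OF xs] by blast+
  have Z: "submodule ?Z R W" by (rule W.submodule_smult_image[OF x(1)])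
  have "set (take 1 xs) = {xs ! 0}" using xs by (cases xs) auto
  then have I: "ideal_smult R (Idl\<^bsub>R\<^esub> (set (take 1 xs))) W = ?Z"
    using W.ideal_smult_principal[OF x(1)] by simp
  have "\<forall>u\<in>carrier (quot_module W ?Z). (xs ! 1) \<odot>\<^bsub>quot_module W ?Z\<^esub> u = \<zero>\<^bsub>quot_module W ?Z\<^esub> \<longrightarrow> u = \<zero>\<^bsub>quot_module W ?Z\<^esub>"
    using reg xs unfolding regular_sequence_def Let_def I[symmetric] by blast
  moreover have "?Z +>\<^bsub>W\<^esub> w \<in> carrier (quot_module W ?Z)" using w by (auto simp: W.quot_carrier)
  moreover have "(xs ! 1) \<odot>\<^bsub>quot_module W ?Z\<^esub> (?Z +>\<^bsub>W\<^esub> w) = \<zero>\<^bsub>quot_module W ?Z\<^esub>"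
    using x w W.coset_eq_self_iff[OF Z]
    by (simp add: W.quot_smult[OF Z] W.quot_zero)
  ultimately have "?Z +>\<^bsub>W\<^esub> w = ?Z" by (auto simp: W.quot_zero)
  then show ?thesis using W.coset_eq_self_iff[OF Z w(1)] by simp
qed

lemma regular_sequence_singleton:
  assumes W: "Module.module R W"
    and nzd: "\<And>w. w \<in> carrier W \<Longrightarrow> proj h \<odot>\<^bsub>W\<^esub> w = \<zero>\<^bsub>W\<^esub> \<Longrightarrow> w = \<zero>\<^bsub>W\<^esub>"
    and proper: "(\<lambda>v. proj h \<odot>\<^bsub>W\<^esub> v) ` carrier W \<noteq> carrier W"
  shows "regular_sequence R W [proj h]"
proof -
  interpret W: Module.module R W by fact
  let ?Z = "{\<zero>\<^bsub>W\<^esub>}"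
  have "u = \<zero>\<^bsub>quot_module W ?Z\<^esub>"
    if "u \<in> carrier (quot_module W ?Z)" "proj h \<odot>\<^bsub>quot_module W ?Z\<^esub> u = \<zero>\<^bsub>quot_module W ?Z\<^esub>" for u
  proof -
    from that(1) obtain w where w: "w \<in> carrier W" "u = ?Z +>\<^bsub>W\<^esub> w" by (auto simp: W.quot_carrier)
    have "?Z +>\<^bsub>W\<^esub> (proj h \<odot>\<^bsub>W\<^esub> w) = ?Z"
      using that(2) unfolding w(2) W.quot_smult[OF W.submodule_zero proj_closed w(1)] W.quot_zero .
    then have "proj h \<odot>\<^bsub>W\<^esub> w = \<zero>\<^bsub>W\<^esub>" using W.coset_eq_self_iff[OF W.submodule_zero] w(1) by simp
    then have "w = \<zero>\<^bsub>W\<^esub>" by (rule nzd[OF w(1)])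
    then show ?thesis using W.coset_eq_self_iff[OF W.submodule_zero w(1)] by (simp add: w(2) W.quot_zero)
  qed
  then show ?thesis
    using proper unfolding regular_sequence_def
    by (simp add: Let_def Idl_empty W.ideal_smult_empty W.ideal_smult_principal)
qed

end

section \<open>Covers by maximal Cohen-Macaulay modules without free summand\<close>

lemma parabola_subst: "ps_substitution (parabola :: 'k::comm_ring_1 fps fps) py"
  by unfold_locales (rule parabola_mpow py_mpow)+

lemma parabola_subst_inv: "ps_substitution (px + py ^ 2 :: 'k::comm_ring_1 fps fps) py"
  unfolding power2_eq_square
  by unfold_locales (intro mpow_add px_mpow mpow_mult_left py_mpow)+

text \<open>Mutually inverse changes of coordinates: \<open>unstraighten\<close> maps \<open>x\<close> to the parabola, so \<open>straighten\<close>
  rewrites a series in terms of the parabola and \<open>y\<close>.\<close>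

definition straighten :: "'k::comm_ring_1 fps fps \<Rightarrow> 'k fps fps" where
  "straighten = psubst (px + py ^ 2) py"

definition unstraighten :: "'k::comm_ring_1 fps fps \<Rightarrow> 'k fps fps" where
  "unstraighten = psubst parabola py"

lemma unstraighten_straighten: "unstraighten (straighten s) = s"
proof -
  interpret ps_substitution parabola py by (rule parabola_subst)
  have "psubst parabola py (px + py ^ 2) = px"
    by (simp add: psubst_add psubst_power psubst_px psubst_py) (simp add: parabola_def)
  then show ?thesis
    unfolding straighten_def unstraighten_def
    by (intro psubst_inverse[OF parabola_subst parabola_subst_inv] psubst_py)
qed

lemma straighten_unstraighten: "straighten (unstraighten s) = s"
proof -
  interpret ps_substitution "px + py ^ 2" py by (rule parabola_subst_inv)
  have "psubst (px + py ^ 2) py parabola = px"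
    by (simp add: parabola_def psubst_diff psubst_power psubst_px psubst_py)
  then show ?thesis
    unfolding straighten_def unstraighten_def
    by (intro psubst_inverse[OF parabola_subst_inv parabola_subst] psubst_py)
qed

lemmas unstraighten_hom =
  ps_substitution.psubst_add[OF parabola_subst, folded unstraighten_def]
  ps_substitution.psubst_mult[OF parabola_subst, folded unstraighten_def]
  ps_substitution.psubst_1[OF parabola_subst, folded unstraighten_def]
  ps_substitution.psubst_diff[OF parabola_subst, folded unstraighten_def]
  ps_substitution.psubst_px[OF parabola_subst, folded unstraighten_def]
  ps_substitution.psubst_py[OF parabola_subst, folded unstraighten_def]

lemma unstraighten_mpow_iff: "unstraighten s \<in> mpow n \<longleftrightarrow> s \<in> mpow n"
  using ps_substitution.psubst_mpow[OF parabola_subst, of s n]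
    ps_substitution.psubst_mpow[OF parabola_subst_inv, of "unstraighten s" n]
    straighten_unstraighten[of s]
  by (metis straighten_def unstraighten_def)

text \<open>If the parabola kills \<open>w \<noteq> 0\<close>, then so does a power of the maximal ideal, because that power lies in the ideal
  generated by the parabola and \<open>f\<close>. Hence some nonzero multiple of \<open>w\<close> is killed by the whole
  maximal ideal, in contradiction to the existence of a regular element.\<close>

lemma mcm_parabola_regular:
  fixes W :: "('k::{field,finite} fps fps set, 'w, 'd) module_scheme"
  assumes W: "max_cohen_macaulay H.R W"
    and w: "w \<in> carrier W" "H.proj parabola \<odot>\<^bsub>W\<^esub> w = \<zero>\<^bsub>W\<^esub>"
  shows "w = \<zero>\<^bsub>W\<^esub>"
proof (rule ccontr)
  assume nz: "w \<noteq> \<zero>\<^bsub>W\<^esub>"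
  have mod: "Module.module H.R W" using W by (simp add: max_cohen_macaulay_def fin_gen_module_def)
  interpret W: Module.module H.R W by (rule mod)
  have depth: "module_depth H.R W = 1"
    using W nz w(1) by (auto simp: max_cohen_macaulay_def krull_dim_arrangement)
  have "\<exists>xs. set xs \<subseteq> max_ideal H.R \<and> regular_sequence H.R W xs \<and> 0 < length xs"
  proof (rule ccontr)
    assume "\<not> ?thesis"
    then have "module_depth H.R W \<le> 0"
      unfolding module_depth_def by (intro Sup_least) (auto simp: zero_enat_def)
    then show False by (simp add: depth)
  qed
  then obtain xs where xs: "set xs \<subseteq> max_ideal H.R" "regular_sequence H.R W xs" "0 < length xs" by blast
  then have "xs ! 0 \<in> H.proj ` mpow 1" using nth_mem[OF xs(3)] unfolding H.max_ideal_R by blast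
  then obtain h where h: "h \<in> mpow 1" "xs ! 0 = H.proj h" by blast
  have kill: "H.proj s \<odot>\<^bsub>W\<^esub> w = \<zero>\<^bsub>W\<^esub>" if s: "s \<in> mpow (CARD('k) + 2)" for s
  proof -
    obtain a b where "s = a * parabola + b * arrangement" using mpow_parabola_arrangement[OF s] by blast
    then have "H.proj s = H.proj (a * parabola)" unfolding H.proj_eq_iff by simp
    then show ?thesis using w by (simp add: H.proj_mult W.smult_assoc1)
  qed
  define n where "n = (LEAST n. \<forall>s\<in>mpow n. H.proj s \<odot>\<^bsub>W\<^esub> w = \<zero>\<^bsub>W\<^esub>)"
  have n: "\<forall>s\<in>mpow n. H.proj s \<odot>\<^bsub>W\<^esub> w = \<zero>\<^bsub>W\<^esub>"
    unfolding n_def by (rule LeastI[of _ "CARD('k) + 2"]) (use kill in blast)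
  have "n \<noteq> 0"
  proof
    assume "n = 0"
    then have "H.proj 1 \<odot>\<^bsub>W\<^esub> w = \<zero>\<^bsub>W\<^esub>" using n by simp
    then show False using nz w(1) by (simp add: H.proj_1)
  qed
  then obtain m where m: "n = Suc m" by (cases n) auto
  then have "\<not> (\<forall>s\<in>mpow m. H.proj s \<odot>\<^bsub>W\<^esub> w = \<zero>\<^bsub>W\<^esub>)"
    using not_less_Least[of m "\<lambda>n. \<forall>s\<in>mpow n. H.proj s \<odot>\<^bsub>W\<^esub> w = \<zero>\<^bsub>W\<^esub>"] unfolding n_def[symmetric] by simp
  then obtain s where s: "s \<in> mpow m" "H.proj s \<odot>\<^bsub>W\<^esub> w \<noteq> \<zero>\<^bsub>W\<^esub>" by blast
  have "h * s \<in> mpow n" using mpow_mult[OF h(1) s(1)] m by simp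
  then have "H.proj h \<odot>\<^bsub>W\<^esub> (H.proj s \<odot>\<^bsub>W\<^esub> w) = \<zero>\<^bsub>W\<^esub>"
    using n w(1) W.smult_assoc1[of "H.proj h" "H.proj s" w] by (simp flip: H.proj_mult)
  then have "H.proj s \<odot>\<^bsub>W\<^esub> w = \<zero>\<^bsub>W\<^esub>"
    using H.regular_sequence_first[OF mod xs(2,3)] w(1) h(2) by simp
  with s(2) show False by simp
qed

text \<open>The lower bound for the index. The series \<open>f\<close> below is the equation of the arrangement in the straightened coordinates, in
  which the parabola is the variable \<open>x\<close>. Either \<open>\<sigma>w0\<close>, with \<open>\<sigma>\<close> the shift of \<open>f\<close> by one, lies outside \<open>xW\<close>, and then
  there is a linear form on \<open>W\<close> with a unit among its values; or \<open>\<sigma>w0 = xw1\<close>, and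
  then the image of \<open>w1\<close> reveals that \<open>f\<close> has order at least \<open>q + 2\<close>.\<close>

lemma no_mcm_cover:
  fixes W :: "('k::{field,finite} fps fps set, 'w, 'd) module_scheme"
  assumes W: "max_cohen_macaulay H.R W" "no_free_summand H.R W"
    and \<phi>_closed: "\<And>w. w \<in> carrier W \<Longrightarrow> \<phi> w \<in> carrier (H.res_module (CARD('k) + 1))"
    and \<phi>_add: "\<And>v w. v \<in> carrier W \<Longrightarrow> w \<in> carrier W \<Longrightarrow>
      \<phi> (v \<oplus>\<^bsub>W\<^esub> w) = \<phi> v \<oplus>\<^bsub>H.res_module (CARD('k) + 1)\<^esub> \<phi> w"
    and \<phi>_smult: "\<And>s w. w \<in> carrier W \<Longrightarrow>
      \<phi> (H.proj s \<odot>\<^bsub>W\<^esub> w) = H.proj s \<odot>\<^bsub>H.res_module (CARD('k) + 1)\<^esub> \<phi> w"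
    and w0: "w0 \<in> carrier W" "\<phi> w0 = H.res (CARD('k) + 1) 1"
  shows False
proof -
  define n where "n = CARD('k) + 1"
  have arrangement_n: "(arrangement :: 'k fps fps) \<in> mpow n" unfolding n_def by (rule arrangement_mpow)
  have res_eq: "H.res n s = H.res n t \<longleftrightarrow> s - t \<in> mpow n" for s t :: "'k fps fps"
    unfolding H.res_eq_iff H.proj_mem_mpow[OF arrangement_n] ..
  have mod: "Module.module H.R W" using W by (simp add: max_cohen_macaulay_def fin_gen_module_def)
  interpret W: Module.module H.R W by (rule mod)
  let ?u = "unstraighten :: 'k fps fps \<Rightarrow> 'k fps fps"
  define act where "act = (\<lambda>s w. H.proj (?u s) \<odot>\<^bsub>W\<^esub> w)"
  interpret P: ps_module W act
    unfolding act_def by (rule H.module_ps_module[OF mod]) (simp_all add: unstraighten_hom)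
  define f where "f = (straighten arrangement :: 'k fps fps)"
  have uf: "?u f = arrangement" by (simp add: f_def unstraighten_straighten)
  have f_kills: "act f w = \<zero>\<^bsub>W\<^esub>" if "w \<in> carrier W" for w
    using that H.proj_eq_0_iff[of "arrangement :: 'k fps fps"] by (simp add: act_def uf)
  have inj: "w = \<zero>\<^bsub>W\<^esub>" if "w \<in> carrier W" "act px w = \<zero>\<^bsub>W\<^esub>" for w
    using mcm_parabola_regular[OF W(1) that(1)] that(2) by (simp add: act_def unstraighten_hom)
  show False
  proof (cases "act (fps_shift 1 f) w0 \<in> act px ` carrier W")
    case False
    obtain l where l: "\<And>v w. v \<in> carrier W \<Longrightarrow> w \<in> carrier W \<Longrightarrow> l (v \<oplus>\<^bsub>W\<^esub> w) = l v + l w"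
      "\<And>s w. w \<in> carrier W \<Longrightarrow> f dvd l (act s w) - s * l w" "l w0 $ 0 $ 0 = 1"
      using P.linear_map_to_hypersurface[OF inj f_kills w0(1) False] by blast
    define L where "L v = H.proj (?u (l v))" for v
    have L_smult: "L (a \<odot>\<^bsub>W\<^esub> w) = a \<otimes>\<^bsub>H.R\<^esub> L w" if a: "a \<in> carrier H.R" and w: "w \<in> carrier W" for a w
    proof -
      from a obtain s where "a = H.proj s" by (auto simp: H.carrier_R)
      then have s: "a = H.proj (?u (straighten s))" by (simp add: unstraighten_straighten)
      obtain c where "l (act (straighten s) w) - straighten s * l w = f * c" using l(2)[OF w] by (auto simp: dvd_def)
      then have "?u (l (act (straighten s) w) - straighten s * l w) = arrangement * ?u c"
        by (simp add: unstraighten_hom uf)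
      then have "H.proj (?u (l (act (straighten s) w))) = H.proj (?u (straighten s) * ?u (l w))"
        unfolding H.proj_eq_iff by (simp add: unstraighten_hom)
      then show ?thesis by (simp add: L_def s act_def H.proj_mult)
    qed
    have "?u (l w0) $ 0 $ 0 = 1"
      using l(3) ps_substitution.psubst_const_coeff[OF parabola_subst, of "l w0"] by (simp add: unstraighten_def)
    then obtain t where t: "?u (l w0) * t = 1" using ps_unit[of "?u (l w0)"] by auto
    have "\<not> no_free_summand H.R W"
    proof (rule W.free_summandI[of L])
      show "H.proj t \<odot>\<^bsub>W\<^esub> w0 \<in> carrier W" using w0 by simp
      show "L (H.proj t \<odot>\<^bsub>W\<^esub> w0) = \<one>\<^bsub>H.R\<^esub>"
        using L_smult[of "H.proj t" w0] w0(1) t by (simp add: L_def mult.commute flip: H.proj_mult H.proj_1)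
      show "L v \<in> carrier H.R" for v by (simp add: L_def)
      show "L (v \<oplus>\<^bsub>W\<^esub> w) = L v \<oplus>\<^bsub>H.R\<^esub> L w" if "v \<in> carrier W" "w \<in> carrier W" for v w
        using that by (simp add: L_def l(1) unstraighten_hom H.proj_add)
    qed (rule L_smult)
    with W(2) show False by simp
  next
    case True
    then obtain w1 where w1: "w1 \<in> carrier W" "act (fps_shift 1 f) w0 = act px w1" by blast
    have "\<phi> w1 \<in> range (H.res n)" using \<phi>_closed[OF w1(1)] unfolding H.res_carrier n_def .
    then obtain r' where r': "\<phi> w1 = H.res n r'" by blast
    define r where "r = straighten r'"
    have \<phi>0: "\<phi> (act s w0) = H.res n (?u s)" for s
      unfolding act_def using \<phi>_smult[OF w0(1)] w0(2) by (simp add: n_def H.res_smult)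
    have \<phi>1: "\<phi> (act s w1) = H.res n (?u (s * r))" for s
      unfolding act_def using \<phi>_smult[OF w1(1)] r'
      by (simp add: n_def H.res_smult r_def unstraighten_hom unstraighten_straighten)
    have "H.res n (?u (fps_shift 1 f)) = H.res n (?u (px * r))"
      using \<phi>0 \<phi>1 w1(2) by metis
    then have d1: "fps_shift 1 f - px * r \<in> mpow n"
      unfolding res_eq unstraighten_hom(4)[symmetric] unstraighten_mpow_iff .
    define \<rho> where "\<rho> = shx f"
    have "f \<in> mpow n" using unstraighten_mpow_iff[of f n] uf arrangement_n by simp
    then have "f $ 0 $ 0 = 0" by (auto simp: mpow_def n_def)
    then have f: "f = px * \<rho> + py * fps_shift 1 f" using ps_decomp[of f] by (simp add: \<rho>_def)
    (* x (y w1 + \<rho> w0) = (y \<sigma> + x \<rho>) w0 = f w0 = 0, and x can be cancelled. *)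
    let ?v = "act py w1 \<oplus>\<^bsub>W\<^esub> act \<rho> w0"
    have vW: "?v \<in> carrier W" using w0 w1 by simp
    have "act px ?v = act py (act px w1) \<oplus>\<^bsub>W\<^esub> act px (act \<rho> w0)"
      using w0(1) w1(1) P.act_comm[OF w1(1), of px py] by (simp add: P.act_distrib)
    also have "\<dots> = act (py * fps_shift 1 f + px * \<rho>) w0"
      unfolding w1(2)[symmetric] using w0(1) by (simp add: P.act_add P.act_mult)
    also have "\<dots> = \<zero>\<^bsub>W\<^esub>" using f f_kills[OF w0(1)] by (simp add: add.commute)
    finally have "?v = \<zero>\<^bsub>W\<^esub>" by (rule inj[OF vW])
    moreover have "\<phi> \<zero>\<^bsub>W\<^esub> = H.res n 0"
    proof -
      have "\<phi> (act 0 w0) = H.res n (?u 0)" by (rule \<phi>0)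
      moreover have "?u 0 = 0" using unstraighten_hom(4)[of 0 0] by simp
      ultimately show ?thesis using w0(1) by simp
    qed
    ultimately have "H.res n (?u (py * r + \<rho>)) = H.res n 0"
      using \<phi>_add[folded n_def, of "act py w1" "act \<rho> w0"] w0(1) w1(1)
      by (simp add: \<phi>0 \<phi>1 unstraighten_hom(1) H.res_add)
    then have d2: "py * r + \<rho> \<in> mpow n"
      unfolding res_eq by (simp add: unstraighten_mpow_iff)
    have "f = px * (py * r + \<rho>) + py * (fps_shift 1 f - px * r)"
      by (subst f) (simp add: algebra_simps)
    also have "\<dots> \<in> mpow (Suc n)"
      using mpow_mult[OF px_mpow d2] mpow_mult[OF py_mpow d1] by (simp add: mpow_add)
    finally have "(arrangement :: 'k fps fps) \<in> mpow (Suc n)" using unstraighten_mpow_iff[of f "Suc n"] uf by simp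
    then show False using arrangement_not_mpow[where 'k = 'k] by (simp add: n_def)
  qed
qed

text \<open>Multiply the relations for the individual lines.\<close>

lemma line_prod_coprime_power:
  fixes h t :: "'k::{field,finite} fps fps"
  assumes h: "\<And>\<alpha>. \<not> (px + kc \<alpha> * py) dvd h" and t: "t \<in> mpow 1"
  shows "\<exists>n a b. t ^ n = a * line_prod + b * h"
proof -
  have "\<exists>n a b. t ^ n = a * (\<Prod>\<alpha>\<in>A. px + kc \<alpha> * py) + b * h" if "finite A" for A
    using that
  proof (induction A rule: finite_induct)
    case empty
    then show ?case by (intro exI[of _ 0] exI[of _ 1]) simp
  next
    case (insert \<alpha> A)
    let ?l = "px + kc \<alpha> * py" and ?p = "\<Prod>\<alpha>\<in>A. px + kc \<alpha> * py"
    from insert obtain n a b where n: "t ^ n = a * ?p + b * h" by blast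
    obtain m c d where m: "t ^ m = c * ?l + d * h"
      using line_coprime_power[OF is_line_px h t] by blast
    have "t ^ (m + n) = (c * a) * (?l * ?p) + (c * ?l * b + d * (a * ?p + b * h)) * h"
      unfolding power_add m n by (simp add: algebra_simps)
    moreover have "(\<Prod>\<alpha>\<in>insert \<alpha> A. px + kc \<alpha> * py) = ?l * ?p" using insert.hyps by simp
    ultimately show ?case by metis
  qed
  then show ?thesis by (simp add: line_prod_def)
qed

lemma py_not_dvd_line_prod: "\<not> (py :: 'k::{field,finite} fps fps) dvd line_prod"
proof -
  have "(\<Prod>\<alpha>\<in>A. px + kc \<alpha> * py) $ 0 = (fps_X :: 'k fps) ^ card A" if "finite A" for A
    using that by (induction A rule: finite_induct) simp_all
  then show ?thesis by (simp add: residue_py line_prod_def)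
qed

text \<open>The cyclic module \<open>S/(g)\<close> with \<open>g\<close> the product of the lines \<open>x + \<alpha>y = 0\<close>, described by a
  generator and its annihilator. This description is stable under isomorphism, so the universe in
  which the module lives is of no concern.\<close>

locale line_prod_module = Module.module H.R W
  for W :: "('k::{field,finite} fps fps set, 'w, 'd) module_scheme" (structure) +
  fixes w1 :: 'w
  assumes w1: "w1 \<in> carrier W"
    and gen: "carrier W = range (\<lambda>s. H.proj s \<odot> w1)"
    and ann: "\<And>s. H.proj s \<odot> w1 = \<zero>\<^bsub>W\<^esub> \<longleftrightarrow> line_prod dvd s"
begin

lemma W_module: "Module.module H.R W" by (rule module_axioms)

lemma smult_gen: "H.proj s \<odot> (H.proj t \<odot> w1) = H.proj (s * t) \<odot> w1"
  using w1 by (simp add: H.proj_mult smult_assoc1)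

lemma gen_eq_iff: "H.proj s \<odot> w1 = H.proj t \<odot> w1 \<longleftrightarrow> line_prod dvd s - t"
proof -
  have "H.proj (s - t) \<odot> w1 = H.proj s \<odot> w1 \<ominus>\<^bsub>W\<^esub> H.proj t \<odot> w1"
    using w1 H.proj_add[of s "- t"] by (simp add: H.proj_uminus smult_l_distr smult_l_minus a_minus_def)
  moreover have "H.proj s \<odot> w1 \<ominus>\<^bsub>W\<^esub> H.proj t \<odot> w1 = \<zero>\<^bsub>W\<^esub> \<longleftrightarrow> H.proj s \<odot> w1 = H.proj t \<odot> w1"
    using ps_module.eq_of_diff_0[OF H.module_ps_module[OF W_module, of "\<lambda>s. s"], of "H.proj s \<odot> w1" "H.proj t \<odot> w1"] w1
    by (auto simp: a_minus_def M.r_neg)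
  ultimately show ?thesis using ann[of "s - t"] by simp
qed

lemma fin_gen: "fin_gen_module H.R W"
  unfolding fin_gen_module_def
proof (intro conjI exI[of _ "{w1}"])
  show "submodule_gen H.R W {w1} = carrier W"
  proof
    show "submodule_gen H.R W {w1} \<subseteq> carrier W" using w1 by (intro submodule_gen_closed) simp
    show "carrier W \<subseteq> submodule_gen H.R W {w1}"
      unfolding submodule_gen_def gen using submoduleE(4) by fastforce
  qed
qed (use w1 W_module in auto)

lemma py_regular: "w \<in> carrier W \<Longrightarrow> H.proj py \<odot> w = \<zero>\<^bsub>W\<^esub> \<Longrightarrow> w = \<zero>\<^bsub>W\<^esub>"
proof -
  assume "w \<in> carrier W" and 0: "H.proj py \<odot> w = \<zero>\<^bsub>W\<^esub>"
  then obtain s where w: "w = H.proj s \<odot> w1" by (auto simp: gen)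
  have "line_prod dvd py * s" using 0 unfolding w smult_gen ann .
  then obtain u where u: "py * s = line_prod * u" by (auto simp: dvd_def)
  have "py dvd line_prod * u" unfolding u[symmetric] by simp
  then have "py dvd u" using line_prime[OF is_line_py] py_not_dvd_line_prod by blast
  then obtain v where "u = py * v" by (auto simp: dvd_def)
  then have "py * s = py * (line_prod * v)" using u by (simp add: algebra_simps)
  then have "s = line_prod * v" by simp
  then show ?thesis unfolding w ann by simp
qed

lemma mult_not_surj:
  assumes "h \<in> mpow 1" shows "w1 \<notin> (\<lambda>w. H.proj h \<odot> w) ` carrier W"
proof
  assume "w1 \<in> (\<lambda>w. H.proj h \<odot> w) ` carrier W"
  then obtain w where "w \<in> carrier W" "w1 = H.proj h \<odot> w" by blast
  then obtain s where s: "w1 = H.proj h \<odot> (H.proj s \<odot> w1)" unfolding gen by blast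
  have "H.proj 1 \<odot> w1 = w1" using w1 by (simp add: H.proj_1)
  also have "\<dots> = H.proj (h * s) \<odot> w1" using s unfolding smult_gen .
  finally obtain c where "1 - h * s = line_prod * c" unfolding gen_eq_iff by (auto simp: dvd_def)
  moreover have "line_prod \<in> mpow 1" by (rule mpow_mono[OF _ line_prod_mpow]) (simp add: Suc_le_eq)
  ultimately have "1 - h * s \<in> mpow 1" using mpow_mult_right by metis
  then have "1 - h * s + h * s \<in> mpow 1" using mpow_mult_right[OF assms] by (rule mpow_add)
  then show False by (simp add: mpow_1_iff del: One_nat_def)
qed

text \<open>The first member \<open>h\<close> of a regular sequence is divisible by none of the lines, so
  a power of the second member \<open>t\<close> lies in \<open>(g, h)\<close>. Since \<open>t\<close> is regular modulo \<open>h\<close>, its powers can be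
  cancelled one after the other, until the generator itself would be a multiple of \<open>h\<close>.\<close>

lemma no_regular_pair:
  assumes xs: "set xs \<subseteq> max_ideal H.R" "regular_sequence H.R W xs" shows "length xs \<le> 1"
proof (rule ccontr)
  assume "\<not> length xs \<le> 1"
  then have len: "0 < length xs" "1 < length xs" by auto
  from xs(1) nth_mem[OF len(1)] nth_mem[OF len(2)]
  have "xs ! 0 \<in> H.proj ` mpow 1" "xs ! 1 \<in> H.proj ` mpow 1" unfolding H.max_ideal_R by blast+
  then obtain h t where h: "h \<in> mpow 1" "xs ! 0 = H.proj h" and t: "t \<in> mpow 1" "xs ! 1 = H.proj t" by blast
  have nd: "\<not> (px + kc \<alpha> * py) dvd h" for \<alpha> :: 'k
  proof
    let ?l = "px + kc \<alpha> * py"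
    assume "?l dvd h"
    then obtain b where b: "h = ?l * b" by (auto simp: dvd_def)
    have "?l dvd line_prod" unfolding line_prod_def by (rule dvd_prodI) auto
    then obtain c where c: "line_prod = ?l * c" by (auto simp: dvd_def)
    have "line_prod dvd h * c" unfolding b c by (simp add: ac_simps)
    then have "H.proj h \<odot> (H.proj c \<odot> w1) = \<zero>\<^bsub>W\<^esub>" unfolding smult_gen ann .
    then have "H.proj c \<odot> w1 = \<zero>\<^bsub>W\<^esub>"
      using H.regular_sequence_first[OF W_module xs(2) len(1)] w1 h(2) by simp
    then have "line_prod dvd c" unfolding ann .
    then obtain e where e: "c = line_prod * e" by (auto simp: dvd_def)
    have "c * (1 - ?l * e) = 0" using e[unfolded c] by (simp add: algebra_simps)
    moreover have "c \<noteq> 0" using c py_not_dvd_line_prod[where 'k = 'k] by auto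
    ultimately have "1 = ?l * e" by simp
    then have "(1 :: 'k fps fps) \<in> mpow 1" using mpow_mult_right[OF line_mpow[OF is_line_px]] by metis
    then show False by (simp add: mpow_1_iff del: One_nat_def)
  qed
  let ?N = "(\<lambda>w. H.proj h \<odot> w) ` carrier W"
  obtain n a b where n: "t ^ n = a * line_prod + b * h" using line_prod_coprime_power[OF nd t(1)] by blast
  have "H.proj (t ^ n) \<odot> w1 = H.proj (h * b) \<odot> w1" unfolding gen_eq_iff n by (simp add: mult.commute)
  then have "H.proj (t ^ n) \<odot> w1 \<in> ?N" using w1 by (auto simp flip: smult_gen)
  moreover have "H.proj (t ^ m) \<odot> w1 \<in> ?N" if "H.proj (t ^ Suc m) \<odot> w1 \<in> ?N" for m
    using H.regular_sequence_second[OF W_module xs(2) len(2), of "H.proj (t ^ m) \<odot> w1"] that w1 h(2) t(2)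
    by (simp add: smult_gen)
  ultimately have "H.proj (t ^ 0) \<odot> w1 \<in> ?N"
    by (induction n) blast+
  then have "w1 \<in> ?N" using w1 by (simp add: H.proj_1)
  then show False using mult_not_surj[OF h(1)] by simp
qed

lemma mcm: "max_cohen_macaulay H.R W"
proof -
  have "module_depth H.R W = 1"
    unfolding module_depth_def
  proof (rule antisym)
    show "Sup {enat (length xs) | xs. set xs \<subseteq> max_ideal H.R \<and> regular_sequence H.R W xs} \<le> 1"
      using no_regular_pair by (intro Sup_least) (auto simp: one_enat_def)
    have "(\<lambda>v. H.proj py \<odot> v) ` carrier W \<noteq> carrier W" using mult_not_surj[OF py_mpow] w1 by blast
    then have "regular_sequence H.R W [H.proj py]"
      by (intro H.regular_sequence_singleton[OF W_module py_regular])
    moreover have "set [H.proj (py :: 'k fps fps)] \<subseteq> max_ideal H.R"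
      using imageI[OF py_mpow, of "H.proj :: 'k fps fps \<Rightarrow> _"] by (simp add: H.max_ideal_R)
    ultimately show "1 \<le> Sup {enat (length xs) | xs. set xs \<subseteq> max_ideal H.R \<and> regular_sequence H.R W xs}"
      by (intro Sup_upper CollectI exI[of _ "[H.proj py]"] conjI) (simp_all add: one_enat_def)
  qed
  then show ?thesis by (simp add: max_cohen_macaulay_def fin_gen krull_dim_arrangement)
qed

text \<open>The product of the lines \<open>x + \<alpha>y = 0\<close> kills the module, but it kills no element of a basis of a free module.\<close>

lemma no_free: "no_free_summand H.R W"
  unfolding no_free_summand_def
proof clarify
  fix F N :: "'w set" and n :: nat
  assume F: "submodule F H.R W" and n: "1 \<le> n"
    and "mod_isomorphic H.R (W\<lparr>carrier := F\<rparr>) (free_module H.R n)"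
  then obtain \<theta> where \<theta>: "\<theta> \<in> mod_hom H.R (W\<lparr>carrier := F\<rparr>) (free_module H.R n)"
    "bij_betw \<theta> F (carrier (free_module H.R n))" by (auto simp: mod_isomorphic_def)
  have sm: "\<theta> (H.proj s \<odot> u) = (\<lambda>i\<in>{..<n}. H.proj s \<otimes>\<^bsub>H.R\<^esub> \<theta> u i)" if "u \<in> F" for s u
    using \<theta>(1) that by (auto simp: mod_hom_def free_module_def)
  let ?e = "\<lambda>i\<in>{..<n}. H.proj (1 :: 'k fps fps)"
  have "?e \<in> carrier (free_module H.R n)" by (auto simp: free_module_def)
  then obtain u where u: "u \<in> F" "\<theta> u = ?e" using \<theta>(2) by (metis bij_betw_imp_surj_on imageE)
  have "u \<in> carrier W" using u submoduleE(1)[OF F] by blast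
  then obtain s where s: "u = H.proj s \<odot> w1" by (auto simp: gen)
  have "H.proj line_prod \<odot> u = H.proj 0 \<odot> u" unfolding s smult_gen gen_eq_iff by simp
  then have "\<theta> (H.proj line_prod \<odot> u) 0 = \<theta> (H.proj 0 \<odot> u) 0" by simp
  then have "H.proj (line_prod :: 'k fps fps) = H.proj 0"
    unfolding sm[OF u(1)] u(2) using n by (simp flip: H.proj_mult)
  then have "arrangement dvd (line_prod :: 'k fps fps)" by (simp add: H.proj_eq_iff)
  then show False using py_not_dvd_line_prod unfolding arrangement_def by (metis dvd_mult_left)
qed

lemma covers:
  assumes n: "n \<le> CARD('k)"
  shows "\<exists>h. h \<in> mod_hom H.R (direct_sum_module W (free_module H.R 0)) (H.res_module n) \<and>
    h ` carrier (direct_sum_module W (free_module H.R 0)) = carrier (H.res_module n)"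
proof -
  define \<phi> where "\<phi> w = H.res n (SOME s. w = H.proj s \<odot> w1)" for w
  have \<phi>: "\<phi> (H.proj s \<odot> w1) = H.res n s" for s
  proof -
    have "H.proj s \<odot> w1 = H.proj (SOME t. H.proj s \<odot> w1 = H.proj t \<odot> w1) \<odot> w1"
      by (rule someI[of "\<lambda>t. H.proj s \<odot> w1 = H.proj t \<odot> w1" s]) simp
    then have "line_prod dvd s - (SOME t. H.proj s \<odot> w1 = H.proj t \<odot> w1)" unfolding gen_eq_iff[of s] .
    then obtain c where "s - (SOME t. H.proj s \<odot> w1 = H.proj t \<odot> w1) = line_prod * c" by (auto simp: dvd_def)
    moreover have "line_prod * c \<in> mpow n" by (intro mpow_mult_right mpow_mono[OF n line_prod_mpow])
    ultimately have "s - (SOME t. H.proj s \<odot> w1 = H.proj t \<odot> w1) \<in> mpow n" by simp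
    then show ?thesis unfolding \<phi>_def by (rule H.res_eqI[symmetric])
  qed
  have add: "\<phi> (v \<oplus>\<^bsub>W\<^esub> w) = \<phi> v \<oplus>\<^bsub>H.res_module n\<^esub> \<phi> w" if "v \<in> carrier W" "w \<in> carrier W" for v w
  proof -
    from that obtain s t where "v = H.proj s \<odot> w1" "w = H.proj t \<odot> w1" by (auto simp: gen)
    moreover from this have "v \<oplus>\<^bsub>W\<^esub> w = H.proj (s + t) \<odot> w1" using w1 by (simp add: H.proj_add smult_l_distr)
    ultimately show ?thesis by (simp add: \<phi> H.res_add)
  qed
  have smult: "\<phi> (a \<odot> w) = a \<odot>\<^bsub>H.res_module n\<^esub> \<phi> w" if "a \<in> carrier H.R" "w \<in> carrier W" for a w
    using that by (auto simp: gen H.carrier_R smult_gen \<phi> H.res_smult)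
  have img: "\<phi> ` carrier W = carrier (H.res_module n)"
    unfolding H.res_carrier gen image_image \<phi> ..
  have "(\<lambda>(w, e). \<phi> w) \<in> mod_hom H.R (direct_sum_module W (free_module H.R 0)) (H.res_module n)"
    using add smult img by (auto simp: mod_hom_def direct_sum_module_def)
  moreover have "(\<lambda>(w, e). \<phi> w) ` carrier (direct_sum_module W (free_module H.R 0)) = carrier (H.res_module n)"
    using img by (auto simp: direct_sum_module_def free_module_def image_def)
  ultimately show ?thesis by blast
qed

end

text \<open>The ideal of \<open>R\<close> that is generated by \<open>y\<close> is such a module, since \<open>y s\<close> is divisible by \<open>f\<close> iff \<open>s\<close> is divisible by
  the product of the other lines.\<close>

lemma line_prod_module_exists:
  "\<exists>(W :: ('k::{field,finite} fps fps set, (nat \<Rightarrow> 'k fps fps set) set) module) w1. line_prod_module W w1"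
proof -
  let ?Y = "(\<lambda>w. H.proj py \<odot>\<^bsub>regular_module H.R\<^esub> w) ` carrier (regular_module (H.R :: 'k fps fps set ring))"
  let ?M = "(regular_module (H.R :: 'k fps fps set ring))\<lparr>carrier := ?Y\<rparr>"
  have Y: "?Y = range (\<lambda>s. H.proj (py * s))"
    unfolding H.regular_carrier image_image by (simp add: H.reg_ops)
  have "submodule ?Y H.R (regular_module (H.R :: 'k fps fps set ring))"
    by (rule H.reg.submodule_smult_image) simp
  then have M: "Module.module H.R ?M"
    by (rule submodule.submodule_is_module) (rule H.reg.module_axioms)
  obtain W :: "('k fps fps set, (nat \<Rightarrow> 'k fps fps set) set) module"
    where W: "Module.module H.R W" "mod_isomorphic H.R W ?M"
    using module_transport[OF M, of "\<lambda>r. {\<lambda>_. r}"] by (auto simp: inj_on_def fun_eq_iff)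
  interpret W: Module.module H.R W by (rule W(1))
  obtain \<theta> where \<theta>: "\<theta> \<in> mod_hom H.R W ?M" "bij_betw \<theta> (carrier W) ?Y"
    using W(2) by (auto simp: mod_isomorphic_def)
  have inj: "inj_on \<theta> (carrier W)" and img: "\<theta> ` carrier W = ?Y"
    using \<theta>(2) by (auto simp: bij_betw_def)
  have "H.proj py \<in> ?Y" unfolding Y by (rule range_eqI[of _ _ 1]) simp
  then obtain w1 where w1: "w1 \<in> carrier W" "\<theta> w1 = H.proj py" using img by (metis imageE)
  have \<theta>s: "\<theta> (H.proj s \<odot>\<^bsub>W\<^esub> w1) = H.proj (py * s)" for s
  proof -
    have "\<theta> (H.proj s \<odot>\<^bsub>W\<^esub> w1) = H.proj s \<odot>\<^bsub>regular_module H.R\<^esub> \<theta> w1"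
      using \<theta>(1) w1(1) by (auto simp: mod_hom_def)
    then show ?thesis by (simp add: w1(2) H.reg_ops mult.commute)
  qed
  have "line_prod_module W w1"
  proof (unfold_locales)
    show "w1 \<in> carrier W" by (rule w1(1))
    show "carrier W = range (\<lambda>s. H.proj s \<odot>\<^bsub>W\<^esub> w1)"
    proof
      show "carrier W \<subseteq> range (\<lambda>s. H.proj s \<odot>\<^bsub>W\<^esub> w1)"
      proof
        fix w assume w: "w \<in> carrier W"
        then have "\<theta> w \<in> ?Y" using img by blast
        then obtain s where "\<theta> w = \<theta> (H.proj s \<odot>\<^bsub>W\<^esub> w1)" unfolding Y \<theta>s by blast
        then have "w = H.proj s \<odot>\<^bsub>W\<^esub> w1" using inj_onD[OF inj] w w1(1) by simp
        then show "w \<in> range (\<lambda>s. H.proj s \<odot>\<^bsub>W\<^esub> w1)" by blast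
      qed
    qed (use w1 in auto)
    fix s :: "'k fps fps"
    have "H.proj s \<odot>\<^bsub>W\<^esub> w1 = \<zero>\<^bsub>W\<^esub> \<longleftrightarrow> H.proj s \<odot>\<^bsub>W\<^esub> w1 = H.proj 0 \<odot>\<^bsub>W\<^esub> w1"
      using w1(1) by (simp add: H.proj_0)
    also have "\<dots> \<longleftrightarrow> H.proj (py * s) = H.proj (py * 0)"
      unfolding \<theta>s[symmetric] using inj_on_eq_iff[OF inj, of "H.proj s \<odot>\<^bsub>W\<^esub> w1" "H.proj 0 \<odot>\<^bsub>W\<^esub> w1"] w1(1) by simp
    also have "\<dots> \<longleftrightarrow> line_prod dvd s" unfolding H.proj_eq_iff by (simp add: arrangement_def)
    finally show "H.proj s \<odot>\<^bsub>W\<^esub> w1 = \<zero>\<^bsub>W\<^esub> \<longleftrightarrow> line_prod dvd s" .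
  qed
  then show ?thesis by blast
qed

text \<open>Every \<open>R/n\<^sup>j\<close> is cyclic, so the zero module together with one free generator suffices.\<close>

lemma zero_module_cover:
  "\<exists>(W :: ('k::{field,finite} fps fps set, (nat \<Rightarrow> 'k fps fps set) set) module) h.
    max_cohen_macaulay H.R W \<and> no_free_summand H.R W \<and>
    h \<in> mod_hom H.R (direct_sum_module W (free_module H.R 1)) (H.res_module n) \<and>
    h ` carrier (direct_sum_module W (free_module H.R 1)) = carrier (H.res_module n)"
proof -
  define W :: "('k fps fps set, (nat \<Rightarrow> 'k fps fps set) set) module" where
    "W = \<lparr>carrier = {{}}, monoid.mult = undefined, one = undefined, ring.zero = {},
      add = (\<lambda>_ _. {}), module.smult = (\<lambda>_ _. {})\<rparr>"
  have "abelian_group W" by (rule abelian_groupI) (auto simp: W_def)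
  then have mod: "Module.module H.R W" by (rule moduleI[OF H.cring_R]) (auto simp: W_def)
  interpret W: Module.module H.R W by (rule mod)
  have "submodule_gen H.R W {} = carrier W"
  proof
    show "submodule_gen H.R W {} \<subseteq> carrier W" by (rule W.submodule_gen_closed) simp
    have "{} \<in> N" if "submodule N H.R W" for N
      using subgroup.one_closed[OF submodule.axioms(1)[OF that]] by (simp add: W_def)
    then show "carrier W \<subseteq> submodule_gen H.R W {}" by (auto simp: submodule_gen_def W_def)
  qed
  then have "max_cohen_macaulay H.R W"
    using mod by (auto simp: max_cohen_macaulay_def fin_gen_module_def W_def)
  moreover have "no_free_summand H.R W"
    unfolding no_free_summand_def
  proof clarify
    fix F N :: "(nat \<Rightarrow> 'k fps fps set) set set" and m :: nat
    assume F: "submodule F H.R W" and m: "1 \<le> m"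
      and "mod_isomorphic H.R (W\<lparr>carrier := F\<rparr>) (free_module H.R m)"
    then obtain \<theta> where "bij_betw \<theta> (carrier (W\<lparr>carrier := F\<rparr>)) (carrier (free_module (H.R :: 'k fps fps set ring) m))"
      unfolding mod_isomorphic_def by blast
    then have img: "\<theta> ` F = carrier (free_module (H.R :: 'k fps fps set ring) m)" by (simp add: bij_betw_def)
    have FW: "F \<subseteq> {{}}" using W.submoduleE(1)[OF F] by (simp add: W_def)
    have "(\<lambda>i\<in>{..<m}. H.proj s) = \<theta> {}" for s :: "'k fps fps"
    proof -
      have "(\<lambda>i\<in>{..<m}. H.proj s) \<in> \<theta> ` F" unfolding img by (auto simp: free_module_def)
      then show ?thesis using FW by auto
    qed
    then have "(\<lambda>i\<in>{..<m}. H.proj (0 :: 'k fps fps)) 0 = (\<lambda>i\<in>{..<m}. H.proj 1) 0" by metis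
    then have "arrangement dvd (1 :: 'k fps fps)" using m H.proj_eq_iff[of 1 "0 :: 'k fps fps"] by simp
    then obtain c where "arrangement * c = (1 :: 'k fps fps)" by (auto simp: dvd_def)
    then have "(1 :: 'k fps fps) \<in> mpow 1" using mpow_mult_right[OF H.f_mpow, of c] by (simp del: One_nat_def)
    then show False by (simp add: mpow_1_iff del: One_nat_def)
  qed
  moreover have "(\<lambda>(w, v). H.res n (SOME s. v 0 = H.proj s)) \<in>
      mod_hom H.R (direct_sum_module W (free_module H.R 1)) (H.res_module n) \<and>
    (\<lambda>(w, v). H.res n (SOME s. v 0 = H.proj s)) ` carrier (direct_sum_module W (free_module H.R 1))
      = carrier (H.res_module n)"
  proof -
    define \<phi> :: "'k fps fps set \<Rightarrow> 'k fps fps set set" where "\<phi> r = H.res n (SOME s. r = H.proj s)" for r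
    have \<phi>: "\<phi> (H.proj s) = H.res n s" for s
    proof -
      have "H.proj s = H.proj (SOME t. H.proj s = H.proj t)" by (rule someI[of "\<lambda>t. H.proj s = H.proj t" s]) simp
      then show ?thesis unfolding \<phi>_def H.res_def by simp
    qed
    have "\<phi> (r \<oplus>\<^bsub>H.R\<^esub> r') = \<phi> r \<oplus>\<^bsub>H.res_module n\<^esub> \<phi> r'" "\<phi> (r \<otimes>\<^bsub>H.R\<^esub> r') = r \<odot>\<^bsub>H.res_module n\<^esub> \<phi> r'"
      if "r \<in> carrier H.R" "r' \<in> carrier H.R" for r r'
      using that by (auto simp: H.carrier_R \<phi> H.res_add H.res_smult simp flip: H.proj_add H.proj_mult)
    moreover have "\<exists>s. \<phi> r = H.res n s" if "r \<in> carrier H.R" for r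
      using that by (auto simp: H.carrier_R \<phi>)
    moreover have "\<exists>x\<in>carrier W \<times> ({..<1::nat} \<rightarrow>\<^sub>E carrier H.R). H.res n s = \<phi> (snd x 0)" for s
      by (rule bexI[of _ "({}, \<lambda>i\<in>{..<1}. H.proj s)"]) (auto simp: \<phi> W_def)
    ultimately show ?thesis
      unfolding \<phi>_def[symmetric] mod_hom_def direct_sum_module_def free_module_def
      by (auto simp: H.res_carrier image_iff PiE_iff split_beta)
  qed
  ultimately show ?thesis by blast
qed

section \<open>The index\<close>

lemma delta_large: "delta_invariant (H.R :: 'k::{field,finite} fps fps set ring) (H.res_module (CARD('k) + 1)) = 1"
  unfolding delta_invariant_def one_enat_def
proof (rule Inf_enat_eq)
  show "\<exists>(W :: ('k fps fps set, (nat \<Rightarrow> 'k fps fps set) set) module) h.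
      max_cohen_macaulay H.R W \<and> no_free_summand H.R W \<and>
      h \<in> mod_hom H.R (direct_sum_module W (free_module H.R 1)) (H.res_module (CARD('k) + 1)) \<and>
      h ` carrier (direct_sum_module W (free_module H.R 1)) = carrier (H.res_module (CARD('k) + 1))"
    by (rule zero_module_cover)
  fix m assume ex: "\<exists>(W :: ('k fps fps set, (nat \<Rightarrow> 'k fps fps set) set) module) h.
      max_cohen_macaulay H.R W \<and> no_free_summand H.R W \<and>
      h \<in> mod_hom H.R (direct_sum_module W (free_module H.R m)) (H.res_module (CARD('k) + 1)) \<and>
      h ` carrier (direct_sum_module W (free_module H.R m)) = carrier (H.res_module (CARD('k) + 1))"
  show "1 \<le> m"
  proof (rule ccontr)
    assume "\<not> 1 \<le> m"
    then have m: "m = 0" by simp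
    from ex obtain W :: "('k fps fps set, (nat \<Rightarrow> 'k fps fps set) set) module" and h where
      W: "max_cohen_macaulay H.R W" "no_free_summand H.R W"
      and h: "h \<in> mod_hom H.R (direct_sum_module W (free_module H.R 0)) (H.res_module (CARD('k) + 1))"
      "h ` carrier (direct_sum_module W (free_module H.R 0)) = carrier (H.res_module (CARD('k) + 1))"
      unfolding m by blast
    define e :: "nat \<Rightarrow> 'k fps fps set" where "e = (\<lambda>_. undefined)"
    have C: "carrier (direct_sum_module W (free_module H.R 0)) = (\<lambda>w. (w, e)) ` carrier W"
      by (auto simp: direct_sum_module_def free_module_def e_def)
    have hom: "\<And>v w. v \<in> carrier W \<Longrightarrow> w \<in> carrier W \<Longrightarrow>
        h (v \<oplus>\<^bsub>W\<^esub> w, e) = h (v, e) \<oplus>\<^bsub>H.res_module (CARD('k) + 1)\<^esub> h (w, e)"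
      "\<And>a w. a \<in> carrier H.R \<Longrightarrow> w \<in> carrier W \<Longrightarrow>
        h (a \<odot>\<^bsub>W\<^esub> w, e) = a \<odot>\<^bsub>H.res_module (CARD('k) + 1)\<^esub> h (w, e)"
      using h(1) unfolding mod_hom_def C
      by (auto simp: direct_sum_module_def free_module_def restrict_def e_def)
    have "H.res (CARD('k) + 1) 1 \<in> h ` (\<lambda>w. (w, e)) ` carrier W"
      using h(2) unfolding C H.res_carrier by simp
    then obtain w0 where w0: "w0 \<in> carrier W" "h (w0, e) = H.res (CARD('k) + 1) 1" by auto
    have "h (w, e) \<in> carrier (H.res_module (CARD('k) + 1))" if "w \<in> carrier W" for w
      using h(2) that unfolding C by blast
    then show False
      by (rule no_mcm_cover[OF W, of "\<lambda>w. h (w, e)" w0]) (simp_all add: hom w0)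
  qed
qed

lemma delta_small:
  assumes n: "n \<le> CARD('k::{field,finite})"
  shows "delta_invariant (H.R :: 'k fps fps set ring) (H.res_module n) = 0"
  unfolding delta_invariant_def zero_enat_def
proof (rule Inf_enat_eq)
  obtain W :: "('k fps fps set, (nat \<Rightarrow> 'k fps fps set) set) module" and w1 where "line_prod_module W w1"
    using line_prod_module_exists by blast
  then interpret W: line_prod_module W w1 .
  show "\<exists>(W :: ('k fps fps set, (nat \<Rightarrow> 'k fps fps set) set) module) h.
      max_cohen_macaulay H.R W \<and> no_free_summand H.R W \<and>
      h \<in> mod_hom H.R (direct_sum_module W (free_module H.R 0)) (H.res_module n) \<and>
      h ` carrier (direct_sum_module W (free_module H.R 0)) = carrier (H.res_module n)"
    using W.mcm W.no_free W.covers[OF n] by blast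
qed simp

lemma ring_index_arrangement: "ring_index (H.R :: 'k::{field,finite} fps fps set ring) = enat (CARD('k) + 1)"
  unfolding ring_index_def H.ideal_power_R
proof (rule Inf_enat_eq)
  show "CARD('k) + 1 \<ge> 1 \<and> delta_invariant (H.R :: 'k fps fps set ring) (H.res_module (CARD('k) + 1)) = 1"
    using delta_large by simp
  fix m assume m: "m \<ge> 1 \<and> delta_invariant (H.R :: 'k fps fps set ring) (H.res_module m) = 1"
  show "CARD('k) + 1 \<le> m"
  proof (rule ccontr)
    assume "\<not> ?thesis"
    then have "delta_invariant (H.R :: 'k fps fps set ring) (H.res_module m) = 0" by (intro delta_small) simp
    then show False using m by simp
  qed
qed

theorem proposition3p5:
  fixes x y :: "'k::{field, finite} fps fps"
    and R :: "'k fps fps set ring"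
  assumes "x = fps_const fps_X"
    and "y = fps_X"
    and "R = ring_of_type_algebra Quot
      (PIdl\<^bsub>ring_of_type_algebra\<^esub> (y * (\<Prod>\<alpha>\<in>UNIV. x + fps_const (fps_const \<alpha>) * y)))"
  shows "gen_loewy_length R = ring_index R + 1 \<and> ring_index R + 1 = enat (card (UNIV :: 'k set) + 2)"
proof -
  have "y * (\<Prod>\<alpha>\<in>UNIV. x + fps_const (fps_const \<alpha>) * y) = arrangement"
    unfolding assms(1,2) arrangement_def line_prod_def ..
  then have "R = H.R" unfolding assms(3) H.R_def by (simp only:)
  then show ?thesis by (simp add: gen_loewy_length_arrangement ring_index_arrangement one_enat_def)
qed

end
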